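(* Let $G$, $H_0$, $V=vUv^*$, $H=H_0+V$, $R(\kappa)=(H+\kappa^2)^{-1}$ be as in the context, and assume that $V$ satisfies the assumption $(\mathrm A_\beta)$ of the context for some integer $\beta\ge3$. Assume that the threshold $0$ is an exceptional point of the first kind, i.e. $\mathcal E\supsetneq\mathsf E=\{0\}$. Let $G_j$ be the coefficients in the asymptotic expansion $R(\kappa)=\sum_{j=-1}^{\beta-4}\kappa^jG_j+\mathcal O(\kappa^{\beta-3})$ in $\mathcal B^{\beta-1}$ as $\kappa\to0$, $\mathop{\mathrm{Re}}\kappa>0$. Then (each formula being asserted when the coefficient occurs in the expansion) $$\begin{aligned}G_0&=G_{0,0}-\mathcal PVG_{0,1}-G_{0,1}V\mathcal P-\bigl(G_{0,0}-\mathcal PVG_{0,1}\bigr)vM_0^\dagger v^*\bigl(G_{0,0}-G_{0,1}V\mathcal P\bigr)+\mathcal PVG_{0,2}V\mathcal P,\\ G_1&=-\widetilde{\mathcal P}+\mathcal PVG_{0,3}V\mathcal P+\mathcal PVG_{0,2}V\mathcal PVG_{0,2}V\mathcal P\\ &\quad-\bigl[I-\bigl(G_{0,0}-\mathcal PVG_{0,1}\bigr)vM_0^\dagger v^*\bigr]\bigl(I+G_{0,1}V\mathcal PV\bigr)G_{0,2}V\mathcal P\\ &\quad-\mathcal PVG_{0,2}\bigl(I+V\mathcal PVG_{0,1}\bigr)\bigl[I-vM_0^\dagger v^*\bigl(G_{0,0}-G_{0,1}V\mathcal P\bigr)\bigr].\end{aligned}$$ Here $\widetilde{\mathcal P}=\sum_{\widetilde\gamma}|\Psi_{\widetilde\gamma}\rangle\langle\Psi_{\widetilde\gamma}|$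 with $$\Psi_{\widetilde\gamma}=\bigl[I-\bigl(G_{0,0}-\mathcal PVG_{0,1}\bigr)vM_0^\dagger v^*\bigr]\mathbf n_{\widetilde\gamma},$$ where $\mathbf n_{\widetilde\gamma}$ is as in the context, and $\{\Psi_{\widetilde\gamma}\}$ is an orthonormal non-resonance basis (so $\widetilde{\mathcal P}$ is the associated orthogonal non-resonance projection). In particular, for any $\Psi_1\in\widetilde{\mathcal E}$ and $\Psi_2\in\mathcal E$ with $\Psi_1-\sum_{\alpha=1}^Nc_\alpha^{(1)}\mathbf n^{(\alpha)}\in\mathbb C\mathbf 1\oplus\mathcal L^{\beta-2}$ and $\Psi_2-\sum_{\alpha=1}^Nc_\alpha^{(2)}\mathbf 1^{(\alpha)}\in\mathcal L^{\beta-2}$ one has $\sum_{\alpha=1}^N\overline{c_\alpha^{(2)}}\,c_\alpha^{(1)}=0$.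
   Context: Graph. Let $(K,E_0)$ be a connected, finite, undirected, simple graph (no loops, no multiple edges), and for $\alpha=1,\dots,N$ let $(L_\alpha,E_\alpha)$ be a copy of the discrete half-line, $L_\alpha=\{1,2,\dots\}$, $E_\alpha=\{\{n,n+1\}: n\in L_\alpha\}$. Fix vertices $x_1,\dots,x_N\in K$ (not necessarily distinct). Let $G=K\cup L_1\cup\dots\cup L_N$ (disjoint union), with edges those of $E_0,E_1,\dots,E_N$ together with $\{x_\alpha,1^{(\alpha)}\}$, $\alpha=1,\dots,N$, where $1^{(\alpha)}$ is the point $1\in L_\alpha$. Free operator. For $u\colon K\to\mathbb C$ set $(h_0u)[x]=\sum_{y\in K,\{x,y\}\in E_0}(u[x]-u[y])+\sum_{\alpha=1}^Ns_\alpha[x]u[x]$, where $s_\alpha[x]=1$ if $x=x_\alpha$ and $0$ otherwise. For $u\colon L_\alpha\to\mathbb C$ set $(h_\alpha u)[1]=2u[1]-u[2]$ and $(h_\alpha u)[n]=2u[n]-u[n+1]-u[n-1]$ for $n\ge2$. Let $H_0=h_0\oplus h_1\oplus\dots\oplus h_N$, acting on all functions on $G$ decomposed as functions on $K,L_1,\dots,L_N$; on $\mathcal H=\ell^2(G)$ it is bounded and self-adjoint. The operator $h_0$ is invertible. Spaces. For $s\in\mathbb R$, $\mathcal L^s=\ell^{1,s}(G)$ is the space of $u\colon G\to\mathbb C$ with $\sum_{x\in K}|u[x]|+\sum_{\alpha}\sum_{n\in L_\alpha}(1+n^2)^{s/2}|u[n]|<\infty$; its dual $(\mathcal L^s)^*=\ell^{\infty,-s}(G)$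 is the space of $u$ with $\sup_{x\in K}|u[x]|<\infty$ and $\sup_{n\in L_\alpha}(1+n^2)^{-s/2}|u[n]|<\infty$ for all $\alpha$. Put $\mathcal B^s=\mathcal B(\mathcal L^s,(\mathcal L^s)^* )$. $\langle u,w\rangle=\sum_{x\in G}\overline{u[x]}w[x]$ whenever this converges absolutely, and $|\Psi\rangle\langle\Phi|$ is the operator $u\mapsto\langle\Phi,u\rangle\Psi$. $(\Phi\cdot\Psi)[x]=\Phi[x]\Psi[x]$ is the pointwise product. Assumption $(\mathrm A_\beta)$, $\beta\ge1$: $V\in\mathcal B(\mathcal H)$ is self-adjoint, and there exist a Hilbert space $\mathcal K$, an injective operator $v\in\mathcal B(\mathcal K,\mathcal L^\beta)$ and a self-adjoint unitary operator $U\in\mathcal B(\mathcal K)$ such that $V=vUv^*\in\mathcal B((\mathcal L^\beta)^*,\mathcal L^\beta)$; such $\mathcal K,v,U$ are fixed. Put $H=H_0+V$ and $R(\kappa)=(H+\kappa^2)^{-1}$ for $-\kappa^2\notin\sigma(H)$. Free coefficients. $G_{0,j}=g_{0,j}\oplus g_{1,j}\oplus\dots\oplus g_{N,j}$ for $j$ even and $G_{0,j}=0\oplus g_{1,j}\oplus\dots\oplus g_{N,j}$ for $j$ odd, where $g_{0,2i}=(-1)^ih_0^{-i-1}$ on functions on $K$ and, for $\alpha\ge1$, $g_{\alpha,j}$ is given on $L_\alpha$ by the kernels (with $n\wedge m=\min\{n,m\}$, $n\vee m=\max\{n,m\}$): $g_{\alpha,0}[n,m]=n\wedge m$, $g_{\alpha,1}[n,m]=-nm$,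 $g_{\alpha,2}[n,m]=-\frac16(n\wedge m)+\frac16(n\wedge m)^3+\frac12nm(n\vee m)$, $g_{\alpha,3}[n,m]=\frac5{24}nm-\frac16n^3m-\frac16nm^3$. $M_0=U+v^*G_{0,0}v\in\mathcal B(\mathcal K)$ (self-adjoint), and $M_0^\dagger$ is its pseudo-inverse: zero on $\mathop{\mathrm{Ker}}M_0$ and the inverse of $M_0|_{(\mathop{\mathrm{Ker}}M_0)^\perp}$ on $(\mathop{\mathrm{Ker}}M_0)^\perp$. Eigenspaces. Let $\mathbf n^{(\alpha)}[x]=m$ if $x=m\in L_\alpha$ and $0$ otherwise; $\mathbf 1^{(\alpha)}[x]=1$ if $x\in L_\alpha$ and $0$ otherwise; $\mathbb C\mathbf n=\bigoplus_\alpha\mathbb C\mathbf n^{(\alpha)}$, $\mathbb C\mathbf 1=\bigoplus_\alpha\mathbb C\mathbf 1^{(\alpha)}$. Define $\widetilde{\mathcal E}=\{\Psi\in(\mathcal L^\beta)^*: H\Psi=0\}$, $\mathcal E=\widetilde{\mathcal E}\cap(\mathbb C\mathbf 1\oplus\mathcal L^{\beta-2})$, $\mathsf E=\widetilde{\mathcal E}\cap\mathcal L^{\beta-2}$. Projections. A set $\{\Psi_\gamma\}\subset\mathcal E$ is an orthonormal resonance basis if the classes $[\Psi_\gamma]$ form a basis of $\mathcal E/\mathsf E$, for every $\gamma$ and $\Psi\in\mathsf E$ one has $\overline\Psi\cdot\Psi_\gamma\in\mathcal L^0$ and $\langle\Psi,\Psi_\gamma\rangle=0$, and there is an orthonormal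 system $\{c^{(\gamma)}\}\subset\mathbb C^N$ with $\Psi_\gamma-\sum_\alpha c^{(\gamma)}_\alpha\mathbf 1^{(\alpha)}\in\mathcal L^{\beta-2}$ for every $\gamma$. The orthogonal resonance projection is $\mathcal P=\sum_\gamma|\Psi_\gamma\rangle\langle\Psi_\gamma|$ (independent of the choice of basis). A set $\{\Psi_{\gamma}\}\subset\widetilde{\mathcal E}$ is an orthonormal non-resonance basis if the classes form a basis of $\widetilde{\mathcal E}/\mathcal E$, for every $\gamma$ and $\Psi\in\mathsf E$ one has $\overline\Psi\cdot\Psi_\gamma\in\mathcal L^0$ and $\langle\Psi,\Psi_\gamma\rangle=0$, and there is an orthonormal system $\{c^{(\gamma)}\}\subset\mathbb C^N$ with $\Psi_\gamma-\sum_\alpha c_\alpha^{(\gamma)}\mathbf n^{(\alpha)}\in\mathbb C\mathbf 1\oplus\mathcal L^{\beta-2}$ for every $\gamma$; the associated orthogonal non-resonance projection is $\sum_\gamma|\Psi_\gamma\rangle\langle\Psi_\gamma|$. Notation $\mathbf n_{\widetilde\gamma}$. Let $\{\Psi_\gamma\}\subset\mathcal E$ be an orthonormal resonance basis and set $c^{(\gamma)}_\alpha=-\langle\mathbf n^{(\alpha)},V\Psi_\gamma\rangle$; then $\{c^{(\gamma)}\}\subset\mathbb C^N$ is an orthonormal system. Take an orthonormal system $\{c^{(\widetilde\gamma)}\}\subset\mathbb C^N$ such that $\{c^{(\gamma)}\}\cup\{c^{(\widetilde\gamma)}\}$ is an orthonormal basis of $\mathbb C^N$, and put $\mathbf n_{\widetilde\gamma}=\sum_{\alpha=1}^Nc_\alpha^{(\widetilde\gamma)}\mathbf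 n^{(\alpha)}$. *)

theory Defs
  imports "HOL-Analysis.Analysis" "HOL-Library.Function_Algebras"
begin

section \<open>Complex vector spaces and Hilbert spaces\<close>

class complex_vector = ab_group_add +
  fixes scaleC :: "complex \<Rightarrow> 'a \<Rightarrow> 'a"  (infixr "*\<^sub>C" 75)
  assumes scaleC_add_right: "c *\<^sub>C (x + y) = c *\<^sub>C x + c *\<^sub>C y"
    and scaleC_add_left: "(c + d) *\<^sub>C x = c *\<^sub>C x + d *\<^sub>C x"
    and scaleC_scaleC: "c *\<^sub>C d *\<^sub>C x = (c * d) *\<^sub>C x"
    and scaleC_one: "1 *\<^sub>C x = x"

instantiation complex :: complex_vector
begin
definition scaleC_complex_def: "c *\<^sub>C (z::complex) = c * z"
instance by standard (simp_all add: scaleC_complex_def algebra_simps)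
end

instantiation "fun" :: (type, complex_vector) complex_vector
begin
definition scaleC_fun_def: "c *\<^sub>C f = (\<lambda>x. c *\<^sub>C f x)"
instance
  by standard (simp_all add: scaleC_fun_def fun_eq_iff scaleC_add_right scaleC_add_left
      scaleC_scaleC scaleC_one)
end

text \<open>The inner product is antilinear in its first argument; completeness comes from
  \<^class>\<open>banach\<close>.  Positive definiteness follows from the last axiom.\<close>

class complex_hilbert = complex_vector + banach +
  fixes cinner :: "'a \<Rightarrow> 'a \<Rightarrow> complex"
  assumes scaleR_scaleC: "r *\<^sub>R x = complex_of_real r *\<^sub>C x"
    and cinner_commute: "cinner x y = cnj (cinner y x)"
    and cinner_add_right: "cinner x (y + z) = cinner x y + cinner x z"
    and cinner_scaleC_right: "cinner x (c *\<^sub>C y) = c * cinner x y"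
    and norm_eq_sqrt_cinner: "norm x = sqrt (Re (cinner x x))"

definition clinear_on :: "'a::complex_vector set \<Rightarrow> ('a \<Rightarrow> 'b::complex_vector) \<Rightarrow> bool" where
  "clinear_on S f \<longleftrightarrow> (\<forall>x\<in>S. \<forall>y\<in>S. f (x + y) = f x + f y) \<and> (\<forall>x\<in>S. \<forall>c. f (c *\<^sub>C x) = c *\<^sub>C f x)"

definition selfadjoint_unitary :: "('k::complex_hilbert \<Rightarrow> 'k) \<Rightarrow> bool" where
  "selfadjoint_unitary U \<longleftrightarrow> clinear_on UNIV U \<and>
     (\<forall>x y. cinner x (U y) = cinner (U x) y) \<and>
     (\<forall>x y. cinner (U x) (U y) = cinner x y) \<and> surj U"

definition kernel :: "('a \<Rightarrow> 'b::zero) \<Rightarrow> 'a set" where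
  "kernel M = {x. M x = 0}"

definition orth_compl :: "'k::complex_hilbert set \<Rightarrow> 'k set" where
  "orth_compl S = {x. \<forall>y\<in>S. cinner y x = 0}"

text \<open>The conditions below determine the operator uniquely when the space is the sum of \<open>kernel M\<close> and
  its orthogonal complement, which holds for bounded \<open>M\<close>.\<close>

definition pseudo_inverse :: "('k::complex_hilbert \<Rightarrow> 'k) \<Rightarrow> 'k \<Rightarrow> 'k" where
  "pseudo_inverse M = (THE D. clinear_on UNIV D \<and> (\<forall>x\<in>kernel M. D x = 0) \<and>
     (\<forall>x\<in>orth_compl (kernel M). D x \<in> orth_compl (kernel M) \<and> M (D x) = x \<and> D (M x) = x))"

abbreviation op_comp :: "('b \<Rightarrow> 'c) \<Rightarrow> ('a \<Rightarrow> 'b) \<Rightarrow> 'a \<Rightarrow> 'c"  (infixl "\<odot>" 70) where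
  "A \<odot> B \<equiv> A \<circ> B"


section \<open>The graph and functions on it\<close>

text \<open>The vertices of $K$ are the elements of the finite type \<open>'v\<close>, the half-lines are indexed by the
  finite type \<open>'n\<close>.  Since the half-lines start at 1, \<open>Lead \<alpha> k\<close> stands for the point $k + 1$ of
  $L_\alpha$; \<open>pos k\<close> is the coordinate of that point.\<close>

datatype ('v, 'n) vertex = Core 'v | Lead 'n nat

type_synonym ('v, 'n) state = "('v, 'n) vertex \<Rightarrow> complex"
type_synonym ('v, 'n) op = "('v, 'n) state \<Rightarrow> ('v, 'n) state"

definition pos :: "nat \<Rightarrow> real" where
  "pos k = real (Suc k)"

definition connected_simple_graph :: "'v set set \<Rightarrow> bool" where
  "connected_simple_graph E0 \<longleftrightarrow> (\<forall>e\<in>E0. card e = 2) \<and> (\<forall>x y. (\<lambda>a b. {a, b} \<in> E0)\<^sup>*\<^sup>* x y)"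

definition weight :: "real \<Rightarrow> ('v, 'n) vertex \<Rightarrow> real" where
  "weight s x = (case x of Core _ \<Rightarrow> 1 | Lead _ k \<Rightarrow> (1 + (pos k)\<^sup>2) powr (s / 2))"

definition ell1 :: "real \<Rightarrow> ('v, 'n) state set" where
  "ell1 s = {u. (\<lambda>x. weight s x * cmod (u x)) summable_on UNIV}"

definition ell1_norm :: "real \<Rightarrow> ('v, 'n) state \<Rightarrow> real" where
  "ell1_norm s u = (\<Sum>\<^sub>\<infinity>x. weight s x * cmod (u x))"

definition ell1_dual :: "real \<Rightarrow> ('v, 'n) state set" where
  "ell1_dual s = {u. bdd_above (range (\<lambda>x. weight (- s) x * cmod (u x)))}"

definition ell1_dual_norm :: "real \<Rightarrow> ('v, 'n) state \<Rightarrow> real" where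
  "ell1_dual_norm s u = (SUP x. weight (- s) x * cmod (u x))"

definition ell2 :: "('v, 'n) state set" where
  "ell2 = {u. (\<lambda>x. (cmod (u x))\<^sup>2) summable_on UNIV}"

definition ell2_norm :: "('v, 'n) state \<Rightarrow> real" where
  "ell2_norm u = sqrt (\<Sum>\<^sub>\<infinity>x. (cmod (u x))\<^sup>2)"

definition pairing :: "('v, 'n) state \<Rightarrow> ('v, 'n) state \<Rightarrow> complex"  ("\<langle>_, _\<rangle>") where
  "\<langle>u, w\<rangle> = (\<Sum>\<^sub>\<infinity>x. cnj (u x) * w x)"

definition ketbra :: "('v, 'n) state \<Rightarrow> ('v, 'n) state \<Rightarrow> ('v, 'n) op" where
  "ketbra \<Psi> \<Phi> u = \<langle>\<Phi>, u\<rangle> *\<^sub>C \<Psi>"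

definition bounded_by :: "real \<Rightarrow> real \<Rightarrow> ('v, 'n) op \<Rightarrow> bool" where
  "bounded_by s C A \<longleftrightarrow> clinear_on (ell1 s) A \<and>
     (\<forall>u\<in>ell1 s. A u \<in> ell1_dual s \<and> ell1_dual_norm s (A u) \<le> C * ell1_norm s u)"

definition bounded_ell2 :: "('v, 'n) op \<Rightarrow> bool" where
  "bounded_ell2 A \<longleftrightarrow> clinear_on ell2 A \<and>
     (\<exists>C. \<forall>u\<in>ell2. A u \<in> ell2 \<and> ell2_norm (A u) \<le> C * ell2_norm u)"

definition selfadjoint_ell2 :: "('v, 'n) op \<Rightarrow> bool" where
  "selfadjoint_ell2 A \<longleftrightarrow> (\<forall>u\<in>ell2. \<forall>w\<in>ell2. \<langle>u, A w\<rangle> = \<langle>A u, w\<rangle>)"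

definition spectrum :: "('v, 'n) op \<Rightarrow> complex set" where
  "spectrum A = {z. \<not> (bij_betw (A - z *\<^sub>C id) ell2 ell2 \<and>
     (\<exists>C. \<forall>u\<in>ell2. ell2_norm u \<le> C * ell2_norm ((A - z *\<^sub>C id) u)))}"

definition resolvent :: "('v, 'n) op \<Rightarrow> complex \<Rightarrow> ('v, 'n) op" where
  "resolvent H \<kappa> = inv_into ell2 (H + \<kappa>\<^sup>2 *\<^sub>C id)"


section \<open>The free operator and its resolvent coefficients\<close>

definition core_ham :: "'v::finite set set \<Rightarrow> ('n::finite \<Rightarrow> 'v) \<Rightarrow> ('v \<Rightarrow> complex) \<Rightarrow> 'v \<Rightarrow> complex" where
  "core_ham E0 xs u x =
     (\<Sum>y | {x, y} \<in> E0. u x - u y) + (\<Sum>\<alpha>\<in>UNIV. (if x = xs \<alpha> then 1 else 0) * u x)"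

definition lead_ham :: "(nat \<Rightarrow> complex) \<Rightarrow> nat \<Rightarrow> complex" where
  "lead_ham u k = (case k of 0 \<Rightarrow> 2 * u 0 - u 1 | Suc l \<Rightarrow> 2 * u k - u (Suc k) - u l)"

definition direct_sum :: "(('v \<Rightarrow> complex) \<Rightarrow> 'v \<Rightarrow> complex) \<Rightarrow>
    ((nat \<Rightarrow> complex) \<Rightarrow> nat \<Rightarrow> complex) \<Rightarrow> ('v, 'n) op" where
  "direct_sum A B u x =
     (case x of Core y \<Rightarrow> A (\<lambda>z. u (Core z)) y | Lead \<alpha> k \<Rightarrow> B (\<lambda>l. u (Lead \<alpha> l)) k)"

definition free_ham :: "'v::finite set set \<Rightarrow> ('n::finite \<Rightarrow> 'v) \<Rightarrow> ('v, 'n) op" where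
  "free_ham E0 xs = direct_sum (core_ham E0 xs) lead_ham"

text \<open>Only the kernels for $j \le 3$ are given; the value 0 for larger \<open>j\<close> is a dummy.\<close>

definition lead_kernel :: "nat \<Rightarrow> real \<Rightarrow> real \<Rightarrow> real" where
  "lead_kernel j n m =
    (if j = 0 then min n m
     else if j = 1 then - (n * m)
     else if j = 2 then - (1/6) * min n m + (1/6) * (min n m) ^ 3 + (1/2) * n * m * max n m
     else if j = 3 then (5/24) * n * m - (1/6) * n ^ 3 * m - (1/6) * n * m ^ 3
     else 0)"

definition core_coeff :: "'v::finite set set \<Rightarrow> ('n::finite \<Rightarrow> 'v) \<Rightarrow> nat \<Rightarrow>
    ('v \<Rightarrow> complex) \<Rightarrow> 'v \<Rightarrow> complex" where
  "core_coeff E0 xs j =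
     (if even j then (- 1) ^ (j div 2) *\<^sub>C (inv (core_ham E0 xs) ^^ (j div 2 + 1)) else 0)"

definition free_coeff :: "'v::finite set set \<Rightarrow> ('n::finite \<Rightarrow> 'v) \<Rightarrow> nat \<Rightarrow> ('v, 'n) op" where
  "free_coeff E0 xs j = direct_sum (core_coeff E0 xs j)
     (\<lambda>u k. \<Sum>\<^sub>\<infinity>l. complex_of_real (lead_kernel j (pos k) (pos l)) * u l)"


section \<open>The perturbation\<close>

text \<open>The adjoint of $v \colon \mathcal K \to \ell^{1,\beta}$, as a map
  $\ell^{\infty,-\beta} \to \mathcal K$, where $\mathcal K$ is identified with its dual.\<close>

definition adjoint_of :: "('k::complex_hilbert \<Rightarrow> ('v, 'n) state) \<Rightarrow> ('v, 'n) state \<Rightarrow> 'k" where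
  "adjoint_of v u = (THE k. \<forall>\<phi>. cinner k \<phi> = \<langle>u, v \<phi>\<rangle>)"

definition assumption_A :: "real \<Rightarrow> ('v, 'n) op \<Rightarrow> ('k::complex_hilbert \<Rightarrow> ('v, 'n) state) \<Rightarrow>
    ('k \<Rightarrow> 'k) \<Rightarrow> bool" where
  "assumption_A \<beta> V v U \<longleftrightarrow>
     bounded_ell2 V \<and> selfadjoint_ell2 V \<and>
     clinear_on UNIV v \<and> (\<exists>C. \<forall>\<phi>. v \<phi> \<in> ell1 \<beta> \<and> ell1_norm \<beta> (v \<phi>) \<le> C * norm \<phi>) \<and> inj v \<and>
     selfadjoint_unitary U \<and>
     (\<forall>u\<in>ell1_dual \<beta>. V u = v (U (adjoint_of v u)))"

definition resolvent_expansion :: "nat \<Rightarrow> ('v, 'n) op \<Rightarrow> (int \<Rightarrow> ('v, 'n) op) \<Rightarrow> bool" where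
  "resolvent_expansion \<beta> H G \<longleftrightarrow>
     (\<forall>j\<in>{-1..int \<beta> - 4}. \<exists>C. bounded_by (real \<beta> - 1) C (G j)) \<and>
     (\<exists>C. \<forall>\<^sub>F \<kappa> in at 0 within {\<kappa>. Re \<kappa> > 0}. - (\<kappa>\<^sup>2) \<notin> spectrum H \<and>
        bounded_by (real \<beta> - 1) (C * cmod \<kappa> ^ (\<beta> - 3))
          (resolvent H \<kappa> - (\<Sum>j\<in>{-1..int \<beta> - 4}. (\<kappa> powi j) *\<^sub>C G j)))"


section \<open>Eigenspaces and projections\<close>

definition n_vec :: "'n \<Rightarrow> ('v, 'n) state" where
  "n_vec \<alpha> x = (case x of Core _ \<Rightarrow> 0 | Lead \<alpha>' k \<Rightarrow> if \<alpha>' = \<alpha> then of_real (pos k) else 0)"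

definition one_vec :: "'n \<Rightarrow> ('v, 'n) state" where
  "one_vec \<alpha> x = (case x of Core _ \<Rightarrow> 0 | Lead \<alpha>' _ \<Rightarrow> if \<alpha>' = \<alpha> then 1 else 0)"

definition n_comb :: "complex ^ 'n \<Rightarrow> ('v, 'n::finite) state" where
  "n_comb c = (\<Sum>\<alpha>\<in>UNIV. (c $ \<alpha>) *\<^sub>C n_vec \<alpha>)"

definition one_comb :: "complex ^ 'n \<Rightarrow> ('v, 'n::finite) state" where
  "one_comb c = (\<Sum>\<alpha>\<in>UNIV. (c $ \<alpha>) *\<^sub>C one_vec \<alpha>)"

definition one_plus_ell1 :: "real \<Rightarrow> ('v, 'n::finite) state set" where
  "one_plus_ell1 s = {one_comb c + u | c u. u \<in> ell1 s}"

definition gen_eigenspace :: "real \<Rightarrow> ('v, 'n) op \<Rightarrow> ('v, 'n) state set" where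
  "gen_eigenspace \<beta> H = {\<Psi> \<in> ell1_dual \<beta>. H \<Psi> = 0}"

definition bdd_eigenspace :: "real \<Rightarrow> ('v, 'n::finite) op \<Rightarrow> ('v, 'n) state set" where
  "bdd_eigenspace \<beta> H = gen_eigenspace \<beta> H \<inter> one_plus_ell1 (\<beta> - 2)"

definition eigenspace :: "real \<Rightarrow> ('v, 'n) op \<Rightarrow> ('v, 'n) state set" where
  "eigenspace \<beta> H = gen_eigenspace \<beta> H \<inter> ell1 (\<beta> - 2)"

text \<open>The classes of the family \<open>\<Psi>\<close>, indexed by \<open>I\<close>, form a basis of \<open>E / F\<close>.\<close>

definition quotient_basis :: "'a::complex_vector set \<Rightarrow> 'a set \<Rightarrow> 'i set \<Rightarrow> ('i \<Rightarrow> 'a) \<Rightarrow> bool" where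
  "quotient_basis E F I \<Psi> \<longleftrightarrow>
     (\<forall>i\<in>I. \<Psi> i \<in> E) \<and>
     (\<forall>J a. finite J \<longrightarrow> J \<subseteq> I \<longrightarrow> (\<Sum>i\<in>J. a i *\<^sub>C \<Psi> i) \<in> F \<longrightarrow> (\<forall>i\<in>J. a i = 0)) \<and>
     (\<forall>\<Phi>\<in>E. \<exists>J a. finite J \<and> J \<subseteq> I \<and> \<Phi> - (\<Sum>i\<in>J. a i *\<^sub>C \<Psi> i) \<in> F)"

definition cdot :: "complex ^ 'n \<Rightarrow> complex ^ 'n::finite \<Rightarrow> complex" where
  "cdot a b = (\<Sum>\<alpha>\<in>UNIV. cnj (a $ \<alpha>) * b $ \<alpha>)"

definition orthonormal_system :: "'i set \<Rightarrow> ('i \<Rightarrow> complex ^ 'n::finite) \<Rightarrow> bool" where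
  "orthonormal_system I c \<longleftrightarrow> (\<forall>i\<in>I. \<forall>j\<in>I. cdot (c i) (c j) = (if i = j then 1 else 0))"

definition orthonormal_basis :: "'i set \<Rightarrow> ('i \<Rightarrow> complex ^ 'n::finite) \<Rightarrow> bool" where
  "orthonormal_basis I c \<longleftrightarrow> orthonormal_system I c \<and> vec.span (c ` I) = UNIV"

definition resonance_basis :: "real \<Rightarrow> ('v, 'n::finite) op \<Rightarrow> 'i set \<Rightarrow> ('i \<Rightarrow> ('v, 'n) state) \<Rightarrow> bool" where
  "resonance_basis \<beta> H I \<Psi> \<longleftrightarrow>
     quotient_basis (bdd_eigenspace \<beta> H) (eigenspace \<beta> H) I \<Psi> \<and>
     (\<forall>i\<in>I. \<forall>\<Phi>\<in>eigenspace \<beta> H. (cnj \<circ> \<Phi>) * \<Psi> i \<in> ell1 0 \<and> \<langle>\<Phi>, \<Psi> i\<rangle> = 0) \<and>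
     (\<exists>c. orthonormal_system I c \<and> (\<forall>i\<in>I. \<Psi> i - one_comb (c i) \<in> ell1 (\<beta> - 2)))"

definition nonresonance_basis :: "real \<Rightarrow> ('v, 'n::finite) op \<Rightarrow> 'i set \<Rightarrow> ('i \<Rightarrow> ('v, 'n) state) \<Rightarrow> bool" where
  "nonresonance_basis \<beta> H I \<Psi> \<longleftrightarrow>
     quotient_basis (gen_eigenspace \<beta> H) (bdd_eigenspace \<beta> H) I \<Psi> \<and>
     (\<forall>i\<in>I. \<forall>\<Phi>\<in>eigenspace \<beta> H. (cnj \<circ> \<Phi>) * \<Psi> i \<in> ell1 0 \<and> \<langle>\<Phi>, \<Psi> i\<rangle> = 0) \<and>
     (\<exists>c. orthonormal_system I c \<and> (\<forall>i\<in>I. \<Psi> i - n_comb (c i) \<in> one_plus_ell1 (\<beta> - 2)))"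

definition projection_of :: "'i set \<Rightarrow> ('i \<Rightarrow> ('v, 'n) state) \<Rightarrow> ('v, 'n) op" where
  "projection_of I \<Psi> = (\<Sum>i\<in>I. ketbra (\<Psi> i) (\<Psi> i))"

end

theory Submission
  imports Defs
begin

text \<open>Fix \<open>u\<close> and put \<open>w = R(\<kappa>) u\<close>, so that \<open>w = R\<^sub>0(\<kappa>) (u - V w)\<close>, where the free resolvent \<open>R\<^sub>0(\<kappa>)\<close>
  is explicit on every half-line and its kernel can be expanded in \<open>\<kappa>\<close> by hand.  Comparing powers
  of \<open>\<kappa>\<close> gives for each coefficient of \<open>w\<close> an equation \<open>(1 + G\<^sub>0\<^sub>,\<^sub>0 V) a = d\<close> with \<open>d\<close> known from
  the previous orders.  It is solved by \<open>d - G\<^sub>0\<^sub>,\<^sub>0 v M\<^sub>0\<^sup>\<dagger> v\<^sup>* d\<close> up to an element of the span of the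
  resonance functions, and this element is fixed by the solvability condition of the next
  order, that is, by pairing with \<open>V \<Psi>\<^sub>\<gamma>\<close>.  The pseudo-inverse \<open>M\<^sub>0\<^sup>\<dagger>\<close> exists because \<open>v\<^sup>* G\<^sub>0\<^sub>,\<^sub>0 v\<close> is
  compact and \<open>U\<close> is an isometry.  The non-resonance projection comes from
  \<open>G\<^sub>0\<^sub>,\<^sub>1 (1 + V P V G\<^sub>0\<^sub>,\<^sub>1)\<close>: since \<open>G\<^sub>0\<^sub>,\<^sub>1\<close> has the kernel \<open>-nm\<close>, completeness of the vectors
  \<open>c\<^sub>\<gamma>\<close> and \<open>ct\<^sub>\<gamma>\<close> turns it into minus the sum over the complementary \<open>|n\<rangle>\<langle>n|\<close>.\<close>

section \<open>Complex Hilbert spaces\<close>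

text \<open>The existence of the expansion is a hypothesis, so nothing has to be inverted in
  operator norm: for fixed \<open>u\<close> the coefficients only need to be identified, and this is
  done on scalar functions of \<kappa>, namely values at a vertex and pairings with a fixed element.
  Everything is multiplied by \<kappa> so that only nonnegative powers occur. The difficulty is a
  missing order. If \<open>\<kappa> w\<close> is known modulo \<open>\<kappa>^m\<close>, the
  equation gives the coefficients below \<open>m\<close>, but the free part of the last one is
  decided by the condition at order \<open>m\<close>. For \<open>z\<close> in the resonance space,
  \<open>z = - G0 0 (V z)\<close> makes the unknown remainder cancel exactly in the pairing with
  \<open>V z\<close>, so this condition is available after all. The weights are a second constraint:
  with \<open>\<beta> = 4\<close> the remainder of order \<open>\<kappa>^3\<close> of the free
  kernel may grow only like \<open>(n m)^3\<close>, so Taylor remainders may cost just one power of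
  the coordinate per power of \<kappa>. Finally, the normalisation of the resonance basis makes
  \<open>P V G0 1 V\<close> minus the identity on the resonance space, and so each condition can be
  solved for the undetermined part.\<close>

lemma scaleC_zero_left [simp]: "0 *\<^sub>C (x::'a::complex_vector) = 0"
  using scaleC_add_left[of 0 0 x] by simp

lemma scaleC_zero_right [simp]: "c *\<^sub>C (0::'a::complex_vector) = 0"
  using scaleC_add_right[of c "0::'a" 0] by simp

lemma scaleC_minus_right: "c *\<^sub>C (- x) = - (c *\<^sub>C (x::'a::complex_vector))"
  using scaleC_add_right[of c x "-x"] by (simp add: eq_neg_iff_add_eq_0 add.commute)

lemma scaleC_minus_left: "(- c) *\<^sub>C x = - (c *\<^sub>C (x::'a::complex_vector))"
  using scaleC_add_left[of c "-c" x] by (simp add: eq_neg_iff_add_eq_0 add.commute)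

lemma scaleC_diff_right: "c *\<^sub>C (x - y) = c *\<^sub>C x - c *\<^sub>C (y::'a::complex_vector)"
  using scaleC_add_right[of c x "-y"] by (simp add: scaleC_minus_right)

lemma scaleC_diff_left: "(c - d) *\<^sub>C x = c *\<^sub>C x - d *\<^sub>C (x::'a::complex_vector)"
  using scaleC_add_left[of c "-d" x] by (simp add: scaleC_minus_left)

lemma scaleC_minus_one: "(-1) *\<^sub>C x = - (x::'a::complex_vector)"
  by (simp add: scaleC_minus_left scaleC_one)

lemma scaleC_sum_right: "c *\<^sub>C (\<Sum>i\<in>I. f i) = (\<Sum>i\<in>I. c *\<^sub>C (f i::'a::complex_vector))"
  by (induction I rule: infinite_finite_induct) (auto simp: scaleC_add_right)

lemma clinear_onD:
  assumes "clinear_on UNIV f"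
  shows "f (x + y) = f x + f y" "f (c *\<^sub>C x) = c *\<^sub>C f x" "f 0 = 0" "f (- x) = - f x"
    "f (x - y) = f x - f y"
proof -
  show 1: "f (x + y) = f x + f y" for x y using assms by (simp add: clinear_on_def)
  show 2: "f (c *\<^sub>C x) = c *\<^sub>C f x" for c x using assms by (simp add: clinear_on_def)
  show "f 0 = 0" using 1[of 0 0] by simp
  show 3: "f (- x) = - f x" for x using 2[of "-1" x] by (simp add: scaleC_minus_one)
  show "f (x - y) = f x - f y" using 1[of x "-y"] 3 by simp
qed

lemma cinner_add_left: "cinner (x + y) z = cinner x z + cinner (y::'k::complex_hilbert) z"
  by (metis cinner_add_right cinner_commute complex_cnj_add)

lemma cinner_scaleC_left: "cinner (c *\<^sub>C x) y = cnj c * cinner x (y::'k::complex_hilbert)"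
  by (metis cinner_commute cinner_scaleC_right complex_cnj_mult)

lemma cinner_zero_right [simp]: "cinner x (0::'k::complex_hilbert) = 0"
  using cinner_add_right[of x 0 0] by simp

lemma cinner_zero_left [simp]: "cinner (0::'k::complex_hilbert) x = 0"
  using cinner_add_left[of 0 0 x] by simp

lemma cinner_minus_right: "cinner x (- y) = - cinner x (y::'k::complex_hilbert)"
  using cinner_add_right[of x y "-y"] by (simp add: eq_neg_iff_add_eq_0 add.commute)

lemma cinner_minus_left: "cinner (- x) y = - cinner x (y::'k::complex_hilbert)"
  using cinner_add_left[of x "-x" y] by (simp add: eq_neg_iff_add_eq_0 add.commute)

lemma cinner_diff_right: "cinner x (y - z) = cinner x y - cinner x (z::'k::complex_hilbert)"
  using cinner_add_right[of x y "-z"] by (simp add: cinner_minus_right)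

lemma cinner_diff_left: "cinner (x - y) z = cinner x z - cinner y (z::'k::complex_hilbert)"
  using cinner_add_left[of x "-y" z] by (simp add: cinner_minus_left)

lemma cinner_self: "cinner x x = complex_of_real ((norm (x::'k::complex_hilbert))\<^sup>2)"
proof -
  have "0 \<le> sqrt (Re (cinner x x))" by (metis norm_eq_sqrt_cinner norm_ge_zero)
  then have "0 \<le> Re (cinner x x)" by simp
  moreover have "Im (cinner x x) = 0" using cinner_commute[of x x] by (simp add: complex_eq_iff)
  ultimately show ?thesis by (simp add: complex_eq_iff norm_eq_sqrt_cinner)
qed

lemma norm_scaleC: "norm (c *\<^sub>C (x::'k::complex_hilbert)) = cmod c * norm x"
proof -
  have "complex_of_real ((norm (c *\<^sub>C x))\<^sup>2) = complex_of_real ((cmod c * norm x)\<^sup>2)"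
    unfolding cinner_self[symmetric] cinner_scaleC_left cinner_scaleC_right
    by (simp add: cinner_self power_mult_distrib flip: complex_norm_square)
  then show ?thesis
    using of_real_eq_iff power2_eq_iff_nonneg by (metis mult_nonneg_nonneg norm_ge_zero)
qed

lemma norm_diff_squared:
  "(norm (x - y))\<^sup>2 = (norm x)\<^sup>2 - 2 * Re (cinner y x) + (norm (y::'k::complex_hilbert))\<^sup>2"
proof -
  have "complex_of_real ((norm (x - y))\<^sup>2) = complex_of_real ((norm x)\<^sup>2)
      - (cinner y x + cnj (cinner y x)) + complex_of_real ((norm y)\<^sup>2)"
    unfolding cinner_self[symmetric] cinner_diff_left cinner_diff_right
    by (simp add: algebra_simps cinner_commute[of x y])
  from arg_cong[OF this, of Re] show ?thesis by (simp add: complex_add_cnj)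
qed

text \<open>Pythagoras after removing the component along \<open>y\<close>. Nonnegativity of the
  left side is Cauchy-Schwarz; the strict decrease on the right is the variation used for nearest
  points.\<close>

lemma norm_diff_component_squared:
  assumes "(y::'k::complex_hilbert) \<noteq> 0"
  shows "(norm (x - (cinner y x / (norm y)\<^sup>2) *\<^sub>C y))\<^sup>2 = (norm x)\<^sup>2 - (cmod (cinner y x))\<^sup>2 / (norm y)\<^sup>2"
proof -
  have "cinner ((cinner y x / (norm y)\<^sup>2) *\<^sub>C y) x = of_real ((cmod (cinner y x))\<^sup>2 / (norm y)\<^sup>2)"
    unfolding cinner_scaleC_left by (simp add: mult.commute flip: complex_norm_square)
  then have "Re (cinner ((cinner y x / (norm y)\<^sup>2) *\<^sub>C y) x) = (cmod (cinner y x))\<^sup>2 / (norm y)\<^sup>2"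
    by (simp only: Re_complex_of_real)
  moreover have "norm ((cinner y x / (norm y)\<^sup>2) *\<^sub>C y) = cmod (cinner y x) / norm y"
    using assms by (simp add: norm_scaleC norm_divide power2_eq_square norm_mult)
  ultimately show ?thesis unfolding norm_diff_squared by (simp add: power_divide)
qed

lemma cinner_Cauchy_Schwarz: "cmod (cinner x y) \<le> norm x * norm (y::'k::complex_hilbert)"
proof (cases "x = 0")
  case False
  have "0 \<le> (norm y)\<^sup>2 - (cmod (cinner x y))\<^sup>2 / (norm x)\<^sup>2"
    unfolding norm_diff_component_squared[OF False, symmetric] by simp
  then have "(cmod (cinner x y))\<^sup>2 \<le> (norm x * norm y)\<^sup>2"
    using False by (simp add: field_simps power_mult_distrib)
  then show ?thesis by (simp add: power2_le_iff_abs_le)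
qed simp

lemma cinner_eq_zero_iff: "cinner x x = 0 \<longleftrightarrow> (x::'k::complex_hilbert) = 0"
  by (simp add: cinner_self)

lemma parallelogram_law:
  "(norm (x + y))\<^sup>2 + (norm (x - y))\<^sup>2 = 2 * (norm x)\<^sup>2 + 2 * (norm (y::'k::complex_hilbert))\<^sup>2"
  using norm_diff_squared[of x y] norm_diff_squared[of x "-y"] by (simp add: cinner_minus_left)

lemma bounded_linearI_clinear:
  fixes f :: "'k::complex_hilbert \<Rightarrow> 'k"
  assumes "clinear_on UNIV f" "\<And>x. norm (f x) \<le> C * norm x"
  shows "bounded_linear f"
  by (rule bounded_linear_intro[of _ C])
    (use assms(2) in \<open>simp_all add: clinear_onD[OF assms(1)] scaleR_scaleC mult.commute\<close>)

lemma bounded_linearI_cfunctional: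
  fixes f :: "'k::complex_hilbert \<Rightarrow> complex"
  assumes "clinear_on UNIV f" "\<And>x. norm (f x) \<le> C * norm x"
  shows "bounded_linear f"
  by (rule bounded_linear_intro[of _ C])
    (use assms(2) in \<open>simp_all add: clinear_onD[OF assms(1)] scaleR_scaleC scaleC_complex_def scaleR_conv_of_real mult.commute\<close>)

lemma bounded_linear_cinner: "bounded_linear (cinner (y::'k::complex_hilbert))"
  by (rule bounded_linearI_cfunctional[of _ "norm y"])
    (simp_all add: clinear_on_def cinner_add_right cinner_scaleC_right scaleC_complex_def cinner_Cauchy_Schwarz)

section \<open>Orthogonal projection and the Riesz representation\<close>

definition csubspace :: "'a::complex_vector set \<Rightarrow> bool" where
  "csubspace S \<longleftrightarrow> 0 \<in> S \<and> (\<forall>x\<in>S. \<forall>y\<in>S. x + y \<in> S) \<and> (\<forall>x\<in>S. \<forall>c. c *\<^sub>C x \<in> S)"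

lemma csubspaceD:
  assumes "csubspace S"
  shows "0 \<in> S" "x \<in> S \<Longrightarrow> y \<in> S \<Longrightarrow> x + y \<in> S" "x \<in> S \<Longrightarrow> c *\<^sub>C x \<in> S" "x \<in> S \<Longrightarrow> - x \<in> S"
    "x \<in> S \<Longrightarrow> y \<in> S \<Longrightarrow> x - y \<in> S"
proof -
  show 1: "x \<in> S \<Longrightarrow> y \<in> S \<Longrightarrow> x + y \<in> S" for x y using assms by (simp add: csubspace_def)
  show "0 \<in> S" using assms by (simp add: csubspace_def)
  show 2: "x \<in> S \<Longrightarrow> c *\<^sub>C x \<in> S" for c x using assms by (simp add: csubspace_def)
  show 3: "x \<in> S \<Longrightarrow> - x \<in> S" for x using 2[of x "-1"] by (simp add: scaleC_minus_one)
  show "x \<in> S \<Longrightarrow> y \<in> S \<Longrightarrow> x - y \<in> S" using 1[of x "-y"] 3 by simp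
qed

lemma csubspace_kernel:
  assumes "clinear_on UNIV f"
  shows "csubspace (kernel f)"
  using clinear_onD[OF assms] by (simp add: csubspace_def kernel_def)

lemma csubspace_range:
  assumes "clinear_on UNIV f"
  shows "csubspace (range f)"
  unfolding csubspace_def
  by (auto simp: clinear_onD(1,2)[OF assms, symmetric] intro: range_eqI[of _ _ 0] simp: clinear_onD(3)[OF assms])

lemma csubspace_orth_compl: "csubspace (orth_compl S)"
  by (auto simp: csubspace_def orth_compl_def cinner_add_right cinner_scaleC_right)

lemma closed_orth_compl: "closed (orth_compl (S::'k::complex_hilbert set))"
proof -
  have "orth_compl S = (\<Inter>y\<in>S. {x. cinner y x = 0})" by (auto simp: orth_compl_def)
  then show ?thesis
    by (auto intro!: closed_Collect_eq linear_continuous_on bounded_linear_cinner continuous_on_const)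
qed

lemma orth_compl_commute: "x \<in> orth_compl S \<Longrightarrow> y \<in> S \<Longrightarrow> cinner x y = 0"
  using cinner_commute[of x y] by (simp add: orth_compl_def)

text \<open>\<open>p\<close> is the limit of a minimising sequence for the distance from
  \<open>x\<close> to \<open>S\<close>. The parallelogram law makes the sequence Cauchy, and moving
  the nearest point along \<open>y\<close> shows orthogonality.\<close>

lemma orthogonal_decomposition:
  fixes S :: "'k::complex_hilbert set"
  assumes S: "csubspace S" "closed S"
  obtains p where "p \<in> S" "x - p \<in> orth_compl S"
proof -
  define d where "d = Inf ((\<lambda>s. (norm (x - s))\<^sup>2) ` S)"
  have bdd: "bdd_below ((\<lambda>s. (norm (x - s))\<^sup>2) ` S)" by (rule bdd_belowI[of _ 0]) auto
  have ne: "S \<noteq> {}" using csubspaceD(1)[OF S(1)] by auto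
  have dle: "d \<le> (norm (x - s))\<^sup>2" if "s \<in> S" for s
    unfolding d_def using that bdd by (intro cInf_lower) auto
  have "\<exists>s\<in>S. (norm (x - s))\<^sup>2 < d + inverse (real (Suc n))" for n
  proof -
    have "Inf ((\<lambda>s. (norm (x - s))\<^sup>2) ` S) < d + inverse (real (Suc n))" by (simp add: d_def)
    from cInf_lessD[OF _ this] ne show ?thesis by auto
  qed
  then obtain s where s: "\<And>n. s n \<in> S" "\<And>n. (norm (x - s n))\<^sup>2 < d + inverse (real (Suc n))" by metis
  have est: "(norm (s n - s m))\<^sup>2 < 2 * inverse (real (Suc n)) + 2 * inverse (real (Suc m))" for n m
  proof -
    have "(norm (s m - s n))\<^sup>2 = 2 * (norm (x - s n))\<^sup>2 + 2 * (norm (x - s m))\<^sup>2 - (norm ((x - s n) + (x - s m)))\<^sup>2"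
      using parallelogram_law[of "x - s n" "x - s m"] by (simp add: algebra_simps)
    \<comment> \<open>The midpoint of \<open>s n\<close> and \<open>s m\<close> is again in
      \<open>S\<close>, so this sum has squared norm at least \<open>4 * d\<close>; subtracting it
      leaves only the two errors.\<close>
    moreover have "(x - s n) + (x - s m) = 2 *\<^sub>R (x - (1/2) *\<^sub>R (s n + s m))"
      by (simp add: algebra_simps scaleR_2)
    then have "(norm ((x - s n) + (x - s m)))\<^sup>2 = 4 * (norm (x - (1/2) *\<^sub>R (s n + s m)))\<^sup>2"
      by (simp add: power_mult_distrib)
    moreover have "(1/2) *\<^sub>R (s n + s m) \<in> S"
      unfolding scaleR_scaleC by (intro csubspaceD(2,3)[OF S(1)] s(1))
    ultimately show ?thesis using dle[of "(1/2) *\<^sub>R (s n + s m)"] s(2)[of n] s(2)[of m]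
      by (simp add: norm_minus_commute)
  qed
  have "Cauchy s"
  proof (rule metric_CauchyI)
    fix e :: real assume e: "0 < e"
    then obtain N where N: "inverse (real (Suc N)) < e\<^sup>2 / 4"
      using reals_Archimedean[of "e\<^sup>2 / 4"] by auto
    show "\<exists>M. \<forall>m\<ge>M. \<forall>n\<ge>M. dist (s m) (s n) < e"
    proof (intro exI allI impI)
      fix m n assume "m \<ge> N" "n \<ge> N"
      then have "inverse (real (Suc m)) \<le> inverse (real (Suc N))" "inverse (real (Suc n)) \<le> inverse (real (Suc N))"
        by (auto intro!: le_imp_inverse_le)
      then have "(norm (s m - s n))\<^sup>2 < e\<^sup>2" using est[of m n] N by linarith
      then show "dist (s m) (s n) < e" using e by (simp add: dist_norm power_less_imp_less_base)
    qed
  qed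
  then obtain p where p: "s \<longlonglongrightarrow> p" using Cauchy_convergent_iff convergent_def by blast
  have pS: "p \<in> S" using S(2) s(1) p closed_sequentially by blast
  have "(\<lambda>n. (norm (x - s n))\<^sup>2) \<longlonglongrightarrow> (norm (x - p))\<^sup>2" by (intro tendsto_intros p)
  moreover have "(\<lambda>n. d + inverse (real (Suc n))) \<longlonglongrightarrow> d + 0"
    by (intro tendsto_intros LIMSEQ_inverse_real_of_nat)
  ultimately have "(norm (x - p))\<^sup>2 \<le> d + 0"
    by (rule LIMSEQ_le) (use s(2) in \<open>auto intro: less_imp_le\<close>)
  then have min: "(norm (x - p))\<^sup>2 \<le> (norm (x - t))\<^sup>2" if "t \<in> S" for t using dle[OF that] by linarith
  have "cinner y (x - p) = 0" if y: "y \<in> S" for y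
  proof (cases "y = 0")
    case False
    \<comment> \<open>\<open>?t\<close> is the component of \<open>x - p\<close> along
      \<open>y\<close>. Passing from \<open>p\<close> to \<open>p + ?t\<close> would lower the
      squared distance unless that component vanishes.\<close>
    let ?t = "(cinner y (x - p) / (norm y)\<^sup>2) *\<^sub>C y"
    have "p + ?t \<in> S" using y pS csubspaceD[OF S(1)] by blast
    then have "(norm (x - p))\<^sup>2 \<le> (norm (x - p - ?t))\<^sup>2" using min by (simp add: algebra_simps)
    then have "(cmod (cinner y (x - p)))\<^sup>2 / (norm y)\<^sup>2 \<le> 0"
      unfolding norm_diff_component_squared[OF False] by simp
    then show ?thesis using False by (simp add: divide_le_0_iff)
  qed simp
  then show ?thesis using pS that[of p] by (simp add: orth_compl_def)
qed

text \<open>The kernel has codimension one: a vector \<open>e\<close> orthogonal to it with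
  \<open>f e \<noteq> 0\<close> spans a complement, so a multiple of \<open>e\<close> represents
  \<open>f\<close>. Unique existence is stated because \<open>adjoint_of\<close> is a definite
  description.\<close>

theorem Riesz_representation:
  fixes f :: "'k::complex_hilbert \<Rightarrow> complex"
  assumes f: "clinear_on UNIV f" and bd: "\<And>x. cmod (f x) \<le> C * norm x"
  shows "\<exists>!k. \<forall>\<phi>. cinner k \<phi> = f \<phi>"
proof -
  have "\<exists>k. \<forall>\<phi>. cinner k \<phi> = f \<phi>"
  proof (cases "\<forall>\<phi>. f \<phi> = 0")
    case True
    then show ?thesis by (intro exI[of _ 0]) simp
  next
    case False
    then obtain x where x: "f x \<noteq> 0" by auto
    have "closed (kernel f)"
      unfolding kernel_def
      by (intro closed_Collect_eq linear_continuous_on bounded_linearI_cfunctional[OF f bd] continuous_on_const)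
    then obtain p where p: "p \<in> kernel f" "x - p \<in> orth_compl (kernel f)"
      using orthogonal_decomposition csubspace_kernel[OF f] by metis
    define e where "e = x - p"
    have fe: "f e \<noteq> 0" using x p(1) by (simp add: e_def clinear_onD[OF f] kernel_def)
    then have e0: "e \<noteq> 0" using clinear_onD(3)[OF f] by auto
    have "cinner ((cnj (f e) / (norm e)\<^sup>2) *\<^sub>C e) \<phi> = f \<phi>" for \<phi>
    proof -
      have "\<phi> - (f \<phi> / f e) *\<^sub>C e \<in> kernel f"
        using fe by (simp add: kernel_def clinear_onD[OF f] scaleC_complex_def)
      then have "cinner e (\<phi> - (f \<phi> / f e) *\<^sub>C e) = 0"
        using p(2) orth_compl_commute by (auto simp: e_def)
      then have "cinner e \<phi> = f \<phi> / f e * (norm e)\<^sup>2"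
        by (simp add: cinner_diff_right cinner_scaleC_right cinner_self)
      then show ?thesis using fe e0 by (simp add: cinner_scaleC_left)
    qed
    then show ?thesis by blast
  qed
  then show ?thesis
  proof (rule ex_ex1I)
    fix k l assume "\<forall>\<phi>. cinner k \<phi> = f \<phi>" "\<forall>\<phi>. cinner l \<phi> = f \<phi>"
    then have "cinner (k - l) (k - l) = 0" by (simp add: cinner_diff_left)
    then show "k = l" by (simp add: cinner_eq_zero_iff)
  qed
qed

section \<open>The pseudo-inverse of a symmetric operator with closed range\<close>

text \<open>The last assumption is what a compact perturbation of an isometry retains of compactness; it
  makes \<open>M\<close> bounded below on the orthogonal complement of its kernel.\<close>

locale compactly_perturbed_isometry =
  fixes M :: "'k::complex_hilbert \<Rightarrow> 'k"
  assumes lin: "clinear_on UNIV M"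
    and bounded_linear_M: "bounded_linear M"
    and sym: "\<And>x y. cinner x (M y) = cinner (M x) y"
    and proper: "\<And>x. (\<And>n::nat. norm (x n) = 1) \<Longrightarrow> (\<lambda>n. M (x n)) \<longlonglongrightarrow> 0 \<Longrightarrow>
        \<exists>r l. strict_mono r \<and> (x \<circ> r) \<longlonglongrightarrow> l"
begin

abbreviation "N \<equiv> kernel M"

lemmas M_simps = clinear_onD[OF lin]

lemma csubspace_N: "csubspace N" by (rule csubspace_kernel[OF lin])

lemma closed_N: "closed N"
  unfolding kernel_def
  by (intro closed_Collect_eq linear_continuous_on bounded_linear_M continuous_on_const)

lemma range_orth: "M x \<in> orth_compl N"
  unfolding orth_compl_def using sym[of _ x] by (auto simp: kernel_def)

lemma disjoint_N: "x \<in> N \<Longrightarrow> x \<in> orth_compl N \<Longrightarrow> x = 0"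
  by (simp add: orth_compl_def cinner_eq_zero_iff[symmetric])

text \<open>Otherwise unit vectors of \<open>orth_compl N\<close> have images tending to 0. The
  convergent subsequence supplied by \<open>proper\<close> has a limit in \<open>N\<close> and in
  \<open>orth_compl N\<close>, hence 0, although its norm is 1.\<close>

lemma bounded_below: "\<exists>c>0. \<forall>x\<in>orth_compl N. c * norm x \<le> norm (M x)"
proof (rule ccontr)
  assume no: "\<not> ?thesis"
  have "\<exists>y\<in>orth_compl N. norm y = 1 \<and> norm (M y) < inverse (real (Suc n))" for n
  proof -
    have "\<not> (\<forall>x\<in>orth_compl N. inverse (real (Suc n)) * norm x \<le> norm (M x))"
      using no by (metis inverse_positive_iff_positive of_nat_0_less_iff zero_less_Suc)
    then obtain x where x: "x \<in> orth_compl N" "norm (M x) < inverse (real (Suc n)) * norm x"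
      by (auto simp: not_le)
    then have x0: "x \<noteq> 0" by auto
    define y where "y = complex_of_real (inverse (norm x)) *\<^sub>C x"
    have "y \<in> orth_compl N" unfolding y_def using x(1) csubspaceD(3)[OF csubspace_orth_compl] by blast
    have "norm y = 1" using x0 by (simp add: y_def norm_scaleC norm_inverse)
    have "norm (M y) = inverse (norm x) * norm (M x)"
      by (simp add: y_def M_simps norm_scaleC norm_inverse)
    also have "\<dots> < inverse (norm x) * (inverse (real (Suc n)) * norm x)"
      using x(2) x0 by (intro mult_strict_left_mono) auto
    also have "\<dots> = inverse (real (Suc n))" using x0 by (simp del: of_nat_Suc)
    finally have "norm (M y) < inverse (real (Suc n))" .
    with \<open>y \<in> orth_compl N\<close> \<open>norm y = 1\<close> show ?thesis by blast
  qed
  then obtain y where y: "\<And>n. y n \<in> orth_compl N" "\<And>n. norm (y n) = 1"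
    "\<And>n. norm (M (y n)) < inverse (real (Suc n))" by metis
  have lim0: "(\<lambda>n. M (y n)) \<longlonglongrightarrow> 0"
    by (rule Lim_null_comparison[OF _ LIMSEQ_inverse_real_of_nat])
      (intro always_eventually allI less_imp_le y(3))
  then obtain r l where r: "strict_mono r" "(y \<circ> r) \<longlonglongrightarrow> l" using proper y(2) by metis
  have "(\<lambda>n. M ((y \<circ> r) n)) \<longlonglongrightarrow> M l" by (rule bounded_linear.tendsto[OF bounded_linear_M r(2)])
  moreover have "(\<lambda>n. M ((y \<circ> r) n)) \<longlonglongrightarrow> 0" using LIMSEQ_subseq_LIMSEQ[OF lim0 r(1)] by (simp add: o_def)
  ultimately have "l \<in> N" using LIMSEQ_unique by (auto simp: kernel_def)
  moreover have "l \<in> orth_compl N"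
    using closed_sequentially[OF closed_orth_compl _ r(2)] y(1) by auto
  ultimately have "l = 0" by (rule disjoint_N)
  moreover have "(\<lambda>n. norm ((y \<circ> r) n)) \<longlonglongrightarrow> norm l" by (intro tendsto_norm r(2))
  then have "norm l = 1" using y(2) by (simp add: LIMSEQ_const_iff)
  ultimately show False by simp
qed

text \<open>Preimages can be chosen in \<open>orth_compl N\<close>, where
  \<open>bounded_below\<close> turns convergence of the images into the Cauchy property.\<close>

lemma closed_range: "closed (range M)"
  unfolding closed_sequential_limits
proof (intro allI impI)
  fix f y assume f: "(\<forall>n. f n \<in> range M) \<and> f \<longlonglongrightarrow> y"
  have "\<exists>x\<in>orth_compl N. M x = f n" for n
  proof -
    obtain x' where x': "f n = M x'" using f by auto
    obtain p where "p \<in> N" "x' - p \<in> orth_compl N"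
      using orthogonal_decomposition[OF csubspace_N closed_N] by metis
    then show ?thesis using x' by (intro bexI[of _ "x' - p"]) (auto simp: M_simps kernel_def)
  qed
  then obtain x where x: "\<And>n. x n \<in> orth_compl N" "\<And>n. M (x n) = f n" by metis
  obtain c where c: "c > 0" "\<And>x. x \<in> orth_compl N \<Longrightarrow> c * norm x \<le> norm (M x)"
    using bounded_below by auto
  have "Cauchy f" using f LIMSEQ_imp_Cauchy by blast
  have "Cauchy x"
  proof (rule metric_CauchyI)
    fix e :: real assume "0 < e"
    then obtain K where K: "\<And>m n. m \<ge> K \<Longrightarrow> n \<ge> K \<Longrightarrow> dist (f m) (f n) < c * e"
      using metric_CauchyD[OF \<open>Cauchy f\<close>, of "c * e"] c(1) by auto
    have "dist (x m) (x n) < e" if "m \<ge> K" "n \<ge> K" for m n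
    proof -
      have "c * norm (x m - x n) \<le> norm (M (x m - x n))"
        using c(2) csubspaceD(5)[OF csubspace_orth_compl] x(1) by blast
      also have "\<dots> < c * e" using K[OF that] by (simp add: M_simps x(2) dist_norm)
      finally show ?thesis using c(1) by (simp add: dist_norm)
    qed
    then show "\<exists>K. \<forall>m\<ge>K. \<forall>n\<ge>K. dist (x m) (x n) < e" by blast
  qed
  then obtain l where l: "x \<longlonglongrightarrow> l" using Cauchy_convergent_iff convergent_def by blast
  have "(\<lambda>n. M (x n)) \<longlonglongrightarrow> M l" by (rule bounded_linear.tendsto[OF bounded_linear_M l])
  then have "y = M l" using f x(2) LIMSEQ_unique by auto
  then show "y \<in> range M" by simp
qed

text \<open>Least-squares form of the pseudo-inverse. A residual in \<open>N\<close> can be reached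
  because the range is closed and, by symmetry, its complement lies in \<open>N\<close>. Two
  solutions differ by an element whose image is both in \<open>N\<close> and orthogonal to
  \<open>N\<close>.\<close>

lemma solve: "\<exists>!x. x \<in> orth_compl N \<and> y - M x \<in> N"
proof (rule ex_ex1I)
  obtain p where p: "p \<in> range M" "y - p \<in> orth_compl (range M)"
    using orthogonal_decomposition[OF csubspace_range[OF lin] closed_range] by metis
  obtain x' where x': "p = M x'" using p(1) by auto
  have "cinner z (M (y - p)) = 0" for z
    using p(2) by (simp add: sym orth_compl_def)
  then have *: "y - M x' \<in> N" using x' cinner_eq_zero_iff by (auto simp: kernel_def)
  obtain q where "q \<in> N" "x' - q \<in> orth_compl N"
    using orthogonal_decomposition[OF csubspace_N closed_N] by metis
  then show "\<exists>x. x \<in> orth_compl N \<and> y - M x \<in> N"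
    using * by (intro exI[of _ "x' - q"]) (auto simp: M_simps kernel_def)
next
  fix a b assume a: "a \<in> orth_compl N \<and> y - M a \<in> N" and b: "b \<in> orth_compl N \<and> y - M b \<in> N"
  have "M (a - b) \<in> N"
    using csubspaceD(5)[OF csubspace_N, of "y - M b" "y - M a"] a b by (simp add: M_simps)
  from disjoint_N[OF this range_orth] have "a - b \<in> N" by (simp add: kernel_def)
  moreover have "a - b \<in> orth_compl N" using csubspaceD(5)[OF csubspace_orth_compl] a b by blast
  ultimately have "a - b = 0" by (rule disjoint_N)
  then show "a = b" by simp
qed

text \<open>The description defining \<open>pseudo_inverse\<close> ranges over whole operators; it
  is satisfied by exactly one, the operator given pointwise by \<open>solve\<close>. Uniqueness
  splits \<open>y\<close> into its parts in \<open>N\<close> and in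
  \<open>orth_compl N\<close>.\<close>

lemma pseudo_inverse_unique_solution:
  "pseudo_inverse M = (\<lambda>y. THE x. x \<in> orth_compl N \<and> y - M x \<in> N)" (is "_ = ?D")
proof -
  have D: "?D y \<in> orth_compl N" "y - M (?D y) \<in> N" for y
    using theI'[OF solve[of y]] by auto
  have Deq: "?D y = x" if "x \<in> orth_compl N" "y - M x \<in> N" for x y
    using that solve[of y] by (intro the1_equality) auto
  have P: "clinear_on UNIV ?D \<and> (\<forall>x\<in>N. ?D x = 0) \<and>
     (\<forall>x\<in>orth_compl N. ?D x \<in> orth_compl N \<and> M (?D x) = x \<and> ?D (M x) = x)"
  proof (intro conjI ballI)
    show "clinear_on UNIV ?D"
      unfolding clinear_on_def
    proof (intro conjI ballI allI)
      fix x y :: 'k and a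
      have "x + y - M (?D x + ?D y) = (x - M (?D x)) + (y - M (?D y))" by (simp add: M_simps)
      then show "?D (x + y) = ?D x + ?D y"
        by (intro Deq) (simp_all only: csubspaceD[OF csubspace_orth_compl] csubspaceD[OF csubspace_N] D)
      have "a *\<^sub>C x - M (a *\<^sub>C ?D x) = a *\<^sub>C (x - M (?D x))" by (simp add: M_simps scaleC_diff_right)
      then show "?D (a *\<^sub>C x) = a *\<^sub>C ?D x"
        by (intro Deq) (simp_all only: csubspaceD[OF csubspace_orth_compl] csubspaceD[OF csubspace_N] D)
    qed
    fix x assume "x \<in> N"
    then show "?D x = 0" by (intro Deq) (simp_all add: csubspaceD[OF csubspace_orth_compl] M_simps)
  next
    fix x assume x: "x \<in> orth_compl N"
    show "?D x \<in> orth_compl N" by (rule D)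
    have "x - M (?D x) = 0"
      by (rule disjoint_N[OF D(2)]) (intro csubspaceD(5)[OF csubspace_orth_compl] x range_orth)
    then show "M (?D x) = x" by simp
    show "?D (M x) = x" by (rule Deq[OF x]) (simp add: csubspaceD[OF csubspace_N])
  qed
  have U: "D' = ?D" if D': "clinear_on UNIV D' \<and> (\<forall>x\<in>N. D' x = 0) \<and>
     (\<forall>x\<in>orth_compl N. D' x \<in> orth_compl N \<and> M (D' x) = x \<and> D' (M x) = x)" for D'
  proof
    fix y
    obtain p where p: "p \<in> N" "y - p \<in> orth_compl N"
      using orthogonal_decomposition[OF csubspace_N closed_N] by metis
    have "D' y = D' (y - p) + D' p" using D' by (metis clinear_onD(1) diff_add_cancel)
    then have "D' y = D' (y - p)" using D' p by simp
    then have "D' y \<in> orth_compl N \<and> M (D' y) = y - p" using D' p by simp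
    then show "D' y = ?D y" using p by (intro Deq[symmetric]) auto
  qed
  show ?thesis unfolding pseudo_inverse_def by (rule the_equality) (fact P, fact U)
qed

lemma pseudo_inverse_orth: "pseudo_inverse M y \<in> orth_compl N"
  and pseudo_inverse_solves: "y - M (pseudo_inverse M y) \<in> N"
  unfolding pseudo_inverse_unique_solution using theI'[OF solve[of y]] by auto

lemma pseudo_inverse_eqI: "x \<in> orth_compl N \<Longrightarrow> y - M x \<in> N \<Longrightarrow> pseudo_inverse M y = x"
  unfolding pseudo_inverse_unique_solution using solve[of y] by (intro the1_equality) auto

lemma pseudo_inverse_exact: "y \<in> orth_compl N \<Longrightarrow> M (pseudo_inverse M y) = y"
  using disjoint_N[OF pseudo_inverse_solves csubspaceD(5)[OF csubspace_orth_compl _ range_orth]]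
  by simp

lemma clinear_pseudo_inverse: "clinear_on UNIV (pseudo_inverse M)"
  unfolding clinear_on_def
proof (intro conjI ballI allI)
  let ?D = "pseudo_inverse M"
  fix x y :: 'k and a
  have "x + y - M (?D x + ?D y) = (x - M (?D x)) + (y - M (?D y))" by (simp add: M_simps)
  then show "?D (x + y) = ?D x + ?D y"
    by (intro pseudo_inverse_eqI) (simp_all only: csubspaceD[OF csubspace_orth_compl]
        csubspaceD[OF csubspace_N] pseudo_inverse_orth pseudo_inverse_solves)
  have "a *\<^sub>C x - M (a *\<^sub>C ?D x) = a *\<^sub>C (x - M (?D x))" by (simp add: M_simps scaleC_diff_right)
  then show "?D (a *\<^sub>C x) = a *\<^sub>C ?D x"
    by (intro pseudo_inverse_eqI) (simp_all only: csubspaceD[OF csubspace_orth_compl]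
        csubspaceD[OF csubspace_N] pseudo_inverse_orth pseudo_inverse_solves)
qed

text \<open>Both sides equal \<open>cinner (?D x) (M (?D y))\<close>, since residuals lie in
  \<open>N\<close> and values of \<open>?D\<close> are orthogonal to \<open>N\<close>.\<close>

lemma pseudo_inverse_sym: "cinner (pseudo_inverse M x) y = cinner x (pseudo_inverse M y)"
proof -
  let ?D = "pseudo_inverse M"
  have 1: "cinner (?D x) (y - M (?D y)) = 0"
    by (rule orth_compl_commute[OF pseudo_inverse_orth pseudo_inverse_solves])
  have 2: "cinner (x - M (?D x)) (?D y) = 0"
    using pseudo_inverse_orth pseudo_inverse_solves by (auto simp: orth_compl_def)
  show ?thesis using 1 2 by (simp add: cinner_diff_left cinner_diff_right sym)
qed

end

section \<open>Weighted sequence spaces\<close>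

lemma scaleC_complex [simp]: "c *\<^sub>C (z::complex) = c * z"
  by (simp add: scaleC_complex_def)

lemma scaleC_fun_apply [simp]: "(c *\<^sub>C f) x = c *\<^sub>C f x"
  by (simp add: scaleC_fun_def)

lemma sum_fun_apply: "(\<Sum>i\<in>I. f i) x = (\<Sum>i\<in>I. f i x)"
  by (induction I rule: infinite_finite_induct) auto

lemma weight_Core [simp]: "weight s (Core a) = 1"
  by (simp add: weight_def)

lemma weight_Lead: "weight s (Lead \<alpha> k) = (1 + (pos k)\<^sup>2) powr (s / 2)"
  by (simp add: weight_def)

lemma one_le_pos: "1 \<le> pos k"
  by (simp add: pos_def)

lemma pos_gt_0 [simp]: "0 < pos k"
  by (simp add: pos_def)

lemma one_plus_pos: "1 < 1 + (pos k)\<^sup>2"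
  using zero_less_power[OF pos_gt_0, of k 2] by linarith

lemma weight_pos [simp]: "0 < weight s x"
proof (cases x)
  case (Lead \<alpha> k)
  have "1 + (pos k)\<^sup>2 \<noteq> 0" using one_plus_pos[of k] by linarith
  then show ?thesis using Lead by (simp add: weight_Lead)
qed simp

lemma weight_nonneg [simp]: "0 \<le> weight s x"
  by (simp add: less_imp_le)

lemma weight_neq_0 [simp]: "weight s x \<noteq> 0"
  using weight_pos[of s x] by linarith

lemma nonneg_if_mult_weight_nonneg: "0 \<le> c * weight s x \<Longrightarrow> 0 \<le> c"
  by (metis mult_neg_pos not_le weight_pos)

lemma weight_add: "weight (s + t) x = weight s x * weight t x"
  by (cases x) (simp_all add: weight_Lead powr_add add_divide_distrib)

lemma weight_0 [simp]: "weight 0 x = 1"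
proof (cases x)
  case (Lead \<alpha> k)
  have "1 + (pos k)\<^sup>2 \<noteq> 0" using one_plus_pos[of k] by linarith
  then show ?thesis using Lead by (simp add: weight_Lead)
qed simp

lemma weight_minus: "weight (- s) x = inverse (weight s x)"
  using weight_add[of s "-s" x] by (simp add: field_simps)

lemma weight_mono: "s \<le> t \<Longrightarrow> weight s x \<le> weight t x"
  by (cases x) (auto simp: weight_Lead intro!: powr_mono less_imp_le[OF one_plus_pos])

lemma weight_ge_1: "0 \<le> s \<Longrightarrow> 1 \<le> weight s x"
  using weight_mono[of 0 s x] by simp

lemma weight_of_nat: "weight (real j) x = weight 1 x ^ j"
proof (induction j)
  case (Suc j)
  have "real (Suc j) = 1 + real j" by simp
  then show ?case using Suc weight_add[of 1 "real j" x] by simp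
qed simp

lemma weight_1_Lead: "weight 1 (Lead \<alpha> k) = sqrt (1 + (pos k)\<^sup>2)"
  by (simp add: weight_Lead powr_half_sqrt)

lemma pos_le_weight: "pos k \<le> weight 1 (Lead \<alpha> k)"
  unfolding weight_1_Lead by (rule real_le_rsqrt) simp

text \<open>The half-line kernels are polynomial in the coordinate; this converts bounds in powers
  of \<open>pos\<close> into weighted norms without a further constant.\<close>

lemma pos_power_le_weight: "pos k ^ j \<le> weight (real j) (Lead \<alpha> k)"
  unfolding weight_of_nat by (intro power_mono pos_le_weight) (simp add: less_imp_le)

lemma ell1_norm_nonneg: "0 \<le> ell1_norm s u"
  unfolding ell1_norm_def by (intro infsum_nonneg) auto

lemma ell1_summable: "u \<in> ell1 s \<Longrightarrow> (\<lambda>x. weight s x * cmod (u x)) summable_on UNIV"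
  by (simp add: ell1_def)

text \<open>Domination yields membership and the norm estimate together; monotonicity in the weight
  and the vector space operations are read off from it.\<close>

lemma ell1_I:
  assumes "g summable_on UNIV" "\<And>x. weight s x * cmod (u x) \<le> g x"
  shows "u \<in> ell1 s" "ell1_norm s u \<le> infsum g UNIV"
proof -
  have *: "(\<lambda>x. weight s x * cmod (u x)) summable_on UNIV"
    by (rule summable_on_comparison_test[OF assms(1)]) (use assms(2) in auto)
  then show "u \<in> ell1 s" by (simp add: ell1_def)
  show "ell1_norm s u \<le> infsum g UNIV" unfolding ell1_norm_def
    by (intro infsum_mono * assms)
qed

lemma ell1_mono:
  assumes "u \<in> ell1 t" "s \<le> t"
  shows "u \<in> ell1 s" "ell1_norm s u \<le> ell1_norm t u"
proof -
  have *: "weight s x * cmod (u x) \<le> weight t x * cmod (u x)" for x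
    using assms by (intro mult_right_mono weight_mono) auto
  show "u \<in> ell1 s" "ell1_norm s u \<le> ell1_norm t u"
    using ell1_I[OF ell1_summable[OF assms(1)] *] by (simp_all add: ell1_norm_def)
qed

lemma ell1_scaleC:
  assumes "u \<in> ell1 s" shows "c *\<^sub>C u \<in> ell1 s" "ell1_norm s (c *\<^sub>C u) \<le> cmod c * ell1_norm s u"
proof -
  have *: "weight s x * cmod ((c *\<^sub>C u) x) \<le> cmod c * (weight s x * cmod (u x))" for x
    by (simp add: norm_mult mult.left_commute)
  show "c *\<^sub>C u \<in> ell1 s" "ell1_norm s (c *\<^sub>C u) \<le> cmod c * ell1_norm s u"
    using ell1_I[where u = "c *\<^sub>C u", OF summable_on_cmult_right[OF ell1_summable[OF assms]] *]
    by (simp_all only: ell1_norm_def infsum_cmult_right')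
qed

lemma ell1_add:
  assumes "u \<in> ell1 s" "w \<in> ell1 s"
  shows "u + w \<in> ell1 s" "ell1_norm s (u + w) \<le> ell1_norm s u + ell1_norm s w"
proof -
  have *: "weight s x * cmod ((u + w) x) \<le> weight s x * cmod (u x) + weight s x * cmod (w x)" for x
    by (simp add: norm_triangle_ineq mult_left_mono flip: distrib_left)
  show "u + w \<in> ell1 s" "ell1_norm s (u + w) \<le> ell1_norm s u + ell1_norm s w"
    using ell1_I[where u = "u + w", OF summable_on_add[OF ell1_summable[OF assms(1)] ell1_summable[OF assms(2)]] *]
    by (simp_all only: ell1_norm_def infsum_add[OF ell1_summable[OF assms(1)] ell1_summable[OF assms(2)]])
qed

lemma ell1_zero [simp]: "0 \<in> ell1 s"
  by (simp add: ell1_def)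

lemma csubspace_ell1: "csubspace (ell1 s)"
  by (simp add: csubspace_def ell1_add ell1_scaleC)

lemmas ell1_minus = csubspaceD(4)[OF csubspace_ell1]
lemmas ell1_diff = csubspaceD(5)[OF csubspace_ell1]

lemma csubspace_sum:
  assumes "csubspace S" "\<And>i. i \<in> I \<Longrightarrow> f i \<in> S"
  shows "(\<Sum>i\<in>I. f i) \<in> S"
  using assms(2) by (induction I rule: infinite_finite_induct) (simp_all add: csubspaceD[OF assms(1)])

lemma ell1_norm_sum_le:
  assumes "\<And>i. i \<in> I \<Longrightarrow> f i \<in> ell1 s"
  shows "ell1_norm s (\<Sum>i\<in>I. f i) \<le> (\<Sum>i\<in>I. ell1_norm s (f i))"
  using assms
proof (induction I rule: infinite_finite_induct)
  case (insert i I)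
  have "ell1_norm s (sum f (insert i I)) \<le> ell1_norm s (f i) + ell1_norm s (sum f I)"
    unfolding sum.insert[OF insert.hyps(1,2)] by (intro ell1_add(2) csubspace_sum[OF csubspace_ell1] insert.prems) auto
  moreover have "ell1_norm s (sum f I) \<le> (\<Sum>i\<in>I. ell1_norm s (f i))"
    by (intro insert.IH insert.prems) auto
  ultimately show ?case by (subst (2) sum.insert[OF insert.hyps(1,2)]) linarith
qed (simp_all add: ell1_norm_def)

lemma ell1_minus_norm: "ell1_norm s (- u) = ell1_norm s u"
  by (simp add: ell1_norm_def)

lemma ell1_dual_bdd:
  "u \<in> ell1_dual s \<Longrightarrow> bdd_above (range (\<lambda>x. weight (- s) x * cmod (u x)))"
  by (simp add: ell1_dual_def)

lemma ell1_dual_bound: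
  assumes "u \<in> ell1_dual s"
  shows "cmod (u x) \<le> ell1_dual_norm s u * weight s x"
proof -
  have "weight (- s) x * cmod (u x) \<le> ell1_dual_norm s u"
    unfolding ell1_dual_norm_def using ell1_dual_bdd[OF assms] by (rule cSUP_upper[rotated]) simp
  then show ?thesis by (simp add: weight_minus field_simps)
qed

lemma ell1_dual_norm_nonneg:
  fixes u :: "('v, 'n) state" assumes "u \<in> ell1_dual s"
  shows "0 \<le> ell1_dual_norm s u"
proof -
  have "0 \<le> ell1_dual_norm s u * weight s (undefined::('v,'n) vertex)"
    using ell1_dual_bound[OF assms, of undefined] norm_ge_zero order_trans by blast
  then show ?thesis by (blast dest: nonneg_if_mult_weight_nonneg)
qed

lemma ell1_dual_I:
  assumes "\<And>x. cmod (u x) \<le> C * weight s x"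
  shows "u \<in> ell1_dual s"
proof -
  have "weight (- s) x * cmod (u x) \<le> C" for x
    using assms[of x] by (simp add: weight_minus field_simps)
  then show ?thesis unfolding ell1_dual_def by (auto intro!: bdd_aboveI[of _ C])
qed

lemma ell1_dual_mono:
  assumes "u \<in> ell1_dual s" "s \<le> t" shows "u \<in> ell1_dual t"
proof (rule ell1_dual_I)
  fix x
  have "cmod (u x) \<le> ell1_dual_norm s u * weight s x" by (rule ell1_dual_bound[OF assms(1)])
  also have "\<dots> \<le> ell1_dual_norm s u * weight t x"
    by (intro mult_left_mono weight_mono assms ell1_dual_norm_nonneg)
  finally show "cmod (u x) \<le> ell1_dual_norm s u * weight t x" .
qed

lemma csubspace_ell1_dual: "csubspace (ell1_dual s)"
  unfolding csubspace_def
proof (intro conjI ballI allI)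
  show "0 \<in> ell1_dual s" by (rule ell1_dual_I[of _ 0]) simp
  fix u w :: "('a, 'b) state" assume u: "u \<in> ell1_dual s" and w: "w \<in> ell1_dual s"
  show "u + w \<in> ell1_dual s"
  proof (rule ell1_dual_I[of _ "ell1_dual_norm s u + ell1_dual_norm s w"])
    fix x show "cmod ((u + w) x) \<le> (ell1_dual_norm s u + ell1_dual_norm s w) * weight s x"
      using norm_triangle_ineq[of "u x" "w x"] ell1_dual_bound[OF u, of x] ell1_dual_bound[OF w, of x]
      by (simp add: distrib_right)
  qed
next
  fix u :: "('a, 'b) state" and c assume u: "u \<in> ell1_dual s"
  show "c *\<^sub>C u \<in> ell1_dual s"
  proof (rule ell1_dual_I[of _ "cmod c * ell1_dual_norm s u"])
    fix x show "cmod ((c *\<^sub>C u) x) \<le> cmod c * ell1_dual_norm s u * weight s x"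
      using mult_left_mono[OF ell1_dual_bound[OF u, of x], of "cmod c"] by (simp add: norm_mult mult.assoc)
  qed
qed

lemma infsum_member_le:
  fixes f :: "'a \<Rightarrow> real"
  assumes "f summable_on UNIV" "\<And>x. 0 \<le> f x"
  shows "f x \<le> infsum f UNIV"
  using finite_sum_le_infsum[of f UNIV "{x}"] assms by simp

lemma ell1_bound: "u \<in> ell1 s \<Longrightarrow> weight s x * cmod (u x) \<le> ell1_norm s u"
  unfolding ell1_norm_def by (rule infsum_member_le) (auto simp: ell1_summable)

lemma ell1_subset_dual:
  assumes "u \<in> ell1 s" "0 \<le> s" "0 \<le> t"
  shows "u \<in> ell1_dual t"
proof (rule ell1_dual_I)
  fix x
  have "cmod (u x) \<le> weight s x * cmod (u x)" using mult_right_mono[OF weight_ge_1[OF assms(2)], of "cmod (u x)" x] by simp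
  also have "\<dots> \<le> ell1_norm s u * 1" using ell1_bound[OF assms(1)] by simp
  also have "\<dots> \<le> ell1_norm s u * weight t x"
    by (intro mult_left_mono weight_ge_1 assms ell1_norm_nonneg)
  finally show "cmod (u x) \<le> ell1_norm s u * weight t x" .
qed

lemma ell1_subset_ell2:
  assumes "u \<in> ell1 s" "0 \<le> s" shows "u \<in> ell2"
proof -
  have u0: "u \<in> ell1 0" "ell1_norm 0 u \<le> ell1_norm s u" using ell1_mono[OF assms] by auto
  have "(cmod (u x))\<^sup>2 \<le> ell1_norm 0 u * (weight 0 x * cmod (u x))" for x
    using ell1_bound[OF u0(1), of x] by (simp add: power2_eq_square mult_right_mono)
  then show ?thesis unfolding ell2_def
    using summable_on_comparison_test[OF summable_on_cmult_right[OF ell1_summable[OF u0(1)]]]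
    by (metis (mono_tags, lifting) mem_Collect_eq zero_le_power2)
qed

lemma ell2_subset_dual:
  assumes "u \<in> ell2" "0 \<le> s" shows "u \<in> ell1_dual s"
proof (rule ell1_dual_I)
  fix x
  have sm: "(\<lambda>x. (cmod (u x))\<^sup>2) summable_on UNIV" using assms(1) by (simp add: ell2_def)
  have "(cmod (u x))\<^sup>2 \<le> (\<Sum>\<^sub>\<infinity>x. (cmod (u x))\<^sup>2)" by (rule infsum_member_le[OF sm]) simp
  then have "cmod (u x) \<le> sqrt (\<Sum>\<^sub>\<infinity>x. (cmod (u x))\<^sup>2) * 1" by (simp add: real_le_rsqrt)
  also have "\<dots> \<le> sqrt (\<Sum>\<^sub>\<infinity>x. (cmod (u x))\<^sup>2) * weight s x"
    by (intro mult_left_mono weight_ge_1 assms) (auto intro: infsum_nonneg)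
  finally show "cmod (u x) \<le> sqrt (\<Sum>\<^sub>\<infinity>x. (cmod (u x))\<^sup>2) * weight s x" .
qed

subsection \<open>The sesquilinear pairing\<close>

text \<open>\<open>infsum\<close> is 0 on families that are not summable, so additivity of
  \<open>pairing\<close> requires this condition, which is carried along explicitly. Scalar
  multiples and signs need no such care.\<close>

definition pairable :: "('v, 'n) state \<Rightarrow> ('v, 'n) state \<Rightarrow> bool" where
  "pairable u w \<longleftrightarrow> (\<lambda>x. cnj (u x) * w x) summable_on UNIV"

lemma pairable_sym: "pairable u w \<longleftrightarrow> pairable w u"
proof -
  have "(\<lambda>x. cnj (u x) * w x) = (\<lambda>x. cnj (cnj (w x) * u x))" by (simp add: mult.commute)
  then show ?thesis unfolding pairable_def by (simp only: summable_on_cnj_iff)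
qed

lemma pairing_commute: "\<langle>u, w\<rangle> = cnj \<langle>w, u\<rangle>"
  unfolding pairing_def infsum_cnj[symmetric] by (simp add: mult.commute)

text \<open>The second argument is controlled pointwise rather than through
  \<open>ell1_dual_norm\<close>, because the estimates for the resolvent arrive as pointwise
  bounds.\<close>

lemma pairing_bound:
  assumes "u \<in> ell1 s" "\<And>x. cmod (w x) \<le> C * weight s x"
  shows "pairable u w" "cmod \<langle>u, w\<rangle> \<le> C * ell1_norm s u"
proof -
  have le: "cmod (cnj (u x) * w x) \<le> C * (weight s x * cmod (u x))" for x
    using mult_left_mono[OF assms(2)[of x], of "cmod (u x)"] by (simp add: norm_mult mult_ac)
  have "(\<lambda>x. cmod (cnj (u x) * w x)) summable_on UNIV"
    by (rule Infinite_Sum.abs_summable_on_comparison_test'[OF summable_on_cmult_right[OF ell1_summable[OF assms(1)], of C]])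
      (use le in auto)
  then show "pairable u w" unfolding pairable_def by (rule abs_summable_summable)
  show "cmod \<langle>u, w\<rangle> \<le> C * ell1_norm s u"
    unfolding pairing_def ell1_norm_def infsum_cmult_right'[symmetric]
    by (rule norm_infsum_le[OF has_sum_infsum has_sum_infsum])
      (use le \<open>pairable u w\<close> ell1_summable[OF assms(1)] in \<open>auto simp: pairable_def intro!: summable_on_cmult_right\<close>)
qed

lemma pairable_ell1_dual: "u \<in> ell1 s \<Longrightarrow> w \<in> ell1_dual s \<Longrightarrow> pairable u w"
  using pairing_bound(1)[OF _ ell1_dual_bound] by blast

lemma pairable_dual_ell1: "u \<in> ell1_dual s \<Longrightarrow> w \<in> ell1 s \<Longrightarrow> pairable u w"
  using pairable_ell1_dual pairable_sym by blast

lemma pairing_bound_dual: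
  assumes "u \<in> ell1_dual s" "w \<in> ell1 s"
  shows "cmod \<langle>u, w\<rangle> \<le> ell1_dual_norm s u * ell1_norm s w"
  using pairing_bound(2)[OF assms(2) ell1_dual_bound[OF assms(1)]] pairing_commute[of u w] by simp

lemma pairing_add_right: "pairable u w \<Longrightarrow> pairable u w' \<Longrightarrow> \<langle>u, w + w'\<rangle> = \<langle>u, w\<rangle> + \<langle>u, w'\<rangle>"
  unfolding pairing_def pairable_def by (simp add: distrib_left infsum_add)

lemma pairing_scaleC_right: "\<langle>u, c *\<^sub>C w\<rangle> = c * \<langle>u, w\<rangle>"
  unfolding pairing_def by (simp add: mult.left_commute infsum_cmult_right')

lemma pairing_minus_right: "\<langle>u, - w\<rangle> = - \<langle>u, w\<rangle>"
  unfolding pairing_def by (simp add: infsum_uminus)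

lemma pairable_minus_right: "pairable u w \<Longrightarrow> pairable u (- w)"
  unfolding pairable_def by (simp add: summable_on_uminus)

lemma pairing_diff_right: "pairable u w \<Longrightarrow> pairable u w' \<Longrightarrow> \<langle>u, w - w'\<rangle> = \<langle>u, w\<rangle> - \<langle>u, w'\<rangle>"
  using pairing_add_right[of u w "-w'"] pairable_minus_right[of u w'] by (simp add: pairing_minus_right)

lemma pairing_add_left: "pairable u w \<Longrightarrow> pairable u' w \<Longrightarrow> \<langle>u + u', w\<rangle> = \<langle>u, w\<rangle> + \<langle>u', w\<rangle>"
  unfolding pairing_def pairable_def by (simp add: distrib_right infsum_add)

lemma pairing_scaleC_left: "\<langle>c *\<^sub>C u, w\<rangle> = cnj c * \<langle>u, w\<rangle>"
  unfolding pairing_def by (simp add: mult.assoc infsum_cmult_right')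

lemma pairing_minus_left: "\<langle>- u, w\<rangle> = - \<langle>u, w\<rangle>"
  unfolding pairing_def by (simp add: infsum_uminus)

lemma pairing_diff_left: "pairable u w \<Longrightarrow> pairable u' w \<Longrightarrow> \<langle>u - u', w\<rangle> = \<langle>u, w\<rangle> - \<langle>u', w\<rangle>"
  using pairing_add_left[of u w "-u'"] pairable_minus_right[of w u'] pairable_sym
  by (metis pairing_minus_left uminus_add_conv_diff add.commute)

lemma pairing_zero_left [simp]: "\<langle>0, w\<rangle> = 0" unfolding pairing_def by simp
lemma pairing_zero_right [simp]: "\<langle>w, 0\<rangle> = 0" unfolding pairing_def by simp

lemma pairable_0 [simp]: "pairable u 0" unfolding pairable_def by simp

lemma pairable_add_right: "pairable u w \<Longrightarrow> pairable u w' \<Longrightarrow> pairable u (w + w')"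
  unfolding pairable_def by (simp add: distrib_left summable_on_add)

lemma pairable_scaleC_right: "pairable u w \<Longrightarrow> pairable u (c *\<^sub>C w)"
  unfolding pairable_def by (simp add: mult.left_commute summable_on_cmult_right)

lemma pairable_sum_right: "(\<And>i. i \<in> I \<Longrightarrow> pairable u (f i)) \<Longrightarrow> pairable u (\<Sum>i\<in>I. f i)"
  by (induction I rule: infinite_finite_induct) (simp_all add: pairable_add_right)

lemma pairing_sum_right: "(\<And>i. i \<in> I \<Longrightarrow> pairable u (f i)) \<Longrightarrow> \<langle>u, \<Sum>i\<in>I. f i\<rangle> = (\<Sum>i\<in>I. \<langle>u, f i\<rangle>)"
  by (induction I rule: infinite_finite_induct) (simp_all add: pairing_add_right pairable_sum_right)

lemma pairing_sum_left: "(\<And>i. i \<in> I \<Longrightarrow> pairable (f i) w) \<Longrightarrow> \<langle>\<Sum>i\<in>I. f i, w\<rangle> = (\<Sum>i\<in>I. \<langle>f i, w\<rangle>)"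
  using pairing_sum_right[of I w f]
  by (simp add: pairable_sym pairing_commute[of "sum f I" w] pairing_commute[of "f _" w])

text \<open>Pairing with it is evaluation, so statements about values at a vertex become special
  cases of statements about pairings.\<close>

definition point_mass :: "('v, 'n) vertex \<Rightarrow> ('v, 'n) state" where
  "point_mass x = (\<lambda>y. if y = x then 1 else 0)"

lemma point_mass_ell1: "point_mass x \<in> ell1 s"
  unfolding ell1_def point_mass_def
  by (auto intro!: finite_nonzero_values_imp_summable_on intro: finite_subset[of _ "{x}"])

lemma pairing_point_mass: "\<langle>point_mass x, w\<rangle> = w x"
proof -
  have "\<langle>point_mass x, w\<rangle> = (\<Sum>\<^sub>\<infinity>y\<in>{x}. w y)"
    unfolding pairing_def point_mass_def by (intro infsum_cong_neutral) auto
  then show ?thesis by simp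
qed

subsection \<open>Operators with a kernel\<close>

text \<open>A kernel bounded by a product of weights maps \<open>ell1 s\<close> boundedly into its
  dual, with \<open>C\<close> as norm bound. The representation is demanded only on
  \<open>ell1 s\<close>, where the sum converges.\<close>

locale kernel_operator =
  fixes A :: "('v, 'n) op" and K :: "('v, 'n) vertex \<Rightarrow> ('v, 'n) vertex \<Rightarrow> complex"
    and s C :: real
  assumes kernel_bound: "\<And>x y. cmod (K x y) \<le> C * weight s x * weight s y"
    and hermitian: "\<And>x y. K y x = cnj (K x y)"
    and apply_kernel: "\<And>u x. u \<in> ell1 s \<Longrightarrow> A u x = (\<Sum>\<^sub>\<infinity>y. K x y * u y)"
begin

lemma C_nonneg: "0 \<le> C"
proof -
  have "0 \<le> C * weight s (undefined::('v,'n) vertex) * weight s (undefined::('v,'n) vertex)"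
    using kernel_bound[of undefined undefined] norm_ge_zero order_trans by blast
  then show ?thesis by (blast dest: nonneg_if_mult_weight_nonneg)
qed

lemma term_bound: "cmod (K x y * u y) \<le> C * weight s x * (weight s y * cmod (u y))"
  using mult_right_mono[OF kernel_bound[of x y], of "cmod (u y)"] by (simp add: norm_mult mult_ac)

lemma summable: "u \<in> ell1 s \<Longrightarrow> (\<lambda>y. K x y * u y) summable_on UNIV"
  by (rule abs_summable_summable, rule Infinite_Sum.abs_summable_on_comparison_test'
      [OF summable_on_cmult_right[OF ell1_summable, of u s "C * weight s x"]])
    (auto simp: term_bound)

lemma apply_bound:
  assumes "u \<in> ell1 s" shows "cmod (A u x) \<le> C * ell1_norm s u * weight s x"
proof -
  have "cmod (\<Sum>\<^sub>\<infinity>y. K x y * u y) \<le> (\<Sum>\<^sub>\<infinity>y. C * weight s x * (weight s y * cmod (u y)))"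
    by (rule norm_infsum_le[OF has_sum_infsum has_sum_infsum])
      (auto simp: term_bound summable[OF assms] ell1_summable[OF assms] summable_on_cmult_right)
  then show ?thesis unfolding apply_kernel[OF assms] infsum_cmult_right' ell1_norm_def[symmetric]
    by (simp add: mult_ac)
qed

lemma apply_dual: "u \<in> ell1 s \<Longrightarrow> A u \<in> ell1_dual s"
  by (rule ell1_dual_I[OF apply_bound])

lemma apply_add: "u \<in> ell1 s \<Longrightarrow> w \<in> ell1 s \<Longrightarrow> A (u + w) = A u + A w"
  by (rule ext) (simp add: apply_kernel ell1_add summable infsum_add distrib_left)

lemma apply_scaleC: "u \<in> ell1 s \<Longrightarrow> A (c *\<^sub>C u) = c *\<^sub>C A u"
  by (rule ext) (simp add: apply_kernel ell1_scaleC infsum_cmult_right' mult.left_commute)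

lemma apply_minus: "u \<in> ell1 s \<Longrightarrow> A (- u) = - A u"
  using apply_scaleC[of u "-1"] by (simp add: scaleC_minus_one)

lemma apply_diff: "u \<in> ell1 s \<Longrightarrow> w \<in> ell1 s \<Longrightarrow> A (u - w) = A u - A w"
  using apply_add[of u "-w"] by (simp add: ell1_minus apply_minus)

lemma apply_zero: "A 0 = 0"
  using apply_scaleC[of 0 0] by simp

lemma apply_sum: "(\<And>i. i \<in> I \<Longrightarrow> f i \<in> ell1 s) \<Longrightarrow> A (\<Sum>i\<in>I. f i) = (\<Sum>i\<in>I. A (f i))"
  by (induction I rule: infinite_finite_induct)
    (simp_all add: apply_zero apply_add csubspace_sum[OF csubspace_ell1])

text \<open>Fubini: the product bound dominates the double family by a product of two summable
  families, and the hermitian kernel moves \<open>A\<close> to the other side.\<close>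

lemma symmetric:
  assumes u: "u \<in> ell1 s" and w: "w \<in> ell1 s"
  shows "\<langle>A u, w\<rangle> = \<langle>u, A w\<rangle>"
proof -
  let ?f = "\<lambda>x y. cnj (u x) * (K x y * w y)"
  have le: "cmod (?f x y) \<le> C * ((weight s x * cmod (u x)) * (weight s y * cmod (w y)))" for x y
    using mult_left_mono[OF term_bound[of x y w], of "cmod (u x)"] by (simp add: norm_mult mult_ac)
  have "(\<lambda>(x, y). (weight s x * cmod (u x)) * (weight s y * cmod (w y))) summable_on UNIV \<times> UNIV"
  proof (rule summable_on_SigmaI[where g = "\<lambda>x. (weight s x * cmod (u x)) * ell1_norm s w"])
    show "((\<lambda>y. case (x, y) of (x, y) \<Rightarrow> (weight s x * cmod (u x)) * (weight s y * cmod (w y))) has_sum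
        (weight s x * cmod (u x)) * ell1_norm s w) UNIV" for x
      unfolding ell1_norm_def prod.case by (intro has_sum_cmult_right has_sum_infsum ell1_summable[OF w])
    show "(\<lambda>x. (weight s x * cmod (u x)) * ell1_norm s w) summable_on UNIV"
      by (intro summable_on_cmult_left ell1_summable[OF u])
  qed auto
  from summable_on_cmult_right[OF this, of C]
  have "(\<lambda>z. norm ((\<lambda>(x, y). ?f x y) z)) summable_on UNIV \<times> UNIV"
    by (rule Infinite_Sum.abs_summable_on_comparison_test') (use le in auto)
  then have S: "(\<lambda>(x, y). ?f x y) summable_on UNIV \<times> UNIV"
    by (rule abs_summable_summable)
  have "\<langle>u, A w\<rangle> = (\<Sum>\<^sub>\<infinity>x. \<Sum>\<^sub>\<infinity>y. ?f x y)"
    unfolding pairing_def by (simp add: apply_kernel[OF w] infsum_cmult_right')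
  also have "\<dots> = (\<Sum>\<^sub>\<infinity>y. \<Sum>\<^sub>\<infinity>x. ?f x y)" by (rule infsum_swap_banach[OF S])
  also have "\<dots> = (\<Sum>\<^sub>\<infinity>y. cnj (A u y) * w y)"
  proof (rule infsum_cong)
    fix y
    have "(\<Sum>\<^sub>\<infinity>x. ?f x y) = (\<Sum>\<^sub>\<infinity>x. cnj (K y x * u x)) * w y"
      unfolding infsum_cmult_left'[symmetric] by (simp add: hermitian[of _ y] mult_ac)
    then show "(\<Sum>\<^sub>\<infinity>x. ?f x y) = cnj (A u y) * w y" by (simp only: apply_kernel[OF u] infsum_cnj)
  qed
  finally show ?thesis by (simp add: pairing_def)
qed

text \<open>Raising the exponent relaxes the bound, as the weight grows with it, and shrinks the
  domain; so one constant serves all larger exponents.\<close>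

lemma weaken:
  assumes "s \<le> t" shows "kernel_operator A K t C"
proof
  fix x y :: "('v, 'n) vertex"
  have "C * weight s x * weight s y \<le> C * weight t x * weight t y"
    by (intro mult_mono mult_nonneg_nonneg weight_mono assms order_refl C_nonneg weight_nonneg)
  then show "cmod (K x y) \<le> C * weight t x * weight t y" using kernel_bound[of x y] by linarith
  show "K y x = cnj (K x y)" by (rule hermitian)
qed (rule apply_kernel, rule ell1_mono(1)[OF _ assms])

end

section \<open>The half-line\<close>

subsection \<open>The decaying solution\<close>

text \<open>The root \<open>z\<close> of \<open>z + 1 / z = 2 + \<kappa>\<^sup>2\<close> in the unit disc.\<close>

definition decay_rate :: "complex \<Rightarrow> complex" where
  "decay_rate \<kappa> = (csqrt (1 + \<kappa>\<^sup>2 / 4) - \<kappa> / 2)\<^sup>2"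

locale small_kappa =
  fixes \<kappa> :: complex
  assumes Re_kappa: "0 < Re \<kappa>" and norm_kappa: "cmod \<kappa> < 1"
begin

abbreviation "z \<equiv> decay_rate \<kappa>"
definition c :: complex where
  "c = csqrt (1 + \<kappa>\<^sup>2 / 4)"

lemma csq: "c\<^sup>2 = 1 + \<kappa>\<^sup>2 / 4"
  by (simp add: c_def)

lemma norm_kappa_power: "cmod \<kappa> ^ n \<le> 1"
  using norm_kappa by (simp add: power_le_one)

text \<open>For \<open>cmod \<kappa> < 1\<close> the number under the root has positive real part,
  so its root is not purely imaginary; the principal branch decides the sign.\<close>

lemma Re_c: "0 < Re c"
proof -
  have "cmod (\<kappa>\<^sup>2 / 4) \<le> 1 / 4" using norm_kappa_power[of 2] by (simp add: norm_divide norm_power)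
  then have "- (1/4) \<le> Re (\<kappa>\<^sup>2 / 4)" using abs_Re_le_cmod[of "\<kappa>\<^sup>2 / 4"] by linarith
  then have pos: "0 < Re (1 + \<kappa>\<^sup>2 / 4)" by simp
  have "Re c \<noteq> 0"
  proof
    assume "Re c = 0"
    then have "c\<^sup>2 = - of_real ((Im c)\<^sup>2)" by (simp add: complex_eq_iff power2_eq_square)
    then have "1 + \<kappa>\<^sup>2 / 4 = - complex_of_real ((Im c)\<^sup>2)" by (simp only: csq)
    from arg_cong[OF this, of Re] have "Re (1 + \<kappa>\<^sup>2 / 4) = - ((Im c)\<^sup>2)"
      by (simp only: uminus_complex.simps Re_complex_of_real)
    then show False using pos zero_le_power2[of "Im c"] by linarith
  qed
  then show ?thesis using csqrt_principal[of "1 + \<kappa>\<^sup>2 / 4"] unfolding c_def[symmetric] by auto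
qed

text \<open>With \<open>s = c - \<kappa> / 2\<close> this says
  \<open>1 / s = c + \<kappa> / 2\<close>, hence \<open>1 / s - s = \<kappa>\<close>. As
  \<open>z = s^2\<close>, squaring gives \<open>z + 1 / z - 2 = \<kappa>^2\<close>; this is why
  \<open>decay_rate\<close> is written as a square.\<close>

lemma roots_mult: "(c - \<kappa> / 2) * (c + \<kappa> / 2) = 1"
  using csq by (simp add: algebra_simps power2_eq_square)

lemma z_equation: "z\<^sup>2 + 1 = (2 + \<kappa>\<^sup>2) * z"
proof -
  let ?s = "c - \<kappa> / 2"
  have "?s\<^sup>2 + \<kappa> * ?s - 1 = c\<^sup>2 - \<kappa>\<^sup>2 / 4 - 1" by (simp add: power2_eq_square algebra_simps)
  then have s: "1 - ?s\<^sup>2 = \<kappa> * ?s" using csq by (simp add: algebra_simps)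
  have "(1 - ?s\<^sup>2)\<^sup>2 = \<kappa>\<^sup>2 * ?s\<^sup>2" unfolding s by (simp add: power_mult_distrib)
  then show ?thesis unfolding decay_rate_def c_def[symmetric] by (simp add: power2_eq_square algebra_simps)
qed

text \<open>Both \<open>?s\<close> and \<open>?t = 1 / ?s\<close> have positive real part, and
  \<open>Re ?t = Re ?s / (cmod ?s)^2\<close> exceeds \<open>Re ?s\<close> because
  \<open>Re \<kappa> > 0\<close>; so \<open>cmod ?s < 1\<close>.\<close>

lemma norm_z_less_1: "cmod z < 1"
proof -
  let ?s = "c - \<kappa> / 2" and ?t = "c + \<kappa> / 2"
  have t0: "?t \<noteq> 0" using roots_mult by auto
  have s: "?s = inverse ?t" using roots_mult t0 by (simp add: field_simps)
  have "0 < Re ?t" using Re_c Re_kappa by simp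
  moreover have "0 < (Re ?t)\<^sup>2 + (Im ?t)\<^sup>2" using \<open>0 < Re ?t\<close> by (simp add: sum_power2_gt_zero_iff)
  ultimately have "0 < Re ?s" unfolding s by (simp only: inverse_complex.simps) simp
  have "Re ?s < Re ?t" using Re_kappa by simp
  moreover have "Re ?t = Re ?s / (cmod ?s)\<^sup>2"
  proof -
    have "?t = inverse ?s" using s by simp
    then show ?thesis by (simp only: inverse_complex.simps cmod_power2)
  qed
  moreover have "?s \<noteq> 0"
  proof
    assume "?s = 0"
    then have "Re ?s = 0" by (simp only: zero_complex.simps)
    then show False using \<open>0 < Re ?s\<close> by linarith
  qed
  then have n: "0 < (cmod ?s)\<^sup>2" by simp
  ultimately have "Re ?s * (cmod ?s)\<^sup>2 < Re ?s / (cmod ?s)\<^sup>2 * (cmod ?s)\<^sup>2"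
    by (metis mult_strict_right_mono)
  then have "Re ?s * (cmod ?s)\<^sup>2 < Re ?s * 1" using n by (simp only: times_divide_eq_left nonzero_mult_div_cancel_right)
  then have "(cmod ?s)\<^sup>2 < 1" using \<open>0 < Re ?s\<close> by (simp only: mult_less_cancel_left_pos)
  then show ?thesis by (simp add: decay_rate_def norm_power c_def[symmetric])
qed

lemma norm_z_power: "cmod (z ^ n) \<le> 1"
  using norm_z_less_1 by (simp add: norm_power power_le_one)

lemma z_neq_0: "z \<noteq> 0"
  using z_equation by auto

lemma z_squared_neq_1: "1 - z\<^sup>2 \<noteq> 0"
proof
  assume "1 - z\<^sup>2 = 0"
  then have "(cmod z)\<^sup>2 = 1" by (simp flip: norm_power)
  then show False using norm_z_less_1 norm_ge_zero[of z] by (auto simp: power2_eq_1_iff)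
qed

text \<open>\<open>z = 1 + \<kappa>^2 / 2 - c \<kappa>\<close>, so only \<open>c\<close> has to be
  expanded, to \<open>1 + \<kappa>^2 / 8\<close>. Multiplying the error \<open>?r\<close> by
  \<open>c + 1 + \<kappa>^2 / 8\<close>, of modulus at least 1/2, leaves
  \<open>- \<kappa>^4 / 64\<close>.\<close>

lemma z_expansion: "cmod (z - (1 - \<kappa> + \<kappa>\<^sup>2 / 2 - \<kappa>^3 / 8)) \<le> cmod \<kappa> ^ 4"
proof -
  let ?r = "c - (1 + \<kappa>\<^sup>2 / 8)"
  have "cmod (\<kappa>\<^sup>2 / 8) \<le> 1 / 8" using norm_kappa_power[of 2] by (simp add: norm_divide norm_power)
  then have "- (1/8) \<le> Re (\<kappa>\<^sup>2 / 8)" using abs_Re_le_cmod[of "\<kappa>\<^sup>2 / 8"] by linarith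
  then have "1 / 2 \<le> Re (c + 1 + \<kappa>\<^sup>2 / 8)" using Re_c by simp
  then have half: "1 / 2 \<le> cmod (c + 1 + \<kappa>\<^sup>2 / 8)" using complex_Re_le_cmod order_trans by blast
  have "?r * (c + 1 + \<kappa>\<^sup>2 / 8) = c\<^sup>2 - (1 + \<kappa>\<^sup>2 / 8)\<^sup>2" by (simp add: power2_eq_square algebra_simps)
  also have "\<dots> = - (\<kappa>^4 / 64)"
    unfolding csq by (simp add: power2_eq_square power4_eq_xxxx algebra_simps)
  finally have "cmod ?r * cmod (c + 1 + \<kappa>\<^sup>2 / 8) = cmod \<kappa> ^ 4 / 64"
    by (metis norm_minus_cancel norm_mult norm_divide norm_power norm_numeral)
  moreover have "cmod ?r * (1 / 2) \<le> cmod ?r * cmod (c + 1 + \<kappa>\<^sup>2 / 8)"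
    by (intro mult_left_mono half) simp
  ultimately have r: "cmod ?r \<le> cmod \<kappa> ^ 4" using zero_le_power[OF norm_ge_zero, of \<kappa> 4] by linarith
  have "z = c\<^sup>2 - c * \<kappa> + \<kappa>\<^sup>2 / 4" unfolding decay_rate_def c_def[symmetric] by (simp add: power2_eq_square algebra_simps)
  then have "z - (1 - \<kappa> + \<kappa>\<^sup>2 / 2 - \<kappa>^3 / 8) = - (\<kappa> * ?r)"
    unfolding csq by (simp add: power2_eq_square power3_eq_cube algebra_simps)
  then have "cmod (z - (1 - \<kappa> + \<kappa>\<^sup>2 / 2 - \<kappa>^3 / 8)) = cmod \<kappa> * cmod ?r"
    by (simp only: norm_minus_cancel norm_mult)
  also have "\<dots> \<le> 1 * cmod \<kappa> ^ 4" using norm_kappa r by (intro mult_mono) auto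
  finally show ?thesis by simp
qed

end

text \<open>The Taylor coefficients at \<open>\<kappa> = 0\<close> of \<open>\<kappa> \<mapsto> decay_rate \<kappa> ^ k\<close>.\<close>

definition decay_coeff :: "nat \<Rightarrow> real \<Rightarrow> real" where
  "decay_coeff j k = (if j = 0 then 1 else if j = 1 then - k else if j = 2 then k\<^sup>2 / 2
     else if j = 3 then k / 24 - k ^ 3 / 6 else 0)"

lemma decay_coeff_3_bound: "x \<le> x ^ 3 \<Longrightarrow> 0 \<le> x \<Longrightarrow> \<bar>decay_coeff 3 x\<bar> \<le> x ^ 3"
  by (simp add: decay_coeff_def abs_le_iff)

lemma one_plus_cubed:
  fixes x :: real assumes "0 \<le> x"
  shows "(x + 1) ^ 3 = x ^ 3 + 3 * x\<^sup>2 + 3 * x + 1" "0 \<le> x ^ 3" "0 \<le> x\<^sup>2"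
  using assms by (simp_all add: power2_eq_square power3_eq_cube algebra_simps)

text \<open>Numerical ends of the next two estimates, after powers of \<open>cmod \<kappa>\<close>
  have been replaced by 1. The visible factors 1 keep the shape in which those bounds are
  produced.\<close>

lemma cubic_bounds:
  fixes x :: real assumes "0 \<le> x"
  shows "1 + 1 * x + 1 * x\<^sup>2 / 2 + 1 * (x / 24 + x ^ 3 / 6) \<le> 3 * (x + 1) ^ 3"
    and "(x ^ 3 / 6 + x\<^sup>2 / 4 + x / 12) + 1 * (x / 48 + x ^ 3 / 12 + x\<^sup>2 / 16)
      + 1 * (x / 192 + x ^ 3 / 48) \<le> (x + 1) ^ 3"
proof -
  \<comment> \<open>With the cube and the square of \<open>x\<close> treated as independent
    nonnegative quantities \<open>a\<close> and \<open>b\<close>, the claims are linear.\<close>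
  have "1 + 1 * x + 1 * b / 2 + 1 * (x / 24 + a / 6) \<le> 3 * (a + 3 * b + 3 * x + 1)"
    and "(a / 6 + b / 4 + x / 12) + 1 * (x / 48 + a / 12 + b / 16) + 1 * (x / 192 + a / 48)
      \<le> a + 3 * b + 3 * x + 1" if "0 \<le> a" "0 \<le> b" for a b
    using that assms by simp_all
  from this[OF one_plus_cubed(2,3)[OF assms]]
  show "1 + 1 * x + 1 * x\<^sup>2 / 2 + 1 * (x / 24 + x ^ 3 / 6) \<le> 3 * (x + 1) ^ 3"
    and "(x ^ 3 / 6 + x\<^sup>2 / 4 + x / 12) + 1 * (x / 48 + x ^ 3 / 12 + x\<^sup>2 / 16)
      + 1 * (x / 192 + x ^ 3 / 48) \<le> (x + 1) ^ 3"
    by (simp_all only: one_plus_cubed[OF assms])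
qed

context small_kappa
begin

text \<open>The cubic Taylor polynomial of \<open>z ^ k\<close>. It can be read off from
  \<open>z = exp (- 2 arsinh (\<kappa> / 2))\<close>, whose exponent is
  \<open>- \<kappa> + \<kappa>^3 / 24\<close> up to order 5.\<close>

definition q :: "nat \<Rightarrow> complex" where
  "q k = 1 - \<kappa> * of_nat k + \<kappa>\<^sup>2 * (of_nat k)\<^sup>2 / 2 + \<kappa>^3 * (of_nat k / 24 - (of_nat k)^3 / 6)"

lemma norm_q_le: "cmod (q k) \<le> 3 * (real k + 1) ^ 3"
proof -
  have "cmod (q k) \<le> cmod 1 + cmod (\<kappa> * of_nat k) + cmod (\<kappa>\<^sup>2 * (of_nat k)\<^sup>2 / 2)
      + cmod (\<kappa>^3 * (of_nat k / 24 - (of_nat k)^3 / 6))"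
    unfolding q_def by (intro norm_triangle_le add_mono norm_triangle_le_diff order_refl)
  also have "\<dots> \<le> 1 + 1 * real k + 1 * (real k)\<^sup>2 / 2 + 1 * (real k / 24 + (real k) ^ 3 / 6)"
  proof (intro add_mono)
    show "cmod (\<kappa> * of_nat k) \<le> 1 * real k"
      using norm_kappa by (simp add: norm_mult mult_left_le_one_le)
    show "cmod (\<kappa>\<^sup>2 * (of_nat k)\<^sup>2 / 2) \<le> 1 * (real k)\<^sup>2 / 2"
      using norm_kappa_power[of 2] by (simp add: norm_mult norm_divide norm_power mult_left_le_one_le)
    have "cmod (of_nat k / 24 - (of_nat k)^3 / 6 :: complex) \<le> real k / 24 + (real k) ^ 3 / 6"
      by (rule order_trans[OF norm_triangle_ineq4]) (simp add: norm_divide norm_power)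
    then show "cmod (\<kappa>^3 * (of_nat k / 24 - (of_nat k)^3 / 6)) \<le> 1 * (real k / 24 + (real k) ^ 3 / 6)"
      unfolding norm_mult norm_power using norm_kappa_power[of 3] by (intro mult_mono) auto
  qed simp
  also have "\<dots> \<le> 3 * (real k + 1) ^ 3"
    by (rule cubic_bounds) simp
  finally show ?thesis .
qed

text \<open>\<open>q (Suc k)\<close> and the product of \<open>q k\<close> with the cubic Taylor
  polynomial of \<open>z\<close> agree up to degree 3, so their difference carries a factor
  \<open>\<kappa>^4\<close>. The constant is 1 for this difference plus 3 for replacing the
  polynomial by \<open>z\<close>.\<close>

lemma q_step: "cmod (q (Suc k) - z * q k) \<le> 4 * cmod \<kappa> ^ 4 * (real k + 1) ^ 3"
proof -
  let ?p = "1 - \<kappa> + \<kappa>\<^sup>2 / 2 - \<kappa>^3 / 8"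
  let ?x = "of_nat k :: complex"
  let ?A = "- (?x^3) / 6 - ?x\<^sup>2 / 4 - ?x / 12" and ?B = "- ?x / 48 + ?x^3 / 12 + ?x\<^sup>2 / 16" and ?C = "?x / 192 - ?x^3 / 48"
  have D: "q (Suc k) - ?p * q k = \<kappa>^4 * (?A + \<kappa> * ?B + \<kappa>\<^sup>2 * ?C)"
    unfolding q_def by (simp add: field_simps power2_eq_square power3_eq_cube power4_eq_xxxx)
  have A: "cmod ?A \<le> real k ^ 3 / 6 + (real k)\<^sup>2 / 4 + real k / 12"
    by (intro norm_triangle_le_diff add_mono) (simp_all add: norm_divide norm_power)
  have B: "cmod ?B \<le> real k / 48 + real k ^ 3 / 12 + (real k)\<^sup>2 / 16"
    by (intro norm_triangle_le add_mono) (simp_all add: norm_divide norm_power)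
  have C: "cmod ?C \<le> real k / 192 + real k ^ 3 / 48"
    by (intro norm_triangle_le_diff add_mono) (simp_all add: norm_divide norm_power)
  have kB: "cmod (\<kappa> * ?B) \<le> 1 * (real k / 48 + real k ^ 3 / 12 + (real k)\<^sup>2 / 16)"
    unfolding norm_mult using norm_kappa by (intro mult_mono B) auto
  have kC: "cmod (\<kappa>\<^sup>2 * ?C) \<le> 1 * (real k / 192 + real k ^ 3 / 48)"
    unfolding norm_mult norm_power using norm_kappa_power[of 2] by (intro mult_mono C) auto
  have "cmod (?A + \<kappa> * ?B + \<kappa>\<^sup>2 * ?C) \<le> (real k ^ 3 / 6 + (real k)\<^sup>2 / 4 + real k / 12)
     + 1 * (real k / 48 + real k ^ 3 / 12 + (real k)\<^sup>2 / 16) + 1 * (real k / 192 + real k ^ 3 / 48)"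
    by (intro norm_triangle_le add_mono A kB kC)
  also have "\<dots> \<le> (real k + 1) ^ 3"
    by (rule cubic_bounds) simp
  finally have "cmod (q (Suc k) - ?p * q k) \<le> cmod \<kappa> ^ 4 * (real k + 1) ^ 3"
    unfolding D norm_mult norm_power by (intro mult_left_mono) auto
  moreover have "cmod ((z - ?p) * q k) \<le> cmod \<kappa> ^ 4 * (3 * (real k + 1) ^ 3)"
    unfolding norm_mult by (intro mult_mono z_expansion norm_q_le) auto
  moreover have "q (Suc k) - z * q k = (q (Suc k) - ?p * q k) - (z - ?p) * q k"
    by (simp only: ring_distribs) simp
  then have "cmod (q (Suc k) - z * q k) \<le> cmod (q (Suc k) - ?p * q k) + cmod ((z - ?p) * q k)"
    by (simp only: norm_triangle_ineq4)
  moreover have "4 * cmod \<kappa> ^ 4 * (real k + 1) ^ 3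
      = cmod \<kappa> ^ 4 * (real k + 1) ^ 3 + cmod \<kappa> ^ 4 * (3 * (real k + 1) ^ 3)" by simp
  ultimately show ?thesis by linarith
qed

text \<open>Passing from \<open>k\<close> to \<open>k + 1\<close> multiplies the old error by
  \<open>z\<close>, which does not enlarge it, and adds that of \<open>q_step\<close>; the sum
  closes because \<open>k^4 + (k + 1)^3 \<le> (k + 1)^4\<close>.\<close>

lemma z_power_expansion_4: "cmod (z ^ k - q k) \<le> 4 * cmod \<kappa> ^ 4 * real k ^ 4"
proof (induction k)
  case (Suc k)
  have "z ^ Suc k - q (Suc k) = z * (z ^ k - q k) - (q (Suc k) - z * q k)"
    by (simp add: algebra_simps)
  also have "cmod \<dots> \<le> cmod z * cmod (z ^ k - q k) + cmod (q (Suc k) - z * q k)"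
    by (metis norm_mult norm_triangle_ineq4)
  also have "\<dots> \<le> 1 * (4 * cmod \<kappa> ^ 4 * real k ^ 4) + 4 * cmod \<kappa> ^ 4 * (real k + 1) ^ 3"
    using norm_z_less_1 by (intro add_mono mult_mono Suc q_step) auto
  also have "\<dots> = 4 * cmod \<kappa> ^ 4 * (real k ^ 4 + (real k + 1) ^ 3)" by (simp add: algebra_simps)
  also have "\<dots> \<le> 4 * cmod \<kappa> ^ 4 * real (Suc k) ^ 4"
  proof (intro mult_left_mono)
    have "real k ^ 4 = real k * real k ^ 3" by (simp add: power_Suc[symmetric] del: power_Suc)
    also have "\<dots> \<le> real k * (real k + 1) ^ 3" by (intro mult_left_mono power_mono) auto
    finally show "real k ^ 4 + (real k + 1) ^ 3 \<le> real (Suc k) ^ 4"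
      by (simp add: algebra_simps numeral_eq_Suc)
  qed auto
  finally show ?case .
qed (simp add: q_def)

text \<open>With three terms the remainder must not contain a fourth power of \<open>k\<close>. For
  \<open>t \<le> 1\<close> it follows from the four-term estimate; for \<open>t > 1\<close> from
  \<open>cmod (z ^ k) \<le> 1\<close>, since then \<open>t^3\<close> dominates every term of the
  polynomial.\<close>

lemma z_power_expansion:
  assumes k: "1 \<le> k" and J: "J = 3 \<or> J = 4"
  shows "cmod (z ^ k - (\<Sum>j<J. \<kappa> ^ j * of_real (decay_coeff j (real k)))) \<le> 5 * (cmod \<kappa> * real k) ^ J"
proof -
  define t where "t = cmod \<kappa> * real k"
  have t0: "0 \<le> t" by (simp add: t_def)
  have q4: "(\<Sum>j<4. \<kappa> ^ j * of_real (decay_coeff j (real k))) = q k"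
    by (simp add: q_def decay_coeff_def numeral_eq_Suc lessThan_Suc)
  have E4: "cmod (z ^ k - q k) \<le> 4 * t ^ 4"
    using z_power_expansion_4[of k] by (simp add: t_def power_mult_distrib)
  show ?thesis
  proof (cases "J = 4")
    case True
    then show ?thesis unfolding True q4 t_def[symmetric] using E4 zero_le_power[OF t0, of 4] by linarith
  next
    case False
    then have [simp]: "J = 3" using J by simp
    let ?e = "of_real (decay_coeff 3 (real k)) :: complex"
    let ?q3 = "1 - \<kappa> * of_nat k + \<kappa>\<^sup>2 * (of_nat k)\<^sup>2 / 2"
    have q3: "(\<Sum>j<3. \<kappa> ^ j * of_real (decay_coeff j (real k))) = ?q3"
      by (simp add: decay_coeff_def numeral_eq_Suc lessThan_Suc)
    have "cmod (z ^ k - ?q3) \<le> 5 * t ^ 3"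
    proof (cases "t \<le> 1")
      case True
      have "real k \<le> real k ^ 3" using k by (intro self_le_power) auto
      then have "\<bar>decay_coeff 3 (real k)\<bar> \<le> real k ^ 3" by (rule decay_coeff_3_bound) simp
      then have "cmod (\<kappa>^3 * ?e) \<le> cmod \<kappa> ^ 3 * real k ^ 3"
        unfolding norm_mult norm_power norm_of_real by (intro mult_left_mono) auto
      then have "cmod (\<kappa>^3 * ?e) \<le> t ^ 3" by (simp add: t_def power_mult_distrib)
      moreover have "t ^ 4 \<le> t ^ 3" using True t0 by (intro power_decreasing) auto
      moreover have "z ^ k - ?q3 = (z ^ k - q k) + \<kappa>^3 * ?e" by (simp add: q_def decay_coeff_def)
      then have "cmod (z ^ k - ?q3) \<le> cmod (z ^ k - q k) + cmod (\<kappa>^3 * ?e)"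
        by (simp only: norm_triangle_ineq)
      ultimately show ?thesis using E4 by linarith
    next
      case False
      have "cmod (z ^ k - ?q3) \<le> cmod (z ^ k) + cmod ?q3" by (rule norm_triangle_ineq4)
      also have "\<dots> \<le> 1 + (1 + t + t\<^sup>2 / 2)"
      proof (intro add_mono)
        show "cmod (z ^ k) \<le> 1" using norm_z_less_1 by (simp add: norm_power power_le_one)
        have "cmod (\<kappa> * of_nat k) \<le> t" "cmod (\<kappa>\<^sup>2 * (of_nat k)\<^sup>2 / 2) \<le> t\<^sup>2 / 2"
          by (simp_all add: t_def norm_mult norm_divide norm_power power_mult_distrib)
        then show "cmod ?q3 \<le> 1 + t + t\<^sup>2 / 2"
          using norm_triangle_ineq[of "1 - \<kappa> * of_nat k" "\<kappa>\<^sup>2 * (of_nat k)\<^sup>2 / 2"]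
            norm_triangle_ineq4[of 1 "\<kappa> * of_nat k"] by simp
      qed
      also have "\<dots> \<le> 5 * t ^ 3"
      proof -
        have "1 \<le> t ^ 3" "t \<le> t ^ 3" "t\<^sup>2 \<le> t ^ 3"
          using False by (auto intro: self_le_power power_increasing one_le_power)
        then show ?thesis by linarith
      qed
      finally show ?thesis .
    qed
    then show ?thesis unfolding \<open>J = 3\<close> q3 t_def .
  qed
qed

end

subsection \<open>The resolvent kernel\<close>

lemma lead_kernel_commute: "lead_kernel j n m = lead_kernel j m n"
  by (simp add: lead_kernel_def min.commute max.commute mult_ac)

text \<open>Here the prescribed kernels are recognised: for coordinates \<open>p\<close> and
  \<open>p + d\<close> the resolvent kernel is the sum of \<open>z ^ (d + 1 + 2 i)\<close> over
  \<open>i < p\<close>, and its Taylor coefficients are the values of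
  \<open>lead_kernel\<close>.\<close>

lemma sum_decay_coeff_diff:
  assumes "j < 4"
  shows "(\<Sum>i<p. decay_coeff j (real (d + 1 + 2 * i))) = lead_kernel j (real (p + d)) (real p)"
proof (induction p)
  case (Suc p)
  have "j = 0 \<or> j = 1 \<or> j = 2 \<or> j = 3" using assms by auto
  then show ?case unfolding sum.lessThan_Suc Suc
    by (auto simp: decay_coeff_def lead_kernel_def field_simps power2_eq_square power3_eq_cube)
qed (simp add: lead_kernel_def)

lemma sum_decay_coeff:
  assumes "j < 4"
  shows "(\<Sum>i\<le>min k l. decay_coeff j (real (max k l - min k l + 1 + 2 * i))) = lead_kernel j (pos k) (pos l)"
proof (cases "k \<le> l")
  case True
  then show ?thesis using sum_decay_coeff_diff[OF assms, of "l - k" "Suc k"]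
    by (simp add: lessThan_Suc_atMost pos_def lead_kernel_commute[of j "1 + real k"] add_ac)
next
  case False
  then show ?thesis using sum_decay_coeff_diff[OF assms, of "k - l" "Suc l"]
    by (simp add: lessThan_Suc_atMost pos_def add_ac)
qed

text \<open>The exponent is at least 1 even for \<open>j = 0\<close>, as the minimum is unbounded.
  Every monomial is raised to \<open>(n m)^J\<close> by inserting factors that are at least
  1.\<close>

lemma lead_kernel_bound:
  assumes "max 1 j \<le> J" "1 \<le> n" "1 \<le> m"
  shows "\<bar>lead_kernel j n m\<bar> \<le> (n * m) ^ J"
proof -
  have nm: "1 \<le> n * m" using assms mult_mono[of 1 n 1 m] by simp
  have P: "(n * m) ^ i \<le> (n * m) ^ J" if "i \<le> J" for i using nm that by (rule power_increasing[rotated])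
  have p1: "n * m \<le> (n * m) ^ J" using P[of 1] assms by simp
  consider "j = 0" | "j = 1" | "j = 2" | "j = 3" | "j \<ge> 4" by linarith
  then show ?thesis
  proof cases
    case 1
    have "n * 1 \<le> n * m" using assms by (intro mult_left_mono) auto
    then have "min n m \<le> n * m" by linarith
    then show ?thesis using 1 p1 assms by (simp add: lead_kernel_def)
  next
    case 2 then show ?thesis using p1 nm by (simp add: lead_kernel_def)
  next
    case 3
    define a b where "a = min n m" and "b = max n m"
    have ab: "n * m = a * b" "1 \<le> a" "1 \<le> b" "a \<le> b"
      using assms by (auto simp: a_def b_def min_def max_def)
    have 1: "a \<le> (a * b)\<^sup>2"
    proof -
      have "a * 1 \<le> a * b" using ab by (intro mult_left_mono) auto
      moreover have "a * b \<le> (a * b)\<^sup>2" using ab nm by (intro self_le_power) auto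
      ultimately show ?thesis by simp
    qed
    have 2: "a ^ 3 \<le> (a * b)\<^sup>2"
    proof -
      have "a ^ 3 = a\<^sup>2 * a" by (simp add: power2_eq_square power3_eq_cube)
      also have "\<dots> \<le> a\<^sup>2 * b\<^sup>2"
        using ab self_le_power[of b 2] by (intro mult_left_mono) auto
      finally show ?thesis by (simp add: power_mult_distrib)
    qed
    have c3: "a * b * b \<le> (a * b)\<^sup>2"
      using ab mult_right_mono[of 1 a "a * b * b"] by (simp add: power2_eq_square mult_ac)
    have "lead_kernel j n m = - (1/6) * a + (1/6) * a ^ 3 + (1/2) * (a * b * b)"
      using \<open>j = 2\<close> ab(1) by (simp add: lead_kernel_def a_def b_def)
    moreover have "0 \<le> a" "0 \<le> a ^ 3" "0 \<le> a * b * b" using ab by auto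
    ultimately have "\<bar>lead_kernel j n m\<bar> \<le> (a * b)\<^sup>2" using 1 2 c3 by linarith
    then show ?thesis using P[of 2] ab(1) 3 assms by auto
  next
    case 4
    have n3: "0 \<le> n * m" "n * m \<le> (n * m) ^ 3" using nm self_le_power[of "n * m" 3] by auto
    have "n ^ 3 * m * 1 \<le> n ^ 3 * m * m\<^sup>2" "1 * (n * m ^ 3) \<le> n\<^sup>2 * (n * m ^ 3)"
      using assms one_le_power[of n 2] one_le_power[of m 2] by (auto intro!: mult_left_mono mult_right_mono)
    then have "n ^ 3 * m \<le> (n * m) ^ 3" "n * m ^ 3 \<le> (n * m) ^ 3"
      by (simp_all add: power_mult_distrib power2_eq_square power3_eq_cube mult_ac)
    moreover have "0 \<le> n ^ 3 * m" "0 \<le> n * m ^ 3" using assms by auto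
    ultimately have "\<bar>lead_kernel j n m\<bar> \<le> (n * m) ^ 3"
      using n3 4 unfolding lead_kernel_def abs_le_iff by simp
    then show ?thesis using P[of 3] 4 assms by auto
  next
    case 5 then show ?thesis using nm by (simp add: lead_kernel_def)
  qed
qed

text \<open>\<open>lead_ham\<close> involves at most three values in the first variable, so it can
  be exchanged with the sum over the second.\<close>

lemma has_sum_lead_ham:
  assumes "\<And>k. ((\<lambda>l. R k l * f l) has_sum S k) UNIV"
  shows "((\<lambda>l. lead_ham (\<lambda>k. R k l) k * f l) has_sum lead_ham S k) UNIV"
proof (cases k)
  case 0
  have "((\<lambda>l. 2 * (R 0 l * f l) + - (R 1 l * f l)) has_sum (2 * S 0 + - S 1)) UNIV"
    by (intro has_sum_add has_sum_cmult_right has_sum_uminusI assms)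
  then show ?thesis using 0 by (simp add: lead_ham_def algebra_simps)
next
  case (Suc j)
  have "((\<lambda>l. 2 * (R k l * f l) + - (R (Suc k) l * f l) + - (R j l * f l)) has_sum
      (2 * S k + - S (Suc k) + - S j)) UNIV"
    by (intro has_sum_add has_sum_cmult_right has_sum_uminusI assms)
  then show ?thesis using Suc by (simp add: lead_ham_def algebra_simps)
qed

lemma has_sum_sum:
  fixes f :: "'i \<Rightarrow> 'a \<Rightarrow> 'b::topological_comm_monoid_add"
  assumes "\<And>i. i \<in> I \<Longrightarrow> (f i has_sum s i) A"
  shows "((\<lambda>x. \<Sum>i\<in>I. f i x) has_sum (\<Sum>i\<in>I. s i)) A"
  using assms by (induction I rule: infinite_finite_induct) (auto intro: has_sum_add)

lemma has_sum_delta: "((\<lambda>l. (if l = k then 1 else 0) * f l) has_sum (f k :: complex)) UNIV"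
proof -
  have "((\<lambda>l. f l) has_sum f k) {k}" by (simp add: has_sum_finiteI)
  then show ?thesis by (subst has_sum_cong_neutral[where g = "\<lambda>l. f l" and T = "{k}"]) auto
qed

lemma lead_ham_min: "lead_ham (\<lambda>k. complex_of_real (lead_kernel 0 (pos k) (pos l))) k = (if l = k then 1 else 0)"
  by (cases k) (auto simp: lead_ham_def lead_kernel_def pos_def min_def)

text \<open>The equation at the first point acts as a boundary value 0 at coordinate 0, so among
  affine functions only multiples of the coordinate remain. The induction carries two consecutive
  values since the recursion has order two.\<close>

lemma lead_ham_eq_0:
  assumes "\<And>k. lead_ham w k = 0"
  shows "w k = of_real (pos k) * w 0"
proof -
  have "w k = of_real (pos k) * w 0 \<and> w (Suc k) = of_real (pos (Suc k)) * w 0"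
  proof (induction k)
    case 0
    then show ?case using assms[of 0] by (simp add: lead_ham_def pos_def)
  next
    case (Suc k)
    then show ?case using assms[of "Suc k"] by (simp add: lead_ham_def pos_def algebra_simps)
  qed
  then show ?thesis by simp
qed

text \<open>In coordinates \<open>n\<close>, \<open>m\<close> this is
  \<open>z (z^|n-m| - z^(n+m)) / (1 - z^2)\<close>, the reflection formula for the half-line. The
  finite geometric sum stays regular at \<open>\<kappa> = 0\<close>, where \<open>1 - z^2\<close>
  vanishes.\<close>

definition lead_resolvent :: "complex \<Rightarrow> nat \<Rightarrow> nat \<Rightarrow> complex" where
  "lead_resolvent \<kappa> k l = (\<Sum>i\<le>min k l. decay_rate \<kappa> ^ (max k l - min k l + 1 + 2 * i))"

context small_kappa
begin

abbreviation "R \<equiv> lead_resolvent \<kappa>"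

lemma geometric: "(1 - z\<^sup>2) * R k l = z ^ (max k l - min k l + 1) - z ^ (k + l + 3)"
proof -
  have "R k l = z ^ (max k l - min k l + 1) * (\<Sum>i<Suc (min k l). (z\<^sup>2) ^ i)"
    unfolding lead_resolvent_def lessThan_Suc_atMost
    unfolding sum_distrib_left by (intro sum.cong refl) (simp only: power_add power_mult)
  moreover have "(1 - z\<^sup>2) * (\<Sum>i<Suc (min k l). (z\<^sup>2) ^ i) = 1 - (z\<^sup>2) ^ Suc (min k l)"
    by (rule one_diff_power_eq[symmetric])
  ultimately have "(1 - z\<^sup>2) * R k l = z ^ (max k l - min k l + 1) * (1 - (z\<^sup>2) ^ Suc (min k l))"
    by (metis mult.left_commute)
  also have "\<dots> = z ^ (max k l - min k l + 1) - z ^ (max k l - min k l + 1 + 2 * Suc (min k l))"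
    unfolding right_diff_distrib mult_1_right power_mult[symmetric] power_add[symmetric] ..
  also have "max k l - min k l + 1 + 2 * Suc (min k l) = k + l + 3" by auto
  finally show ?thesis .
qed

lemma lead_resolvent_equation:
  "lead_ham (\<lambda>k. R k l) k + \<kappa>\<^sup>2 * R k l = (if l = k then 1 else 0)"
proof -
  define A where "A k = z ^ (max k l - min k l + 1) - z ^ (k + l + 3)" for k
  have A: "(1 - z\<^sup>2) * R k l = A k" for k by (simp add: geometric A_def)
  have zz: "(z\<^sup>2 + 1) * x = z * ((2 + \<kappa>\<^sup>2) * x)" for x using z_equation by (simp add: mult_ac)
  have pw: "(z\<^sup>2 + 1) * z ^ Suc n = z * z ^ Suc (Suc n) + z * z ^ n" for n
    by (simp add: algebra_simps power2_eq_square)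
  \<comment> \<open>Multiplying by \<open>z (1 - z^2)\<close> leaves an identity of polynomials in
    \<open>z\<close>: \<open>geometric\<close> removes the denominator, and
    \<open>z (2 + \<kappa>^2)\<close> becomes \<open>z^2 + 1\<close>.\<close>
  have "z * ((1 - z\<^sup>2) * (lead_ham (\<lambda>k. R k l) k + \<kappa>\<^sup>2 * R k l)) = z * ((1 - z\<^sup>2) * (if l = k then 1 else 0))"
  proof (cases k)
    case 0
    have "z * ((1 - z\<^sup>2) * (lead_ham (\<lambda>k. R k l) k + \<kappa>\<^sup>2 * R k l)) =
        z * ((2 + \<kappa>\<^sup>2) * ((1 - z\<^sup>2) * R 0 l)) - z * ((1 - z\<^sup>2) * R 1 l)"
      by (simp add: 0 lead_ham_def algebra_simps)
    also have "\<dots> = (z\<^sup>2 + 1) * A 0 - z * A 1" unfolding A zz ..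
    also have "\<dots> = z * ((1 - z\<^sup>2) * (if l = k then 1 else 0))"
      by (cases l) (simp_all add: A_def 0 algebra_simps power2_eq_square numeral_eq_Suc)
    finally show ?thesis .
  next
    case (Suc m)
    have "z * ((1 - z\<^sup>2) * (lead_ham (\<lambda>k. R k l) k + \<kappa>\<^sup>2 * R k l)) =
        z * ((2 + \<kappa>\<^sup>2) * ((1 - z\<^sup>2) * R k l)) - z * ((1 - z\<^sup>2) * R (Suc k) l) - z * ((1 - z\<^sup>2) * R m l)"
      by (simp add: Suc lead_ham_def algebra_simps)
    also have "\<dots> = (z\<^sup>2 + 1) * A k - z * A (Suc k) - z * A m" unfolding A zz ..
    also have "\<dots> = z * ((1 - z\<^sup>2) * (if l = k then 1 else 0))"
    proof -
      consider "l = k" | d where "k = l + Suc d" | d where "l = k + Suc d"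
        by (metis less_iff_Suc_add linorder_neqE_nat add_Suc_right)
      then show ?thesis
      proof cases
        case 1 then show ?thesis
          by (simp add: A_def Suc algebra_simps power2_eq_square numeral_eq_Suc Suc_diff_le)
      next
        case 2
        then have m: "m = l + d" using Suc by simp
        show ?thesis unfolding 2 A_def m
          by (simp add: algebra_simps power2_eq_square numeral_eq_Suc Suc_diff_le power_add)
      next
        case 3
        show ?thesis unfolding 3 A_def Suc
          by (simp add: algebra_simps power2_eq_square numeral_eq_Suc Suc_diff_le power_add)
      qed
    qed
    finally show ?thesis .
  qed
  then show ?thesis using z_neq_0 z_squared_neq_1 by simp
qed

text \<open>There are \<open>min k l + 1\<close> summands of modulus at most 1. Independence of
  \<open>k\<close> is what makes the kernel sum a bounded function.\<close>

lemma lead_resolvent_bound: "cmod (R k l) \<le> pos l"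
proof -
  have "cmod (R k l) \<le> (\<Sum>i\<le>min k l. 1)"
    unfolding lead_resolvent_def using norm_z_less_1
    by (intro sum_norm_le norm_z_power)
  then show ?thesis by (simp add: pos_def)
qed

text \<open>Each power is expanded separately. The exponents are at most
  \<open>2 * pos (max k l)\<close> and there are \<open>pos (min k l)\<close> of them, which gives
  product growth; 80 is \<open>5 * 2 ^ 4\<close>.\<close>

lemma lead_resolvent_expansion:
  assumes J: "J = 3 \<or> J = 4"
  shows "cmod (R k l - (\<Sum>j<J. \<kappa> ^ j * of_real (lead_kernel j (pos k) (pos l))))
    \<le> 80 * cmod \<kappa> ^ J * (pos k * pos l) ^ J"
proof -
  let ?n = "\<lambda>i. max k l - min k l + 1 + 2 * i"
  have K: "of_real (lead_kernel j (pos k) (pos l)) = (\<Sum>i\<le>min k l. complex_of_real (decay_coeff j (real (?n i))))"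
    if "j < J" for j
    using that J by (subst sum_decay_coeff[symmetric]) auto
  have "(\<Sum>j<J. \<kappa> ^ j * of_real (lead_kernel j (pos k) (pos l)))
      = (\<Sum>j<J. \<Sum>i\<le>min k l. \<kappa> ^ j * of_real (decay_coeff j (real (?n i))))"
    by (intro sum.cong refl) (simp only: K lessThan_iff sum_distrib_left)
  also have "\<dots> = (\<Sum>i\<le>min k l. \<Sum>j<J. \<kappa> ^ j * of_real (decay_coeff j (real (?n i))))"
    by (rule sum.swap)
  finally have eq: "R k l - (\<Sum>j<J. \<kappa> ^ j * of_real (lead_kernel j (pos k) (pos l)))
      = (\<Sum>i\<le>min k l. z ^ ?n i - (\<Sum>j<J. \<kappa> ^ j * of_real (decay_coeff j (real (?n i)))))"
    by (simp only: lead_resolvent_def sum_subtractf)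
  have "cmod (\<Sum>i\<le>min k l. z ^ ?n i - (\<Sum>j<J. \<kappa> ^ j * of_real (decay_coeff j (real (?n i)))))
      \<le> (\<Sum>i\<le>min k l. 5 * (cmod \<kappa> * (2 * pos (max k l))) ^ J)"
  proof (rule sum_norm_le)
    fix i assume "i \<in> {..min k l}"
    then have "?n i \<le> 2 * Suc (max k l)" by auto
    then have "real (?n i) \<le> 2 * pos (max k l)" unfolding pos_def by linarith
    then have "(cmod \<kappa> * real (?n i)) ^ J \<le> (cmod \<kappa> * (2 * pos (max k l))) ^ J"
      by (intro power_mono mult_left_mono) auto
    then show "cmod (z ^ ?n i - (\<Sum>j<J. \<kappa> ^ j * of_real (decay_coeff j (real (?n i)))))
        \<le> 5 * (cmod \<kappa> * (2 * pos (max k l))) ^ J"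
      using z_power_expansion[of "?n i" J] J by linarith
  qed
  also have "\<dots> = 5 * 2 ^ J * cmod \<kappa> ^ J * (pos (min k l) * pos (max k l) ^ J)"
    by (simp only: sum_constant card_atMost pos_def power_mult_distrib mult_ac)
  also have "\<dots> \<le> 80 * cmod \<kappa> ^ J * (pos (min k l) ^ J * pos (max k l) ^ J)"
  proof (intro mult_mono)
    show "5 * 2 ^ J \<le> (80 :: real)" using J by auto
    show "pos (min k l) \<le> pos (min k l) ^ J" using J by (intro self_le_power one_le_pos) auto
  qed (auto simp: less_imp_le)
  also have "pos (min k l) ^ J * pos (max k l) ^ J = (pos k * pos l) ^ J"
    by (simp add: power_mult_distrib min_def max_def)
  finally show ?thesis unfolding eq .
qed

text \<open>\<open>d (Suc k) - z * d k\<close> is multiplied by \<open>1 / z\<close> at each step,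
  so boundedness forces it to vanish. Then \<open>d k = z ^ k * d 0\<close>, and the equation at the
  first point gives \<open>d 0 = 0\<close>.\<close>

lemma homogeneous_bounded_solution:
  assumes eq: "\<And>k. lead_ham d k + \<kappa>\<^sup>2 * d k = 0" and bd: "\<And>k. cmod (d k) \<le> B"
  shows "d k = 0"
proof -
  have rec: "d (Suc (Suc k)) = (2 + \<kappa>\<^sup>2) * d (Suc k) - d k" "d 1 = (2 + \<kappa>\<^sup>2) * d 0" for k
    using eq[of "Suc k"] eq[of 0] by (simp_all add: lead_ham_def algebra_simps)
  have e: "z * (d (Suc (Suc k)) - z * d (Suc k)) = d (Suc k) - z * d k" for k
  proof -
    have "z * ((2 + \<kappa>\<^sup>2) * d (Suc k)) = (z\<^sup>2 + 1) * d (Suc k)" using z_equation by (simp add: mult_ac)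
    then show ?thesis unfolding rec by (simp add: algebra_simps power2_eq_square)
  qed
  have "z ^ k * (d (Suc k) - z * d k) = d 1 - z * d 0" for k
  proof (induction k)
    case (Suc k)
    have "z ^ Suc k * (d (Suc (Suc k)) - z * d (Suc k)) = z ^ k * (z * (d (Suc (Suc k)) - z * d (Suc k)))"
      by (simp only: power_Suc2 mult.assoc)
    then show ?case by (simp only: e Suc)
  qed simp
  moreover have e0: "d 1 - z * d 0 = 0"
  proof (rule ccontr)
    assume ne: "d 1 - z * d 0 \<noteq> 0"
    have le: "cmod (d 1 - z * d 0) \<le> cmod z ^ k * (2 * B)" for k
    proof -
      have "cmod (z * d k) \<le> 1 * B" unfolding norm_mult using norm_z_less_1 bd by (intro mult_mono) auto
      then have "cmod (d (Suc k) - z * d k) \<le> 2 * B"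
        using norm_triangle_ineq4[of "d (Suc k)" "z * d k"] bd[of "Suc k"] by linarith
      then have "cmod (z ^ k * (d (Suc k) - z * d k)) \<le> cmod z ^ k * (2 * B)"
        unfolding norm_mult norm_power by (intro mult_left_mono) auto
      then show ?thesis using calculation by simp
    qed
    have "(\<lambda>k. cmod z ^ k * (2 * B)) \<longlonglongrightarrow> 0 * (2 * B)"
      by (intro tendsto_intros LIMSEQ_realpow_zero) (use norm_z_less_1 in auto)
    then have "cmod (d 1 - z * d 0) \<le> 0 * (2 * B)"
      by (rule LIMSEQ_le_const) (use le in auto)
    then show False using ne by simp
  qed
  ultimately have step: "d (Suc k) = z * d k" for k using z_neq_0 by simp
  have "z * (z * d 0) = (z\<^sup>2 + 1) * d 0"
    using rec(2) e0 z_equation by (metis mult.assoc mult.commute right_minus_eq)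
  then have "d 0 = 0" by (simp add: algebra_simps power2_eq_square)
  then show ?thesis by (induction k) (simp_all add: step)
qed

text \<open>The sum against the resolvent kernel is a bounded solution of the same equation, and
  bounded solutions are unique. In this way \<open>w\<close>, known only to be bounded and to solve
  the equation, acquires a kernel formula.\<close>

lemma lead_solution:
  assumes f: "(\<lambda>l. pos l * cmod (f l)) summable_on UNIV"
    and eq: "\<And>k. lead_ham w k + \<kappa>\<^sup>2 * w k = f k" and bd: "\<And>k. cmod (w k) \<le> B"
  shows "((\<lambda>l. R k l * f l) has_sum w k) UNIV"
proof -
  have le: "cmod (R k l * f l) \<le> pos l * cmod (f l)" for k l
    unfolding norm_mult by (intro mult_right_mono lead_resolvent_bound) auto
  define S where "S k = (\<Sum>\<^sub>\<infinity>l. R k l * f l)" for k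
  have "(\<lambda>l. R k l * f l) summable_on UNIV" for k
    by (rule abs_summable_summable, rule Infinite_Sum.abs_summable_on_comparison_test'[OF f le])
  then have S: "((\<lambda>l. R k l * f l) has_sum S k) UNIV" for k unfolding S_def by simp
  have Sb: "cmod (S k) \<le> (\<Sum>\<^sub>\<infinity>l. pos l * cmod (f l))" for k
    by (rule norm_infsum_le[OF S has_sum_infsum[OF f] le])
  have Seq: "lead_ham S k + \<kappa>\<^sup>2 * S k = f k" for k
  proof -
    have "((\<lambda>l. lead_ham (\<lambda>k. R k l) k * f l + \<kappa>\<^sup>2 * (R k l * f l)) has_sum (lead_ham S k + \<kappa>\<^sup>2 * S k)) UNIV"
      by (intro has_sum_add has_sum_cmult_right has_sum_lead_ham S)
    then have "((\<lambda>l. (if l = k then 1 else 0) * f l) has_sum (lead_ham S k + \<kappa>\<^sup>2 * S k)) UNIV"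
      by (simp only: mult.assoc[symmetric] distrib_right[symmetric] lead_resolvent_equation)
    then show ?thesis by (rule has_sum_unique[OF _ has_sum_delta])
  qed
  have "w k - S k = 0"
  proof (rule homogeneous_bounded_solution[where d = "\<lambda>k. w k - S k"])
    fix k
    have "lead_ham (\<lambda>k. w k - S k) k = lead_ham w k - lead_ham S k"
      by (cases k) (simp_all add: lead_ham_def algebra_simps)
    then show "lead_ham (\<lambda>k. w k - S k) k + \<kappa>\<^sup>2 * (w k - S k) = 0"
      by (simp only: right_diff_distrib add_diff_add[symmetric] eq Seq diff_self)
    show "cmod (w k - S k) \<le> B + (\<Sum>\<^sub>\<infinity>l. pos l * cmod (f l))"
      using norm_triangle_ineq4[of "w k" "S k"] bd[of k] Sb[of k] by linarith
  qed
  then show ?thesis using S[of k] by simp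
qed

theorem lead_expansion:
  assumes J: "J = 3 \<or> J = 4" and f: "(\<lambda>l. pos l ^ J * cmod (f l)) summable_on UNIV"
    and eq: "\<And>k. lead_ham w k + \<kappa>\<^sup>2 * w k = f k" and bd: "\<And>k. cmod (w k) \<le> B"
  shows "cmod (w k - (\<Sum>j<J. \<kappa> ^ j * (\<Sum>\<^sub>\<infinity>l. of_real (lead_kernel j (pos k) (pos l)) * f l)))
    \<le> 80 * cmod \<kappa> ^ J * pos k ^ J * (\<Sum>\<^sub>\<infinity>l. pos l ^ J * cmod (f l))"
proof -
  let ?g = "\<lambda>j l. complex_of_real (lead_kernel j (pos k) (pos l))"
  have f1: "(\<lambda>l. pos l * cmod (f l)) summable_on UNIV"
    by (rule summable_on_comparison_test[OF f])
      (use J in \<open>auto intro!: mult_right_mono self_le_power one_le_pos simp: less_imp_le\<close>)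
  have gs: "(\<lambda>l. ?g j l * f l) summable_on UNIV" if "j < J" for j
  proof (rule abs_summable_summable, rule Infinite_Sum.abs_summable_on_comparison_test'
      [OF summable_on_cmult_right[OF f, of "pos k ^ J"]])
    fix l
    have "cmod (?g j l * f l) \<le> (pos k * pos l) ^ J * cmod (f l)"
      unfolding norm_mult norm_of_real
      by (intro mult_right_mono lead_kernel_bound one_le_pos) (use that in auto)
    then show "cmod (?g j l * f l) \<le> pos k ^ J * (pos l ^ J * cmod (f l))"
      by (simp add: power_mult_distrib mult_ac)
  qed
  have "((\<lambda>l. R k l * f l - (\<Sum>j<J. \<kappa> ^ j * (?g j l * f l))) has_sum
      (w k - (\<Sum>j<J. \<kappa> ^ j * (\<Sum>\<^sub>\<infinity>l. ?g j l * f l)))) UNIV"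
    unfolding diff_conv_add_uminus
    by (intro has_sum_add has_sum_uminusI has_sum_sum has_sum_cmult_right lead_solution[OF f1 eq bd])
       (auto intro!: has_sum_infsum gs)
  moreover have "((\<lambda>l. 80 * cmod \<kappa> ^ J * pos k ^ J * (pos l ^ J * cmod (f l))) has_sum
      80 * cmod \<kappa> ^ J * pos k ^ J * (\<Sum>\<^sub>\<infinity>l. pos l ^ J * cmod (f l))) UNIV"
    by (intro has_sum_cmult_right has_sum_infsum f)
  ultimately show ?thesis
  proof (rule norm_infsum_le)
    fix l
    have "R k l * f l - (\<Sum>j<J. \<kappa> ^ j * (?g j l * f l)) = (R k l - (\<Sum>j<J. \<kappa> ^ j * ?g j l)) * f l"
      by (simp add: left_diff_distrib sum_distrib_right mult.assoc)
    also have "cmod \<dots> \<le> (80 * cmod \<kappa> ^ J * (pos k * pos l) ^ J) * cmod (f l)"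
      unfolding norm_mult by (intro mult_right_mono lead_resolvent_expansion J) auto
    finally show "cmod (R k l * f l - (\<Sum>j<J. \<kappa> ^ j * (?g j l * f l)))
        \<le> 80 * cmod \<kappa> ^ J * pos k ^ J * (pos l ^ J * cmod (f l))"
      by (simp add: power_mult_distrib mult_ac)
  qed
qed

end

section \<open>The core\<close>

definition core_inner :: "('v::finite \<Rightarrow> complex) \<Rightarrow> ('v \<Rightarrow> complex) \<Rightarrow> complex" where
  "core_inner u w = (\<Sum>x\<in>UNIV. cnj (u x) * w x)"

definition core_norm :: "('v::finite \<Rightarrow> complex) \<Rightarrow> real" where
  "core_norm u = (\<Sum>x\<in>UNIV. cmod (u x))"

definition unit_fun :: "'v \<Rightarrow> 'v \<Rightarrow> complex" where
  "unit_fun y = (\<lambda>x. if x = y then 1 else 0)"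

lemma fun_expansion: "u = (\<Sum>y\<in>UNIV. u y *\<^sub>C unit_fun (y::'v::finite))"
  by (rule ext) (simp add: sum_fun_apply unit_fun_def if_distrib cong: if_cong)

lemma clinear_sum:
  assumes "clinear_on UNIV A"
  shows "A (\<Sum>i\<in>I. f i) = (\<Sum>i\<in>I. A (f i))"
  by (induction I rule: infinite_finite_induct) (simp_all add: clinear_onD(1,3)[OF assms])

lemma clinear_fun_expansion:
  assumes "clinear_on UNIV (A :: ('v::finite \<Rightarrow> complex) \<Rightarrow> 'v \<Rightarrow> complex)"
  shows "A u x = (\<Sum>y\<in>UNIV. A (unit_fun y) x * u y)"
proof -
  have "A u = (\<Sum>y\<in>UNIV. A (u y *\<^sub>C unit_fun y))"
    by (subst fun_expansion[of u]) (rule clinear_sum[OF assms])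
  then show ?thesis by (simp add: clinear_onD(2)[OF assms] sum_fun_apply mult.commute)
qed

lemma core_inner_unit_left: "core_inner (unit_fun y) u = u y"
  by (simp add: core_inner_def unit_fun_def if_distrib if_distribR cong: if_cong)

lemma core_inner_commute: "core_inner u w = cnj (core_inner w u)"
  by (simp add: core_inner_def mult.commute)

lemma core_norm_nonneg: "0 \<le> core_norm u"
  by (simp add: core_norm_def sum_nonneg)

lemma core_norm_bound: "cmod (u x) \<le> core_norm u"
  unfolding core_norm_def by (rule member_le_sum) auto

lemma core_norm_clinear:
  assumes "clinear_on UNIV (A :: ('v::finite \<Rightarrow> complex) \<Rightarrow> 'v \<Rightarrow> complex)"
  shows "core_norm (A u) \<le> (\<Sum>y\<in>UNIV. core_norm (A (unit_fun y))) * core_norm u"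
proof -
  have "core_norm (A u) \<le> (\<Sum>x\<in>UNIV. \<Sum>y\<in>UNIV. cmod (A (unit_fun y) x) * cmod (u y))"
    unfolding core_norm_def clinear_fun_expansion[OF assms, of u]
    by (intro sum_mono sum_norm_le) (simp add: norm_mult)
  also have "\<dots> = (\<Sum>y\<in>UNIV. core_norm (A (unit_fun y)) * cmod (u y))"
    unfolding core_norm_def sum_distrib_right by (rule sum.swap)
  also have "\<dots> \<le> (\<Sum>y\<in>UNIV. core_norm (A (unit_fun y)) * core_norm u)"
    by (intro sum_mono mult_left_mono core_norm_bound core_norm_nonneg)
  finally show ?thesis by (simp add: sum_distrib_right)
qed

lemma core_norm_add: "core_norm (u + w) \<le> core_norm u + core_norm w"
  unfolding core_norm_def sum.distrib[symmetric] by (intro sum_mono) (simp add: norm_triangle_ineq)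

lemma core_norm_scaleC: "core_norm (c *\<^sub>C u) = cmod c * core_norm u"
  by (simp add: core_norm_def norm_mult sum_distrib_left)

locale core_graph =
  fixes E0 :: "'v::finite set set" and xs :: "'n::finite \<Rightarrow> 'v"
  assumes graph: "connected_simple_graph E0"
begin

abbreviation "h \<equiv> core_ham E0 xs"

definition adj :: "'v \<Rightarrow> 'v \<Rightarrow> complex" where
  "adj x y = (if {x, y} \<in> E0 then 1 else 0)"

definition degree :: "'v \<Rightarrow> complex" where
  "degree x = of_nat (card {\<alpha>. xs \<alpha> = x})"

lemma cnj_adj [simp]: "cnj (adj x y) = adj x y"
  by (simp add: adj_def)

lemma cnj_degree [simp]: "cnj (degree x) = degree x"
  by (simp add: degree_def)

lemma h_eq: "h u x = (\<Sum>y\<in>UNIV. adj x y * (u x - u y)) + degree x * u x"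
proof -
  have "(\<Sum>y | {x, y} \<in> E0. u x - u y) = (\<Sum>y\<in>UNIV. adj x y * (u x - u y))"
    unfolding adj_def by (rule sum.mono_neutral_cong_left) auto
  moreover have "(\<Sum>\<alpha>\<in>UNIV. (if x = xs \<alpha> then 1 else 0) * u x) = degree x * u x"
  proof -
    have "(\<Sum>\<alpha>\<in>UNIV. (if x = xs \<alpha> then 1 else 0)) = (\<Sum>\<alpha>\<in>{\<alpha>. xs \<alpha> = x}. (1::complex))"
      by (rule sum.mono_neutral_cong_right) auto
    then show ?thesis unfolding degree_def sum_distrib_right[symmetric] by simp
  qed
  ultimately show ?thesis by (simp add: core_ham_def)
qed

lemma clinear_h: "clinear_on UNIV h"
  unfolding clinear_on_def
  by (auto simp: fun_eq_iff h_eq sum_distrib_left ring_distribs sum.distrib sum_subtractf mult_ac)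

text \<open>Exchanging \<open>x\<close> and \<open>y\<close> in the edge sum and averaging gives a
  symmetric form; each edge is counted in both directions, hence the division by 2. Symmetry and
  positivity of \<open>h\<close> are both read off from it.\<close>

lemma core_form:
  "core_inner u (h w) = (\<Sum>x\<in>UNIV. \<Sum>y\<in>UNIV. adj x y * (cnj (u x - u y) * (w x - w y))) / 2
     + (\<Sum>x\<in>UNIV. degree x * (cnj (u x) * w x))"
proof -
  define S where "S = (\<Sum>x\<in>UNIV. \<Sum>y\<in>UNIV. adj x y * (cnj (u x) * (w x - w y)))"
  have "S = (\<Sum>x\<in>UNIV. \<Sum>y\<in>UNIV. adj y x * (cnj (u y) * (w y - w x)))"
    unfolding S_def by (rule sum.swap)
  also have "\<dots> = (\<Sum>x\<in>UNIV. \<Sum>y\<in>UNIV. adj x y * (- cnj (u y) * (w x - w y)))"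
    by (intro sum.cong refl) (simp add: adj_def insert_commute algebra_simps)
  finally have "S + S = (\<Sum>x\<in>UNIV. \<Sum>y\<in>UNIV. adj x y * (cnj (u x) * (w x - w y)))
      + (\<Sum>x\<in>UNIV. \<Sum>y\<in>UNIV. adj x y * (- cnj (u y) * (w x - w y)))"
    by (simp only: S_def)
  also have "\<dots> = (\<Sum>x\<in>UNIV. \<Sum>y\<in>UNIV. adj x y * (cnj (u x - u y) * (w x - w y)))"
    unfolding sum.distrib[symmetric] by (intro sum.cong refl) (simp add: algebra_simps)
  moreover have half: "(S + S) / 2 = S" by simp
  ultimately have "(S + S) / 2 = (\<Sum>x\<in>UNIV. \<Sum>y\<in>UNIV. adj x y * (cnj (u x - u y) * (w x - w y))) / 2"
    by (metis (no_types, lifting))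
  then have S: "S = (\<Sum>x\<in>UNIV. \<Sum>y\<in>UNIV. adj x y * (cnj (u x - u y) * (w x - w y))) / 2"
    unfolding half .
  have "core_inner u (h w) = S + (\<Sum>x\<in>UNIV. degree x * (cnj (u x) * w x))"
    unfolding core_inner_def S_def h_eq
    by (simp add: distrib_left sum.distrib sum_distrib_left mult.left_commute)
  then show ?thesis using S by simp
qed

lemma h_symmetric: "core_inner u (h w) = core_inner (h u) w"
proof -
  have "core_inner (h u) w = cnj (core_inner w (h u))" by (rule core_inner_commute)
  also have "\<dots> = core_inner u (h w)"
    unfolding core_form by (simp add: mult.commute)
  finally show ?thesis by simp
qed

text \<open>The form of \<open>u\<close> with itself is a sum of nonnegative terms, so
  \<open>u\<close> is constant along edges and zero at attachment points; connectedness spreads the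
  zero.\<close>

lemma h_kernel:
  assumes "h u = 0" shows "u = 0"
proof -
  let ?f = "\<lambda>x y. if {x, y} \<in> E0 then (cmod (u x - u y))\<^sup>2 else 0"
  let ?g = "\<lambda>x. real (card {\<alpha>. xs \<alpha> = x}) * (cmod (u x))\<^sup>2"
  have sq: "of_real ((cmod a)\<^sup>2) = cnj a * a" for a
    by (simp only: complex_norm_square mult.commute)
  have "of_real ((\<Sum>x\<in>UNIV. \<Sum>y\<in>UNIV. ?f x y) / 2 + (\<Sum>x\<in>UNIV. ?g x)) = core_inner u (h u)"
    unfolding core_form of_real_add of_real_divide of_real_sum
    by (intro arg_cong2[where f = "(+)"] arg_cong2[where f = "(/)"] sum.cong refl)
      (simp_all only: adj_def degree_def sq[symmetric], simp_all)
  also have "\<dots> = 0" using assms by (simp add: core_inner_def)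
  finally have 0: "(\<Sum>x\<in>UNIV. \<Sum>y\<in>UNIV. ?f x y) / 2 + (\<Sum>x\<in>UNIV. ?g x) = 0"
    by (simp only: of_real_eq_0_iff)
  have f0: "0 \<le> (\<Sum>x\<in>UNIV. \<Sum>y\<in>UNIV. ?f x y)" and g0: "0 \<le> (\<Sum>x\<in>UNIV. ?g x)"
    by (intro sum_nonneg; simp)+
  have "(\<Sum>x\<in>UNIV. \<Sum>y\<in>UNIV. ?f x y) = 0" and "(\<Sum>x\<in>UNIV. ?g x) = 0" using 0 f0 g0 by linarith+
  then have f: "\<And>x y. ?f x y = 0" and g: "\<And>x. ?g x = 0"
    by (simp_all add: sum_nonneg_eq_0_iff sum_nonneg)
  have edge: "u x = u y" if "{x, y} \<in> E0" for x y using f[of x y] that by simp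
  \<comment> \<open>Types are nonempty, so at least one half-line is attached; without an attachment
    point the constants would be in the kernel.\<close>
  obtain \<alpha> :: 'n where True by simp
  have "u (xs \<alpha>) = 0" using g[of "xs \<alpha>"] by (auto simp: card_eq_0_iff)
  moreover have "u y = u (xs \<alpha>)" for y
  proof -
    have "(\<lambda>a b. {a, b} \<in> E0)\<^sup>*\<^sup>* (xs \<alpha>) y" using graph by (simp add: connected_simple_graph_def)
    then show ?thesis by induction (simp_all add: edge)
  qed
  ultimately show ?thesis by (simp add: fun_eq_iff)
qed

lemma inj_h: "inj h"
proof (rule injI)
  fix a b assume "h a = h b"
  then have "h (a - b) = 0" using clinear_onD(5)[OF clinear_h, of a b] by simp
  then show "a = b" using h_kernel[of "a - b"] by simp
qed

text \<open>Functions on the finite type are copied into \<open>complex^'v\<close>, where injective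
  linear maps are surjective.\<close>

lemma bij_h: "bij h"
proof -
  define F :: "complex^'v \<Rightarrow> complex^'v" where "F a = (\<chi> x. h (\<lambda>y. a $ y) x)" for a
  have add: "(\<lambda>y. (a + b) $ y) = (\<lambda>y. a $ y) + (\<lambda>y. b $ y)" for a b :: "complex^'v"
    by (simp add: fun_eq_iff)
  have sc: "(\<lambda>y. (c *s a) $ y) = c *\<^sub>C (\<lambda>y. a $ y)" for c and a :: "complex^'v"
    by (simp add: fun_eq_iff)
  have "Vector_Spaces.linear (*s) (*s) F"
    unfolding Vector_Spaces.linear_iff
    by (intro conjI allI vec.vector_space_axioms)
      (simp_all only: F_def add sc clinear_onD(1,2)[OF clinear_h], simp_all add: vec_eq_iff)
  moreover have "inj F"
  proof (rule injI)
    fix a b assume "F a = F b"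
    then have "h (\<lambda>y. a $ y) = h (\<lambda>y. b $ y)" by (simp add: F_def vec_eq_iff fun_eq_iff)
    then have "(\<lambda>y. a $ y) = (\<lambda>y. b $ y)" by (rule injD[OF inj_h])
    then show "a = b" by (simp add: vec_eq_iff fun_eq_iff)
  qed
  ultimately have surj: "surj F" by (rule vec.linear_inj_imp_surj)
  have "\<exists>u. h u = f" for f
  proof -
    obtain a where "F a = (\<chi> x. f x)" using surj by (metis surjD)
    then have "h (\<lambda>y. a $ y) = f" by (simp add: F_def vec_eq_iff fun_eq_iff)
    then show ?thesis by blast
  qed
  then have "surj h" unfolding surj_def by metis
  then show ?thesis using inj_h by (simp add: bij_def)
qed

abbreviation "g \<equiv> inv h"

lemma h_g: "h (g f) = f" and g_h: "g (h f) = f"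
  using bij_h by (simp_all add: bij_def surj_f_inv_f)

lemma g_eqI: "h a = f \<Longrightarrow> g f = a"
  using g_h by auto

lemma clinear_g: "clinear_on UNIV g"
  unfolding clinear_on_def
  by (intro conjI ballI allI g_eqI) (simp_all only: clinear_onD(1,2)[OF clinear_h] h_g)

lemma g_symmetric: "core_inner u (g w) = core_inner (g u) w"
  using h_symmetric[of "g u" "g w"] by (simp only: h_g)

lemma clinear_core_coeff: "clinear_on UNIV (core_coeff E0 xs j)"
proof -
  have "clinear_on UNIV (g ^^ n)" for n
  proof (induction n)
    case (Suc n)
    show ?case unfolding clinear_on_def funpow.simps o_apply
      by (simp only: clinear_onD(1,2)[OF Suc] clinear_onD(1,2)[OF clinear_g]) blast
  qed (simp add: clinear_on_def)
  note gn = clinear_onD(1,2)[OF this]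
  show ?thesis
    unfolding clinear_on_def core_coeff_def
    by (cases "even j") (simp_all only: if_True if_False scaleC_fun_apply gn scaleC_add_right scaleC_scaleC
        mult.commute simp_thms, simp_all)
qed

lemma core_coeff_symmetric: "core_inner u (core_coeff E0 xs j w) = core_inner (core_coeff E0 xs j u) w"
proof -
  have "core_inner u ((g ^^ n) w) = core_inner ((g ^^ n) u) w" for n u w
  proof (induction n arbitrary: u)
    case (Suc n)
    have "core_inner u (g ((g ^^ n) w)) = core_inner (g u) ((g ^^ n) w)" by (rule g_symmetric)
    also have "\<dots> = core_inner ((g ^^ n) (g u)) w" by (rule Suc)
    finally show ?case by (simp add: funpow_swap1)
  qed simp
  then have n: "core_inner u ((g ^^ n) w) = core_inner ((g ^^ n) u) w" for n .
  have "core_inner u (c *\<^sub>C A w) = core_inner (c *\<^sub>C A u) w" if "core_inner u (A w) = core_inner (A u) w" "cnj c = c"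
    for c and A :: "('v \<Rightarrow> complex) \<Rightarrow> 'v \<Rightarrow> complex"
    using that by (simp add: core_inner_def mult.left_commute mult.assoc flip: sum_distrib_left)
  from this[where A = "g ^^ (j div 2 + 1)" and c = "(-1) ^ (j div 2)", OF n] show ?thesis
    by (simp add: core_coeff_def core_inner_def)
qed

lemma core_coeff_hermitian:
  "core_coeff E0 xs j (unit_fun a) b = cnj (core_coeff E0 xs j (unit_fun b) a)"
  using core_coeff_symmetric[of "unit_fun b" j "unit_fun a"]
    core_inner_commute[of "core_coeff E0 xs j (unit_fun b)" "unit_fun a"]
  by (simp add: core_inner_unit_left)

text \<open>Iterating \<open>w = g f - \<kappa>^2 g w\<close> gives
  \<open>w = g f - \<kappa>^2 g (g f) + \<kappa>^4 g (g w)\<close>. The odd coefficients vanish on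
  the core, so this remainder of order 4 serves both values of \<open>J\<close>.\<close>

lemma core_expansion:
  obtains B where "0 < B" "\<And>\<kappa> f w x J. \<lbrakk>cmod \<kappa> \<le> 1 / B; h w + \<kappa>\<^sup>2 *\<^sub>C w = f; J = 3 \<or> J = 4\<rbrakk> \<Longrightarrow>
    cmod (w x - (\<Sum>j<J. \<kappa> ^ j * core_coeff E0 xs j f x)) \<le> B * cmod \<kappa> ^ J * core_norm f"
proof -
  define b where "b = (\<Sum>y\<in>UNIV. core_norm (g (unit_fun y)))"
  have b0: "0 \<le> b" unfolding b_def by (intro sum_nonneg core_norm_nonneg)
  have gb: "core_norm (g u) \<le> b * core_norm u" for u
    unfolding b_def by (rule core_norm_clinear[OF clinear_g])
  \<comment> \<open>\<open>B\<close> is at least 1 to force \<open>cmod \<kappa> \<le> 1\<close>, at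
    least \<open>2 * b\<close> so that the term with \<open>w\<close> can be absorbed, and at least
    \<open>2 * b ^ 3\<close> for the final remainder.\<close>
  define B where "B = 1 + 2 * b + 2 * b ^ 3"
  have B1: "1 \<le> B" "2 * b \<le> B" "2 * b ^ 3 \<le> B" using b0 zero_le_power[OF b0, of 3] by (simp_all add: B_def)
  have main: "cmod (w x - (\<Sum>j<J. \<kappa> ^ j * core_coeff E0 xs j f x)) \<le> B * cmod \<kappa> ^ J * core_norm f"
    if k: "cmod \<kappa> \<le> 1 / B" and eq: "h w + \<kappa>\<^sup>2 *\<^sub>C w = f" and J: "J = 3 \<or> J = 4" for \<kappa> f w x J
  proof -
    have w1: "w = g f + (- \<kappa>\<^sup>2) *\<^sub>C g w"
    proof -
      have "h w = f - \<kappa>\<^sup>2 *\<^sub>C w" using eq by (simp add: algebra_simps)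
      then have "w = g (f - \<kappa>\<^sup>2 *\<^sub>C w)" using g_h[of w] by simp
      then show ?thesis by (simp add: clinear_onD[OF clinear_g] scaleC_minus_left)
    qed
    have k1: "cmod \<kappa> \<le> 1" using k B1(1) by (simp add: field_simps) (use order_trans in fastforce)
    have kb: "cmod \<kappa> ^ 2 * b \<le> 1 / 2"
    proof -
      have "cmod \<kappa> ^ 2 * b \<le> cmod \<kappa> * b" using k1 b0 by (intro mult_right_mono) (auto simp: power2_eq_square mult_left_le)
      also have "\<dots> \<le> 1 / B * b" by (intro mult_right_mono k b0)
      also have "\<dots> \<le> 1 / 2" using B1 by (simp add: field_simps)
      finally show ?thesis .
    qed
    have "core_norm w \<le> core_norm (g f) + core_norm ((- \<kappa>\<^sup>2) *\<^sub>C g w)"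
      by (subst w1) (rule core_norm_add)
    also have "\<dots> \<le> b * core_norm f + cmod \<kappa> ^ 2 * (b * core_norm w)"
      unfolding core_norm_scaleC norm_minus_cancel norm_power by (intro add_mono mult_left_mono gb) auto
    also have "\<dots> = b * core_norm f + (cmod \<kappa> ^ 2 * b) * core_norm w" by simp
    also have "\<dots> \<le> b * core_norm f + 1 / 2 * core_norm w"
      by (intro add_left_mono mult_right_mono kb core_norm_nonneg)
    finally have wn: "core_norm w \<le> 2 * b * core_norm f" by simp
    have w2: "w = g f - \<kappa>\<^sup>2 *\<^sub>C g (g f) + \<kappa>^4 *\<^sub>C g (g w)"
    proof -
      have "g w = g (g f) + (- \<kappa>\<^sup>2) *\<^sub>C g (g w)"
        using arg_cong[OF w1, of g] by (simp only: clinear_onD(1,2)[OF clinear_g])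
      then have "w = g f + (- \<kappa>\<^sup>2) *\<^sub>C (g (g f) + (- \<kappa>\<^sup>2) *\<^sub>C g (g w))" using w1 by simp
      also have "\<dots> = g f + (- \<kappa>\<^sup>2) *\<^sub>C g (g f) + \<kappa>^4 *\<^sub>C g (g w)"
        by (simp only: scaleC_add_right scaleC_scaleC add.assoc minus_mult_minus power_add[symmetric]) simp
      finally show ?thesis by (simp only: scaleC_minus_left) simp
    qed
    have e: "(\<Sum>j<J. \<kappa> ^ j * core_coeff E0 xs j f x) = g f x - \<kappa>\<^sup>2 * g (g f) x"
    proof -
      have "core_coeff E0 xs 0 f x = g f x" "core_coeff E0 xs 1 f x = 0" "core_coeff E0 xs 3 f x = 0"
        by (simp_all add: core_coeff_def scaleC_one)
      moreover have "core_coeff E0 xs 2 f x = - g (g f) x"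
        by (simp add: core_coeff_def eval_nat_numeral)
      moreover have "{..<3} = {0, 1, 2::nat}" "{..<4} = {0, 1, 2, 3::nat}" by auto
      ultimately show ?thesis using J by (elim disjE) (simp_all del: One_nat_def)
    qed
    have "w x = g f x - \<kappa>\<^sup>2 * g (g f) x + \<kappa>^4 * g (g w) x"
      using fun_cong[OF w2, of x] by simp
    then have "cmod (w x - (\<Sum>j<J. \<kappa> ^ j * core_coeff E0 xs j f x)) = cmod (\<kappa>^4 * g (g w) x)"
      unfolding e by simp
    also have "\<dots> = cmod \<kappa> ^ 4 * cmod (g (g w) x)" by (simp add: norm_mult norm_power)
    also have "\<dots> \<le> cmod \<kappa> ^ J * (b * (b * (2 * b * core_norm f)))"
    proof (intro mult_mono)
      show "cmod \<kappa> ^ 4 \<le> cmod \<kappa> ^ J" using J k1 by (intro power_decreasing) auto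
      have "cmod (g (g w) x) \<le> core_norm (g (g w))" by (rule core_norm_bound)
      also have "\<dots> \<le> b * core_norm (g w)" by (rule gb)
      also have "\<dots> \<le> b * (b * core_norm w)" by (intro mult_left_mono gb b0)
      also have "\<dots> \<le> b * (b * (2 * b * core_norm f))" by (intro mult_left_mono wn b0)
      finally show "cmod (g (g w) x) \<le> b * (b * (2 * b * core_norm f))" .
    qed auto
    also have "\<dots> = (2 * b ^ 3) * cmod \<kappa> ^ J * core_norm f" by (simp add: power3_eq_cube)
    also have "\<dots> \<le> B * cmod \<kappa> ^ J * core_norm f"
      by (intro mult_right_mono B1 core_norm_nonneg) auto
    finally show ?thesis .
  qed
  show thesis
  proof (rule that)
    show "0 < B" using B1 by linarith
  qed (rule main)
qed

end

section \<open>The free operator\<close>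

lemma inj_Lead: "inj (Lead \<alpha>)" by (simp add: inj_def)
lemma inj_Core: "inj Core" by (simp add: inj_def)

lemma infsum_Lead:
  fixes g :: "('v, 'n) vertex \<Rightarrow> 'b::{comm_monoid_add, t2_space}"
  assumes "\<And>y. y \<notin> range (Lead \<alpha>) \<Longrightarrow> g y = 0"
  shows "infsum g UNIV = (\<Sum>\<^sub>\<infinity>k. g (Lead \<alpha> k))"
proof -
  have "infsum g UNIV = infsum g (range (Lead \<alpha>))"
    using assms by (intro infsum_cong_neutral) auto
  also have "\<dots> = infsum (g \<circ> Lead \<alpha>) UNIV" by (rule infsum_reindex[OF inj_Lead])
  finally show ?thesis by (simp add: o_def)
qed

lemma infsum_Core:
  fixes g :: "('v::finite, 'n) vertex \<Rightarrow> 'b::{topological_comm_monoid_add, t2_space}"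
  assumes "\<And>y. y \<notin> range Core \<Longrightarrow> g y = 0"
  shows "infsum g UNIV = (\<Sum>a\<in>UNIV. g (Core a))"
proof -
  have "infsum g UNIV = infsum g (range Core)"
    using assms by (intro infsum_cong_neutral) auto
  also have "\<dots> = infsum (g \<circ> Core) UNIV" by (rule infsum_reindex[OF inj_Core])
  finally show ?thesis by (simp add: o_def)
qed

lemma summable_Lead:
  fixes g :: "('v, 'n) vertex \<Rightarrow> real"
  assumes "g summable_on UNIV"
  shows "(\<lambda>k. g (Lead \<alpha> k)) summable_on UNIV"
  using summable_on_reindex[OF inj_Lead[of \<alpha>], of g] summable_on_subset_banach[OF assms, of "range (Lead \<alpha>)"]
  by (simp add: o_def)

lemma ell1_summable_Lead:
  fixes u :: "('v, 'n) state"
  assumes "u \<in> ell1 s"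
  shows "(\<lambda>k. weight s (Lead \<alpha> k :: ('v, 'n) vertex) * cmod (u (Lead \<alpha> k))) summable_on UNIV"
  using summable_Lead[of "\<lambda>x. weight s x * cmod (u x)" \<alpha>] ell1_summable[OF assms] by simp

lemma infsum_Lead_le:
  fixes g :: "('v, 'n) vertex \<Rightarrow> real"
  assumes g: "g summable_on UNIV" "\<And>x. 0 \<le> g x"
  shows "(\<Sum>\<^sub>\<infinity>k. g (Lead \<alpha> k)) \<le> infsum g UNIV"
proof -
  have "(\<Sum>\<^sub>\<infinity>k. g (Lead \<alpha> k)) = infsum g (range (Lead \<alpha>))"
    using infsum_reindex[OF inj_Lead[of \<alpha>], of g] by (simp add: o_def)
  also have "\<dots> \<le> infsum g UNIV"
    by (intro infsum_mono_neutral g summable_on_subset_banach[OF g(1)]) (auto simp: g)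
  finally show ?thesis .
qed

text \<open>The core and the set of half-lines are finite, so only the tails along single half-lines
  matter.\<close>

lemma ell1_iff_leads:
  fixes u :: "('v::finite, 'n::finite) state"
  shows "u \<in> ell1 s \<longleftrightarrow> (\<forall>\<alpha>. (\<lambda>k. weight s (Lead \<alpha> k :: ('v, 'n) vertex) * cmod (u (Lead \<alpha> k))) summable_on UNIV)"
proof
  assume "u \<in> ell1 s"
  then show "\<forall>\<alpha>. (\<lambda>k. weight s (Lead \<alpha> k :: ('v, 'n) vertex) * cmod (u (Lead \<alpha> k))) summable_on UNIV"
    by (intro allI ell1_summable_Lead)
next
  let ?g = "\<lambda>x. weight s x * cmod (u x)"
  assume "\<forall>\<alpha>. (\<lambda>k. weight s (Lead \<alpha> k :: ('v, 'n) vertex) * cmod (u (Lead \<alpha> k))) summable_on UNIV"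
  then have L: "?g summable_on range (Lead \<alpha>)" for \<alpha>
    using summable_on_reindex[OF inj_Lead[of \<alpha>], of ?g] by (simp add: o_def)
  have "?g summable_on (\<Union>\<alpha>\<in>I. range (Lead \<alpha>))" if "finite I" for I
    using that by (induction I) (auto intro!: summable_on_union L)
  from this[of UNIV] have "?g summable_on (range Core \<union> (\<Union>\<alpha>\<in>UNIV. range (Lead \<alpha>)))"
    by (intro summable_on_union) auto
  also have "range Core \<union> (\<Union>\<alpha>\<in>UNIV. range (Lead \<alpha>)) = (UNIV :: ('v, 'n) vertex set)"
  proof (intro set_eqI)
    fix x :: "('v, 'n) vertex"
    show "x \<in> range Core \<union> (\<Union>\<alpha>\<in>UNIV. range (Lead \<alpha>)) \<longleftrightarrow> x \<in> UNIV" by (cases x) auto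
  qed
  finally show "u \<in> ell1 s" by (simp add: ell1_def)
qed

lemma sum_pos_power_le_ell1_norm:
  fixes f :: "('v, 'n) state"
  assumes "f \<in> ell1 (real J)"
  shows "(\<lambda>l. pos l ^ J * cmod (f (Lead \<alpha> l))) summable_on UNIV"
    "(\<Sum>\<^sub>\<infinity>l. pos l ^ J * cmod (f (Lead \<alpha> l))) \<le> ell1_norm (real J) f"
proof -
  let ?g = "\<lambda>l. weight (real J) (Lead \<alpha> l :: ('v, 'n) vertex) * cmod (f (Lead \<alpha> l))"
  have le: "pos l ^ J * cmod (f (Lead \<alpha> l)) \<le> ?g l" for l
    by (intro mult_right_mono pos_power_le_weight) simp
  have s: "?g summable_on UNIV" by (rule ell1_summable_Lead[OF assms])
  then show S: "(\<lambda>l. pos l ^ J * cmod (f (Lead \<alpha> l))) summable_on UNIV"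
    by (rule summable_on_comparison_test) (use le in \<open>auto simp: less_imp_le\<close>)
  have "(\<Sum>\<^sub>\<infinity>l. pos l ^ J * cmod (f (Lead \<alpha> l))) \<le> infsum ?g UNIV"
    by (intro infsum_mono S s le)
  also have "\<dots> \<le> ell1_norm (real J) f"
    unfolding ell1_norm_def by (rule infsum_Lead_le[OF ell1_summable[OF assms]]) simp
  finally show "(\<Sum>\<^sub>\<infinity>l. pos l ^ J * cmod (f (Lead \<alpha> l))) \<le> ell1_norm (real J) f" .
qed

lemma core_norm_le_ell1_norm:
  fixes f :: "('v::finite, 'n) state"
  assumes "f \<in> ell1 s" shows "core_norm (\<lambda>a. f (Core a)) \<le> ell1_norm s f"
proof -
  have "core_norm (\<lambda>a. f (Core a)) = (\<Sum>x\<in>range Core. weight s x * cmod (f x))"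
    unfolding core_norm_def by (subst sum.reindex[OF inj_Core]) simp
  also have "\<dots> \<le> ell1_norm s f"
    unfolding ell1_norm_def by (intro finite_sum_le_infsum ell1_summable assms) auto
  finally show ?thesis .
qed

context core_graph
begin

abbreviation "H0 \<equiv> free_ham E0 xs"
abbreviation "G0 \<equiv> free_coeff E0 xs"

lemma H0_Core: "H0 u (Core a) = h (\<lambda>b. u (Core b)) a"
  and H0_Lead: "H0 u (Lead \<alpha> k) = lead_ham (\<lambda>l. u (Lead \<alpha> l)) k"
  by (simp_all add: free_ham_def direct_sum_def)

lemma G0_Core: "G0 j u (Core a) = core_coeff E0 xs j (\<lambda>b. u (Core b)) a"
  and G0_Lead: "G0 j u (Lead \<alpha> k) = (\<Sum>\<^sub>\<infinity>l. of_real (lead_kernel j (pos k) (pos l)) * u (Lead \<alpha> l))"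
  by (simp_all add: free_coeff_def direct_sum_def)

lemma clinear_H0: "clinear_on UNIV H0"
proof -
  have 1: "(\<lambda>b. (u + w) (Core b)) = (\<lambda>b. u (Core b)) + (\<lambda>b. w (Core b))" for u w :: "('v, 'n) state"
    by (simp add: fun_eq_iff)
  have 2: "(\<lambda>b. (c *\<^sub>C u) (Core b)) = c *\<^sub>C (\<lambda>b. u (Core b))" for c and u :: "('v, 'n) state"
    by (simp add: fun_eq_iff)
  have "H0 (u + w) x = H0 u x + H0 w x" for u w x
    by (cases x) (simp_all only: H0_Core H0_Lead 1 clinear_onD[OF clinear_h],
        simp_all add: lead_ham_def algebra_simps split: nat.split)
  moreover have "H0 (c *\<^sub>C u) x = c * H0 u x" for c u x
    by (cases x) (simp_all only: H0_Core H0_Lead 2 clinear_onD[OF clinear_h],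
        simp_all add: lead_ham_def algebra_simps split: nat.split)
  ultimately show ?thesis by (simp add: clinear_on_def fun_eq_iff)
qed

definition free_kernel :: "nat \<Rightarrow> ('v, 'n) vertex \<Rightarrow> ('v, 'n) vertex \<Rightarrow> complex" where
  "free_kernel j x y = (case x of
     Core a \<Rightarrow> (case y of Core b \<Rightarrow> core_coeff E0 xs j (unit_fun b) a | Lead _ _ \<Rightarrow> 0)
   | Lead \<alpha> k \<Rightarrow> (case y of Core _ \<Rightarrow> 0
       | Lead \<alpha>' l \<Rightarrow> if \<alpha> = \<alpha>' then of_real (lead_kernel j (pos k) (pos l)) else 0))"

text \<open>The constant is found at the smallest admissible exponent and does not depend on
  \<open>s\<close>; the half-lines account for the 1, the finite matrix on the core for the
  sum.\<close>

lemma free_coeff_kernel: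
  obtains C where "\<And>s. real (max 1 j) \<le> s \<Longrightarrow> kernel_operator (G0 j) (free_kernel j) s C"
proof -
  let ?s = "real (max 1 j)"
  define C where "C = 1 + (\<Sum>b\<in>UNIV. core_norm (core_coeff E0 xs j (unit_fun b)))"
  have C1: "1 \<le> C" unfolding C_def by (simp add: sum_nonneg core_norm_nonneg)
  have "kernel_operator (G0 j) (free_kernel j) ?s C"
  proof
    fix x y :: "('v, 'n) vertex"
    have nn: "0 \<le> C * weight ?s x * weight ?s y" using C1 by simp
    show "cmod (free_kernel j x y) \<le> C * weight ?s x * weight ?s y"
    proof (cases x)
      case x: (Core a)
      show ?thesis
      proof (cases y)
        case (Core b)
        have "cmod (core_coeff E0 xs j (unit_fun b) a) \<le> core_norm (core_coeff E0 xs j (unit_fun b))"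
          by (rule core_norm_bound)
        also have "\<dots> \<le> (\<Sum>b\<in>UNIV. core_norm (core_coeff E0 xs j (unit_fun b)))"
          by (intro member_le_sum core_norm_nonneg) auto
        finally show ?thesis using x Core by (simp add: free_kernel_def C_def)
      qed (use nn x in \<open>simp add: free_kernel_def\<close>)
    next
      case x: (Lead \<alpha> k)
      show ?thesis
      proof (cases y)
        case (Lead \<alpha>' l)
        have "\<bar>lead_kernel j (pos k) (pos l)\<bar> \<le> (pos k * pos l) ^ max 1 j"
          by (intro lead_kernel_bound one_le_pos) simp
        also have "\<dots> \<le> weight ?s x * weight ?s y"
          unfolding power_mult_distrib x Lead by (intro mult_mono pos_power_le_weight) (auto simp: less_imp_le)
        also have "\<dots> \<le> C * (weight ?s x * weight ?s y)"
          using mult_right_mono[OF C1, of "weight ?s x * weight ?s y"] by simp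
        finally show ?thesis using x Lead nn
          by (cases "\<alpha> = \<alpha>'") (simp_all add: free_kernel_def mult.assoc)
      qed (use nn x in \<open>simp add: free_kernel_def\<close>)
    qed
    show "free_kernel j y x = cnj (free_kernel j x y)"
      by (cases x; cases y; simp add: free_kernel_def lead_kernel_commute; rule core_coeff_hermitian)
  next
    fix u :: "('v, 'n) state" and x
    show "G0 j u x = (\<Sum>\<^sub>\<infinity>y. free_kernel j x y * u y)"
    proof (cases x)
      case (Core a)
      have "(\<Sum>\<^sub>\<infinity>y. free_kernel j x y * u y) = (\<Sum>b\<in>UNIV. free_kernel j x (Core b) * u (Core b))"
        by (rule infsum_Core) (auto simp: free_kernel_def Core split: vertex.split)
      then show ?thesis
        using clinear_fun_expansion[OF clinear_core_coeff, of j "\<lambda>b. u (Core b)" a]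
        by (simp add: Core G0_Core free_kernel_def)
    next
      case (Lead \<alpha> k)
      have "(\<Sum>\<^sub>\<infinity>y. free_kernel j x y * u y) = (\<Sum>\<^sub>\<infinity>l. free_kernel j x (Lead \<alpha> l) * u (Lead \<alpha> l))"
        by (rule infsum_Lead) (auto simp: free_kernel_def Lead split: vertex.split)
      then show ?thesis by (simp add: Lead G0_Lead free_kernel_def)
    qed
  qed
  then show thesis using kernel_operator.weaken that by blast
qed

text \<open>The blocks are decoupled and treated one by one. Uniformity of the constants in
  \<open>f\<close> matters because the source to which this is applied varies with \<kappa>.\<close>

theorem free_expansion:
  obtains \<delta> C where "0 < \<delta>" "0 \<le> C"
    "\<And>\<kappa> w f J x. \<lbrakk>0 < Re \<kappa>; cmod \<kappa> < \<delta>; w \<in> ell1_dual 0; f \<in> ell1 (real J); J = 3 \<or> J = 4;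
        H0 w + \<kappa>\<^sup>2 *\<^sub>C w = f\<rbrakk> \<Longrightarrow>
      cmod (w x - (\<Sum>j<J. \<kappa> ^ j * G0 j f x)) \<le> C * cmod \<kappa> ^ J * weight (real J) x * ell1_norm (real J) f"
proof -
  obtain B where B: "0 < B" "\<And>\<kappa> f w x J. \<lbrakk>cmod \<kappa> \<le> 1 / B; h w + \<kappa>\<^sup>2 *\<^sub>C w = f; J = 3 \<or> J = 4\<rbrakk> \<Longrightarrow>
    cmod (w x - (\<Sum>j<J. \<kappa> ^ j * core_coeff E0 xs j f x)) \<le> B * cmod \<kappa> ^ J * core_norm f"
    by (rule core_expansion) blast
  define C where "C = B + 80"
  have "cmod (w x - (\<Sum>j<J. \<kappa> ^ j * G0 j f x)) \<le> C * cmod \<kappa> ^ J * weight (real J) x * ell1_norm (real J) f"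
    if \<kappa>: "0 < Re \<kappa>" "cmod \<kappa> < min 1 (1 / B)" and w: "w \<in> ell1_dual 0" and f: "f \<in> ell1 (real J)"
      and J: "J = 3 \<or> J = 4" and eq: "H0 w + \<kappa>\<^sup>2 *\<^sub>C w = f" for \<kappa> w f J x
  proof (cases x)
    case (Core a)
    have "h (\<lambda>b. w (Core b)) + \<kappa>\<^sup>2 *\<^sub>C (\<lambda>b. w (Core b)) = (\<lambda>b. f (Core b))"
      by (rule ext) (use fun_cong[OF eq, of "Core _"] in \<open>simp add: H0_Core\<close>)
    from B(2)[OF _ this J] \<kappa>
    have "cmod (w x - (\<Sum>j<J. \<kappa> ^ j * G0 j f x)) \<le> B * cmod \<kappa> ^ J * core_norm (\<lambda>b. f (Core b))"
      by (simp add: Core G0_Core)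
    also have "\<dots> \<le> C * cmod \<kappa> ^ J * ell1_norm (real J) f"
      using B(1) by (intro mult_mono core_norm_le_ell1_norm f core_norm_nonneg) (auto simp: C_def)
    finally show ?thesis by (simp add: Core)
  next
    case (Lead \<alpha> k)
    interpret small_kappa \<kappa> by standard (use \<kappa> in auto)
    have "cmod (w (Lead \<alpha> k) - (\<Sum>j<J. \<kappa> ^ j * (\<Sum>\<^sub>\<infinity>l. of_real (lead_kernel j (pos k) (pos l)) * f (Lead \<alpha> l))))
      \<le> 80 * cmod \<kappa> ^ J * pos k ^ J * (\<Sum>\<^sub>\<infinity>l. pos l ^ J * cmod (f (Lead \<alpha> l)))"
    proof (rule lead_expansion[OF J sum_pos_power_le_ell1_norm(1)[OF f]])
      show "lead_ham (\<lambda>k. w (Lead \<alpha> k)) k + \<kappa>\<^sup>2 * w (Lead \<alpha> k) = f (Lead \<alpha> k)" for k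
        using fun_cong[OF eq, of "Lead \<alpha> k"] by (simp add: H0_Lead)
      show "cmod (w (Lead \<alpha> k)) \<le> ell1_dual_norm 0 w" for k
        using ell1_dual_bound[OF w, of "Lead \<alpha> k"] by simp
    qed
    also have "\<dots> \<le> C * cmod \<kappa> ^ J * weight (real J) x * ell1_norm (real J) f"
      unfolding Lead using B(1)
      by (intro mult_mono sum_pos_power_le_ell1_norm(2)[OF f] pos_power_le_weight)
        (auto simp: C_def less_imp_le intro!: infsum_nonneg)
    finally show ?thesis by (simp add: Lead G0_Lead)
  qed
  then show thesis
    using that[of "min 1 (1 / B)" C] B(1) by (auto simp: C_def)
qed

text \<open>On a half-line the kernel \<open>min\<close> is the Green function of
  \<open>lead_ham\<close>; on the core \<open>G0 0\<close> is the inverse of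
  \<open>h\<close>.\<close>

lemma H0_G0:
  assumes "f \<in> ell1 1" shows "H0 (G0 0 f) = f"
proof (rule ext)
  fix x
  show "H0 (G0 0 f) x = f x"
  proof (cases x)
    case (Core a)
    have "(\<lambda>b. G0 0 f (Core b)) = g (\<lambda>b. f (Core b))"
      by (rule ext) (simp add: G0_Core core_coeff_def scaleC_one)
    then show ?thesis by (simp add: Core H0_Core h_g)
  next
    case (Lead \<alpha> k)
    let ?R = "\<lambda>k l. complex_of_real (lead_kernel 0 (pos k) (pos l))"
    have f1: "f \<in> ell1 (real 1)" using assms by simp
    have S: "((\<lambda>l. ?R k l * f (Lead \<alpha> l)) has_sum G0 0 f (Lead \<alpha> k)) UNIV" for k
    proof -
      have "(\<lambda>l. ?R k l * f (Lead \<alpha> l)) summable_on UNIV"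
      proof (rule abs_summable_summable, rule Infinite_Sum.abs_summable_on_comparison_test'
          [OF summable_on_cmult_right[OF sum_pos_power_le_ell1_norm(1)[OF f1], of "pos k" \<alpha>]])
        fix l
        have "cmod (?R k l * f (Lead \<alpha> l)) \<le> (pos k * pos l) ^ 1 * cmod (f (Lead \<alpha> l))"
          unfolding norm_mult norm_of_real by (intro mult_right_mono lead_kernel_bound one_le_pos) auto
        then show "cmod (?R k l * f (Lead \<alpha> l)) \<le> pos k * (pos l ^ 1 * cmod (f (Lead \<alpha> l)))" by simp
      qed
      then show ?thesis by (simp add: G0_Lead)
    qed
    have "((\<lambda>l. (if l = k then 1 else 0) * f (Lead \<alpha> l)) has_sum lead_ham (\<lambda>k. G0 0 f (Lead \<alpha> k)) k) UNIV"
      using has_sum_lead_ham[of ?R "\<lambda>l. f (Lead \<alpha> l)" "\<lambda>k. G0 0 f (Lead \<alpha> k)" k, OF S]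
      by (simp only: lead_ham_min)
    from has_sum_unique[OF this has_sum_delta] show ?thesis by (simp add: Lead H0_Lead)
  qed
qed

end

subsection \<open>Behaviour at infinity\<close>

lemma n_comb_Core [simp]: "n_comb a (Core x) = 0"
  and n_comb_Lead [simp]: "n_comb a (Lead \<alpha> k) = a $ \<alpha> * of_real (pos k)"
  by (simp_all add: n_comb_def n_vec_def sum_fun_apply if_distrib cong: if_cong)

lemma one_comb_Core [simp]: "one_comb a (Core x) = 0"
  and one_comb_Lead [simp]: "one_comb a (Lead \<alpha> k) = a $ \<alpha>"
  by (simp_all add: one_comb_def one_vec_def sum_fun_apply if_distrib cong: if_cong)

lemma vertex_ext: "(\<And>a. u (Core a) = w (Core a)) \<Longrightarrow> (\<And>\<alpha> k. u (Lead \<alpha> k) = w (Lead \<alpha> k)) \<Longrightarrow> u = w"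
  by (rule ext) (metis vertex.exhaust)

lemma n_comb_add: "n_comb (a + b) = n_comb a + n_comb b"
  and n_comb_scale: "n_comb (c *s a) = c *\<^sub>C n_comb a"
  and n_comb_diff: "n_comb (a - b) = n_comb a - n_comb b"
  and n_comb_zero: "n_comb 0 = 0"
  and n_comb_minus: "n_comb (- a) = - n_comb a"
  by (rule vertex_ext; simp add: algebra_simps)+

lemma n_comb_sum: "n_comb (\<Sum>i\<in>I. a i) = (\<Sum>i\<in>I. n_comb (a i))"
  by (induction I rule: infinite_finite_induct) (simp_all only: sum.infinite sum.empty sum.insert n_comb_zero n_comb_add not_False_eq_True)

lemma one_comb_add: "one_comb (a + b) = one_comb a + one_comb b"
  and one_comb_scale: "one_comb (c *s a) = c *\<^sub>C one_comb a"
  and one_comb_diff: "one_comb (a - b) = one_comb a - one_comb b"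
  and one_comb_zero: "one_comb 0 = 0"
  and one_comb_minus: "one_comb (- a) = - one_comb a"
  by (rule vertex_ext; simp add: algebra_simps)+

lemma n_comb_dual: "(n_comb a :: ('v, 'n::finite) state) \<in> ell1_dual 1"
proof (rule ell1_dual_I)
  fix x :: "('v, 'n) vertex"
  show "cmod (n_comb a x) \<le> (\<Sum>\<alpha>\<in>UNIV. cmod (a $ \<alpha>)) * weight 1 x"
    by (cases x) (auto simp: norm_mult sum_nonneg pos_le_weight less_imp_le intro!: mult_mono member_le_sum)
qed

lemma one_comb_dual: "(one_comb a :: ('v, 'n::finite) state) \<in> ell1_dual 0"
proof (rule ell1_dual_I)
  fix x :: "('v, 'n) vertex"
  show "cmod (one_comb a x) \<le> (\<Sum>\<alpha>\<in>UNIV. cmod (a $ \<alpha>)) * weight 0 x"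
    by (cases x) (auto simp: sum_nonneg intro!: member_le_sum)
qed

lemma n_vec_eq_n_comb: "n_vec \<alpha> = n_comb (axis \<alpha> 1)"
  by (rule vertex_ext) (auto simp: n_vec_def axis_def)

lemma n_vec_dual: "(n_vec \<alpha> :: ('v, 'n::finite) state) \<in> ell1_dual 1"
  unfolding n_vec_eq_n_comb by (rule n_comb_dual)

lemma pairing_n_comb_left:
  assumes "f \<in> ell1 1"
  shows "\<langle>n_comb a, f\<rangle> = (\<Sum>\<alpha>\<in>UNIV. cnj (a $ \<alpha>) * \<langle>n_vec \<alpha>, f\<rangle>)"
  unfolding n_comb_def
  using pairing_sum_left[of UNIV "\<lambda>\<alpha>. a $ \<alpha> *\<^sub>C n_vec \<alpha>" f]
    pairable_dual_ell1[OF csubspaceD(3)[OF csubspace_ell1_dual n_vec_dual] assms]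
  by (simp add: pairing_scaleC_left)

lemma pairing_n_vec:
  fixes f :: "('v, 'n::finite) state"
  shows "\<langle>n_vec \<alpha>, f\<rangle> = (\<Sum>\<^sub>\<infinity>l. of_real (pos l) * f (Lead \<alpha> l))"
proof -
  have "\<langle>n_vec \<alpha>, f\<rangle> = (\<Sum>\<^sub>\<infinity>l. cnj ((n_vec \<alpha> :: ('v, 'n) state) (Lead \<alpha> l)) * f (Lead \<alpha> l))"
    unfolding pairing_def by (rule infsum_Lead) (auto simp: n_vec_def split: vertex.split)
  then show ?thesis by (simp add: n_vec_def)
qed

text \<open>The kernel \<open>- n m\<close> has rank one on each half-line, so \<open>G0 1 f\<close>
  depends on \<open>f\<close> only through its first moments. This moves the algebra of
  \<open>P V G0 1\<close> to vectors of \<open>complex ^ 'n\<close>.\<close>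

lemma (in core_graph) G0_1_eq: "G0 1 f = - n_comb (\<chi> \<alpha>. \<langle>n_vec \<alpha>, f\<rangle>)"
proof (rule vertex_ext)
  fix \<alpha> k
  note pairing_n_vec[of \<alpha> f]
  moreover have "G0 1 f (Lead \<alpha> k) = - of_real (pos k) * (\<Sum>\<^sub>\<infinity>l. of_real (pos l) * f (Lead \<alpha> l))"
    unfolding G0_Lead infsum_cmult_right'[symmetric] by (simp add: lead_kernel_def mult.assoc)
  ultimately show "G0 1 f (Lead \<alpha> k) = (- n_comb (\<chi> \<alpha>. \<langle>n_vec \<alpha>, f\<rangle>)) (Lead \<alpha> k)" by simp
qed (simp add: G0_Core core_coeff_def)

lemma ell1_Lead_tendsto_0:
  fixes u :: "('v, 'n) state"
  assumes "u \<in> ell1 s" "0 \<le> s"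
  shows "(\<lambda>k. u (Lead \<alpha> k)) \<longlonglongrightarrow> 0"
proof -
  have "(\<lambda>k. weight 0 (Lead \<alpha> k :: ('v, 'n) vertex) * cmod (u (Lead \<alpha> k))) summable_on UNIV"
    by (rule ell1_summable_Lead[OF ell1_mono(1)[OF assms]])
  then have "summable (\<lambda>k. cmod (u (Lead \<alpha> k)))" by (simp add: summable_on_imp_summable)
  then show ?thesis using summable_LIMSEQ_zero tendsto_norm_zero_iff by blast
qed

text \<open>Elements of \<open>ell1 s\<close> tend to 0 along every half-line. Differences of
  neighbouring values isolate the slope \<open>a\<close>; afterwards \<open>b\<close> is itself the
  limit.\<close>

lemma n_one_comb_unique:
  assumes "n_comb a + one_comb b \<in> ell1 s" "0 \<le> s"
  shows "a = 0" "b = 0"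
proof -
  have lim: "(\<lambda>k. a $ \<alpha> * of_real (pos k) + b $ \<alpha>) \<longlonglongrightarrow> 0" for \<alpha>
    using ell1_Lead_tendsto_0[OF assms, of \<alpha>] by simp
  have "a $ \<alpha> = 0" for \<alpha>
  proof -
    have "(\<lambda>k. (a $ \<alpha> * of_real (pos (Suc k)) + b $ \<alpha>) - (a $ \<alpha> * of_real (pos k) + b $ \<alpha>)) \<longlonglongrightarrow> 0 - 0"
      by (intro tendsto_diff lim LIMSEQ_Suc[OF lim])
    then have "(\<lambda>k::nat. a $ \<alpha>) \<longlonglongrightarrow> 0" by (simp add: pos_def algebra_simps)
    then show ?thesis by (simp add: LIMSEQ_const_iff)
  qed
  then show a: "a = 0" by (simp add: vec_eq_iff)
  show "b = 0" using lim by (simp add: a vec_eq_iff LIMSEQ_const_iff)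
qed

lemma one_plus_ell1_I: "u - one_comb b \<in> ell1 s \<Longrightarrow> u \<in> one_plus_ell1 s"
  unfolding one_plus_ell1_def by (rule CollectI, rule exI[of _ b], rule exI[of _ "u - one_comb b"]) simp

lemma one_plus_ell1_E:
  assumes "u \<in> one_plus_ell1 s" obtains b where "u - one_comb b \<in> ell1 s"
proof -
  obtain b w where "u = one_comb b + w" "w \<in> ell1 s"
    using assms unfolding one_plus_ell1_def by blast
  then show thesis using that[of b] by simp
qed

lemma csubspace_one_plus_ell1: "csubspace (one_plus_ell1 s)"
  unfolding csubspace_def
proof (intro conjI ballI allI)
  show "0 \<in> one_plus_ell1 s" by (rule one_plus_ell1_I[of _ 0]) (simp add: one_comb_zero)
  fix x y :: "('a, 'b) state" and c assume "x \<in> one_plus_ell1 s"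
  then obtain a where a: "x - one_comb a \<in> ell1 s" by (rule one_plus_ell1_E)
  show "c *\<^sub>C x \<in> one_plus_ell1 s"
    by (rule one_plus_ell1_I[of _ "c *s a"])
      (simp only: one_comb_scale scaleC_diff_right[symmetric] csubspaceD(3)[OF csubspace_ell1 a])
  assume "y \<in> one_plus_ell1 s"
  then obtain b where b: "y - one_comb b \<in> ell1 s" by (rule one_plus_ell1_E)
  show "x + y \<in> one_plus_ell1 s"
    by (rule one_plus_ell1_I[of _ "a + b"])
      (simp only: one_comb_add add_diff_add csubspaceD(2)[OF csubspace_ell1 a b])
qed

text \<open>At coordinate \<open>n\<close> the difference is the sum of \<open>(n - m) f[m]\<close>
  over \<open>m > n\<close>. Exchanging summations costs one factor for the number of
  \<open>n < m\<close> and one for \<open>m - n\<close>, that is, two powers of the weight: the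
  origin of the exponent \<open>\<beta> - 2\<close>.\<close>

lemma (in core_graph) G0_0_asymptotics:
  assumes f: "f \<in> ell1 s" and s: "2 \<le> s"
  shows "G0 0 f - one_comb (\<chi> \<alpha>. \<langle>n_vec \<alpha>, f\<rangle>) \<in> ell1 (s - 2)"
  unfolding ell1_iff_leads
proof
  fix \<alpha>
  let ?w = "\<lambda>t k. weight t (Lead \<alpha> k :: ('v, 'n) vertex)"
  \<comment> \<open>Dominating double family: the error at \<open>k\<close> is at most the sum of
    \<open>pos l * cmod (f (Lead \<alpha> l))\<close> over the points \<open>l\<close> beyond
    \<open>k\<close>.\<close>
  let ?F = "\<lambda>l k. ?w (s - 2) k * (if k < l then pos l * cmod (f (Lead \<alpha> l)) else 0)"
  have f1: "f \<in> ell1 (real 1)" using ell1_mono(1)[OF f] s by simp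
  note f1s = sum_pos_power_le_ell1_norm(1)[OF f1, of \<alpha>]
  have inner: "((\<lambda>k. ?F l k) has_sum (\<Sum>k<l. ?w (s - 2) k * (pos l * cmod (f (Lead \<alpha> l))))) UNIV" for l
  proof -
    have "((\<lambda>k. ?w (s - 2) k * (pos l * cmod (f (Lead \<alpha> l)))) has_sum
        (\<Sum>k<l. ?w (s - 2) k * (pos l * cmod (f (Lead \<alpha> l))))) {..<l}" by simp
    then show ?thesis by (rule has_sum_cong_neutral[THEN iffD1, rotated -1]) auto
  qed
  \<comment> \<open>Summed over \<open>k\<close> there are \<open>l\<close> terms, each at most its
    value with the weight at \<open>l\<close>; the factor \<open>real l * pos l\<close> is absorbed
    by the weight of exponent 2, which restores exponent \<open>s\<close>.\<close>
  have outer: "(\<lambda>l. \<Sum>k<l. ?w (s - 2) k * (pos l * cmod (f (Lead \<alpha> l)))) summable_on UNIV"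
  proof (rule summable_on_comparison_test[OF ell1_summable_Lead[OF f]])
    fix l
    have "(\<Sum>k<l. ?w (s - 2) k * (pos l * cmod (f (Lead \<alpha> l))))
        \<le> (\<Sum>k<l. ?w (s - 2) l * (pos l * cmod (f (Lead \<alpha> l))))"
    proof (intro sum_mono mult_right_mono)
      fix k assume "k \<in> {..<l}"
      then have "1 + (pos k)\<^sup>2 \<le> 1 + (pos l)\<^sup>2" by (auto simp: pos_def intro!: power_mono)
      then show "?w (s - 2) k \<le> ?w (s - 2) l"
        unfolding weight_Lead using s one_plus_pos[of k] by (intro powr_mono2) auto
    qed (simp add: less_imp_le)
    also have "\<dots> = real l * pos l * (?w (s - 2) l * cmod (f (Lead \<alpha> l)))" by simp
    also have "\<dots> \<le> ?w 2 l * (?w (s - 2) l * cmod (f (Lead \<alpha> l)))"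
    proof (rule mult_right_mono)
      have "real l * pos l \<le> pos l ^ 2" by (simp add: pos_def power2_eq_square)
      also have "\<dots> \<le> weight (real 2) (Lead \<alpha> l :: ('v, 'n) vertex)" by (rule pos_power_le_weight)
      finally show "real l * pos l \<le> ?w 2 l" by simp
    qed simp
    also have "\<dots> = ?w s l * cmod (f (Lead \<alpha> l))"
      using weight_add[of 2 "s - 2" "Lead \<alpha> l :: ('v, 'n) vertex"] by simp
    finally show "(\<Sum>k<l. ?w (s - 2) k * (pos l * cmod (f (Lead \<alpha> l)))) \<le> ?w s l * cmod (f (Lead \<alpha> l))" .
  qed (auto intro!: sum_nonneg simp: less_imp_le)
  have "(\<lambda>(l, k). ?F l k) summable_on UNIV \<times> UNIV"
    by (rule summable_on_SigmaI[where g = "\<lambda>l. \<Sum>k<l. ?w (s - 2) k * (pos l * cmod (f (Lead \<alpha> l)))"])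
      (use inner outer in \<open>auto simp: less_imp_le\<close>)
  from summable_on_swap[THEN iffD1, OF this] have "(\<lambda>(k, l). ?F l k) summable_on UNIV \<times> UNIV"
    by (simp add: case_prod_unfold cong: if_cong)
  from summable_on_Sigma_banach[OF this] have T: "(\<lambda>k. \<Sum>\<^sub>\<infinity>l. ?F l k) summable_on UNIV" .
  show "(\<lambda>k. ?w (s - 2) k * cmod ((G0 0 f - one_comb (\<chi> \<alpha>. \<langle>n_vec \<alpha>, f\<rangle>)) (Lead \<alpha> k))) summable_on UNIV"
  proof (rule summable_on_comparison_test[OF T])
    fix k
    let ?t = "\<lambda>l. if k < l then pos l * cmod (f (Lead \<alpha> l)) else 0"
    have n: "\<langle>n_vec \<alpha>, f\<rangle> = (\<Sum>\<^sub>\<infinity>l. of_real (pos l) * f (Lead \<alpha> l))"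
      by (rule pairing_n_vec)
    have s1: "(\<lambda>l. complex_of_real (pos l) * f (Lead \<alpha> l)) summable_on UNIV"
      by (rule abs_summable_summable, rule Infinite_Sum.abs_summable_on_comparison_test'[OF f1s])
        (simp add: norm_mult less_imp_le)
    have s2: "(\<lambda>l. complex_of_real (lead_kernel 0 (pos k) (pos l)) * f (Lead \<alpha> l)) summable_on UNIV"
      by (rule abs_summable_summable, rule Infinite_Sum.abs_summable_on_comparison_test'[OF f1s])
        (auto simp: norm_mult lead_kernel_def less_imp_le intro!: mult_right_mono)
    have s3: "?t summable_on UNIV"
      by (rule summable_on_comparison_test[OF f1s]) (auto simp: less_imp_le)
    have "((\<lambda>l. (complex_of_real (lead_kernel 0 (pos k) (pos l)) - of_real (pos l)) * f (Lead \<alpha> l)) has_sum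
        (G0 0 f - one_comb (\<chi> \<alpha>. \<langle>n_vec \<alpha>, f\<rangle>)) (Lead \<alpha> k)) UNIV"
    proof -
      have "((\<lambda>l. complex_of_real (lead_kernel 0 (pos k) (pos l)) * f (Lead \<alpha> l) + - (of_real (pos l) * f (Lead \<alpha> l))) has_sum
          (G0 0 f (Lead \<alpha> k) + - \<langle>n_vec \<alpha>, f\<rangle>)) UNIV"
        unfolding n G0_Lead by (intro has_sum_add has_sum_uminusI has_sum_infsum s1 s2)
      then show ?thesis by (simp add: left_diff_distrib)
    qed
    from norm_infsum_le[OF this has_sum_infsum[OF s3]]
    have "cmod ((G0 0 f - one_comb (\<chi> \<alpha>. \<langle>n_vec \<alpha>, f\<rangle>)) (Lead \<alpha> k)) \<le> infsum ?t UNIV"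
    proof this
      fix l
      have "\<bar>lead_kernel 0 (pos k) (pos l) - pos l\<bar> \<le> (if k < l then pos l else 0)"
        by (auto simp: lead_kernel_def pos_def min_def)
      then show "cmod ((complex_of_real (lead_kernel 0 (pos k) (pos l)) - of_real (pos l)) * f (Lead \<alpha> l)) \<le> ?t l"
        unfolding of_real_diff[symmetric] norm_mult norm_of_real
        using mult_right_mono[of _ _ "cmod (f (Lead \<alpha> l))"] by fastforce
    qed
    then have "?w (s - 2) k * cmod ((G0 0 f - one_comb (\<chi> \<alpha>. \<langle>n_vec \<alpha>, f\<rangle>)) (Lead \<alpha> k))
        \<le> ?w (s - 2) k * infsum ?t UNIV" by (intro mult_left_mono) auto
    then show "?w (s - 2) k * cmod ((G0 0 f - one_comb (\<chi> \<alpha>. \<langle>n_vec \<alpha>, f\<rangle>)) (Lead \<alpha> k)) \<le> (\<Sum>\<^sub>\<infinity>l. ?F l k)"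
      by (simp only: infsum_cmult_right')
  qed simp
qed

context core_graph
begin

lemma H0_n_comb: "H0 (n_comb a) = 0"
proof (rule vertex_ext)
  fix x show "H0 (n_comb a) (Core x) = 0 (Core x)"
    using clinear_onD(3)[OF clinear_h] by (simp add: H0_Core fun_eq_iff zero_fun_def)
next
  fix \<alpha> k show "H0 (n_comb a) (Lead \<alpha> k) = 0 (Lead \<alpha> k)"
    by (cases k) (simp_all add: H0_Lead lead_ham_def pos_def algebra_simps)
qed

text \<open>Injectivity of \<open>h\<close> removes the core, and on each half-line only multiples
  of the coordinate survive.\<close>

lemma H0_kernel:
  assumes "H0 u = 0" obtains a where "u = n_comb a"
proof
  show "u = n_comb (\<chi> \<alpha>. u (Lead \<alpha> 0))"
  proof (rule vertex_ext)
    have "h (\<lambda>b. u (Core b)) = 0"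
      by (rule ext) (use fun_cong[OF assms, of "Core _"] in \<open>simp add: H0_Core\<close>)
    from h_kernel[OF this] show "u (Core x) = n_comb (\<chi> \<alpha>. u (Lead \<alpha> 0)) (Core x)" for x
      by (simp add: fun_eq_iff)
    show "u (Lead \<alpha> k) = n_comb (\<chi> \<alpha>. u (Lead \<alpha> 0)) (Lead \<alpha> k)" for \<alpha> k
      using lead_ham_eq_0[of "\<lambda>k. u (Lead \<alpha> k)" k] fun_cong[OF assms, of "Lead \<alpha> _"]
      by (simp add: H0_Lead mult.commute)
  qed
qed

end

section \<open>The perturbation\<close>

lemma finite_convergent_subsequence:
  fixes f :: "nat \<Rightarrow> 'a \<Rightarrow> complex"
  assumes "finite S" "\<And>p. p \<in> S \<Longrightarrow> bounded (range (\<lambda>n. f n p))"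
  shows "\<exists>r l. strict_mono r \<and> (\<forall>p\<in>S. (\<lambda>n. f (r n) p) \<longlonglongrightarrow> l p)"
  using assms
proof (induction S)
  case empty
  show ?case by (intro exI[of _ id]) (simp add: strict_mono_def)
next
  case (insert q S)
  then obtain r l where r: "strict_mono r" "\<forall>p\<in>S. (\<lambda>n. f (r n) p) \<longlonglongrightarrow> l p" by auto
  have "bounded (range (\<lambda>n. f (r n) q))"
    by (rule bounded_subset[OF insert.prems[of q]]) auto
  from bounded_imp_convergent_subsequence[OF this]
  obtain m r' where r': "strict_mono r'" "(\<lambda>n. f (r (r' n)) q) \<longlonglongrightarrow> m"
    by (auto simp: o_def)
  have "(\<lambda>n. f ((r \<circ> r') n) p) \<longlonglongrightarrow> (l(q := m)) p" if "p \<in> insert q S" for p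
  proof (cases "p = q")
    case False
    then have "(\<lambda>n. f (r n) p) \<longlonglongrightarrow> l p" using r(2) that by blast
    from LIMSEQ_subseq_LIMSEQ[OF this r'(1)] show ?thesis using False by (simp add: o_def)
  qed (use r'(2) in simp)
  then show ?case using strict_mono_o[OF r(1) r'(1)] by blast
qed

lemma Cauchy_if_dist_le:
  fixes x :: "nat \<Rightarrow> 'a::metric_space"
  assumes "\<And>m n. dist (x m) (x n) \<le> b m + b n" "b \<longlonglongrightarrow> (0::real)"
  shows "Cauchy x"
proof (rule metric_CauchyI)
  fix e :: real assume "0 < e"
  then obtain K where K: "\<And>n. n \<ge> K \<Longrightarrow> \<bar>b n\<bar> < e / 2"
    using LIMSEQ_D[OF assms(2), of "e / 2"] by auto
  have "dist (x m) (x n) < e" if "m \<ge> K" "n \<ge> K" for m n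
    using assms(1)[of m n] K[OF that(1)] K[OF that(2)] by linarith
  then show "\<exists>K. \<forall>m\<ge>K. \<forall>n\<ge>K. dist (x m) (x n) < e" by blast
qed

text \<open>Quantitative compactness of the embedding of \<open>ell1 s\<close> into
  \<open>ell1 1\<close>: from the index \<open>N\<close> on, the lower weight is smaller by a factor
  \<open>N\<close>, and the remaining vertices form a finite set that is the same for all
  functions.\<close>

lemma ell1_norm_tail:
  fixes f :: "('v::finite, 'n::finite) state"
  assumes f: "f \<in> ell1 s" and s: "2 \<le> s" and N: "0 < N"
  obtains S where "finite S" "\<And>f :: ('v, 'n) state. f \<in> ell1 s \<Longrightarrow>
      ell1_norm 1 f \<le> (\<Sum>y\<in>S. weight 1 y * cmod (f y)) + ell1_norm s f / real N"
proof -
  define S :: "('v, 'n) vertex set" where "S = range Core \<union> (\<Union>\<alpha>. Lead \<alpha> ` {..<N})"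
  have fin: "finite S" by (simp add: S_def)
  have "ell1_norm 1 f \<le> (\<Sum>y\<in>S. weight 1 y * cmod (f y)) + ell1_norm s f / real N"
    if f: "f \<in> ell1 s" for f :: "('v, 'n) state"
  proof -
    let ?i = "\<lambda>y. if y \<in> S then weight 1 y * cmod (f y) else 0"
    have si: "(?i has_sum (\<Sum>y\<in>S. weight 1 y * cmod (f y))) UNIV"
      by (rule has_sum_finite_neutralI[OF fin]) auto
    have hs: "((\<lambda>y. ?i y + inverse (real N) * (weight s y * cmod (f y))) has_sum
        ((\<Sum>y\<in>S. weight 1 y * cmod (f y)) + inverse (real N) * ell1_norm s f)) UNIV"
      unfolding ell1_norm_def by (intro has_sum_add si has_sum_cmult_right has_sum_infsum ell1_summable f)
    have le: "weight 1 y * cmod (f y) \<le> ?i y + inverse (real N) * (weight s y * cmod (f y))" for y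
    proof (cases "y \<in> S")
      case True
      then show ?thesis by simp
    next
      case False
      then obtain \<alpha> k where y: "y = Lead \<alpha> k" by (cases y) (auto simp: S_def)
      have "N \<le> k"
      proof (rule ccontr)
        assume "\<not> N \<le> k"
        then have "y \<in> Lead \<alpha> ` {..<N}" using y by simp
        then show False using False by (auto simp: S_def)
      qed
      have "pos k \<le> weight 1 y" unfolding y by (rule pos_le_weight)
      then have "real N * weight 1 y \<le> weight 1 y * weight 1 y"
        using \<open>N \<le> k\<close> by (intro mult_right_mono) (auto simp: pos_def)
      also have "\<dots> = weight 2 y" using weight_add[of 1 1 y] by simp
      also have "\<dots> \<le> weight s y" by (rule weight_mono[OF s])
      finally have "weight 1 y \<le> inverse (real N) * weight s y" using N by (simp add: field_simps)
      from mult_right_mono[OF this, of "cmod (f y)"] show ?thesis using False by (simp add: mult.assoc)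
    qed
    show ?thesis
      using ell1_I(2)[OF has_sum_imp_summable[OF hs] le] unfolding infsumI[OF hs]
      by (simp only: divide_inverse_commute)
  qed
  then show thesis using that fin by blast
qed

locale scattering = core_graph E0 xs
  for E0 :: "'v::finite set set" and xs :: "'n::finite \<Rightarrow> 'v" +
  fixes \<beta> :: nat and V :: "('v, 'n) op" and v :: "'k::complex_hilbert \<Rightarrow> ('v, 'n) state" and U :: "'k \<Rightarrow> 'k"
  assumes beta: "3 \<le> \<beta>" and A: "assumption_A (real \<beta>) V v U"
begin

abbreviation "s \<equiv> real \<beta>"
abbreviation "vs \<equiv> adjoint_of v"
abbreviation "H \<equiv> H0 + V"

lemma s_bounds: "1 \<le> s" "2 \<le> s" "3 \<le> s" "0 \<le> s" "0 \<le> s - 2"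
  using beta by auto

lemma clinear_v: "clinear_on UNIV v" and inj_v: "inj v"
  and V_factor: "u \<in> ell1_dual s \<Longrightarrow> V u = v (U (vs u))"
  using A by (auto simp: assumption_A_def)

lemma clinear_U: "clinear_on UNIV U" and U_sym: "cinner x (U y) = cinner (U x) y"
  and U_isometry: "cinner (U x) (U y) = cinner x y"
  using A by (auto simp: assumption_A_def selfadjoint_unitary_def)

lemma cinner_ext:
  assumes "\<And>\<phi>. cinner k \<phi> = cinner (l::'k) \<phi>" shows "k = l"
  using assms[of "k - l"] cinner_eq_zero_iff[of "k - l"] by (simp add: cinner_diff_left)

lemma U_U: "U (U x) = x"
  by (rule cinner_ext) (metis U_sym U_isometry)

lemma norm_U: "norm (U x) = norm x"
proof -
  have "complex_of_real ((norm (U x))\<^sup>2) = complex_of_real ((norm x)\<^sup>2)"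
    by (simp only: cinner_self[symmetric] U_isometry)
  then show ?thesis by (simp only: of_real_eq_iff) (simp add: power2_eq_iff_nonneg)
qed

definition Cv :: real where
  "Cv = (SOME C. 0 \<le> C \<and> (\<forall>\<phi>. v \<phi> \<in> ell1 s \<and> ell1_norm s (v \<phi>) \<le> C * norm \<phi>))"

lemma Cv: "0 \<le> Cv" "v \<phi> \<in> ell1 s" "ell1_norm s (v \<phi>) \<le> Cv * norm \<phi>"
proof -
  obtain C where C: "\<And>\<phi>. v \<phi> \<in> ell1 s" "\<And>\<phi>. ell1_norm s (v \<phi>) \<le> C * norm \<phi>"
    using A by (auto simp: assumption_A_def)
  have "C * norm \<phi> \<le> \<bar>C\<bar> * norm \<phi>" for \<phi> :: 'k by (intro mult_right_mono) auto
  then have "0 \<le> \<bar>C\<bar> \<and> (\<forall>\<phi>. v \<phi> \<in> ell1 s \<and> ell1_norm s (v \<phi>) \<le> \<bar>C\<bar> * norm \<phi>)"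
    using C order_trans by fastforce
  from someI[of "\<lambda>C. 0 \<le> C \<and> (\<forall>\<phi>. v \<phi> \<in> ell1 s \<and> ell1_norm s (v \<phi>) \<le> C * norm \<phi>)", OF this]
  show "0 \<le> Cv" "v \<phi> \<in> ell1 s" "ell1_norm s (v \<phi>) \<le> Cv * norm \<phi>"
    unfolding Cv_def by blast+
qed

text \<open>Riesz justifies the definite description in \<open>adjoint_of\<close> for functionals
  coming from \<open>ell1_dual s\<close>. Therefore linearity of \<open>vs\<close>, and of
  \<open>V\<close> through its factorisation, is claimed on that space only.\<close>

lemma adjoint:
  assumes u: "u \<in> ell1_dual s" shows "cinner (vs u) \<phi> = \<langle>u, v \<phi>\<rangle>"
proof -
  have "clinear_on UNIV (\<lambda>\<phi>. \<langle>u, v \<phi>\<rangle>)"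
    by (simp add: clinear_on_def clinear_onD[OF clinear_v] pairing_add_right pairing_scaleC_right
        pairable_dual_ell1[OF u Cv(2)])
  moreover have "cmod \<langle>u, v \<phi>\<rangle> \<le> (ell1_dual_norm s u * Cv) * norm \<phi>" for \<phi>
    using pairing_bound_dual[OF u Cv(2)[of \<phi>]] mult_left_mono[OF Cv(3)[of \<phi>] ell1_dual_norm_nonneg[OF u]]
    by (simp add: mult.assoc)
  ultimately have "\<exists>!k. \<forall>\<phi>. cinner k \<phi> = \<langle>u, v \<phi>\<rangle>" by (rule Riesz_representation)
  from theI'[OF this] show ?thesis by (simp add: adjoint_of_def)
qed

lemma adjoint_add: "u \<in> ell1_dual s \<Longrightarrow> w \<in> ell1_dual s \<Longrightarrow> vs (u + w) = vs u + vs w"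
  by (rule cinner_ext) (simp add: adjoint csubspaceD[OF csubspace_ell1_dual] cinner_add_left
      pairing_add_left pairable_dual_ell1[OF _ Cv(2)])

lemma adjoint_scaleC: "u \<in> ell1_dual s \<Longrightarrow> vs (c *\<^sub>C u) = c *\<^sub>C vs u"
  by (rule cinner_ext) (simp only: adjoint csubspaceD[OF csubspace_ell1_dual] cinner_scaleC_left pairing_scaleC_left)

lemma adjoint_minus: "u \<in> ell1_dual s \<Longrightarrow> vs (- u) = - vs u"
  using adjoint_scaleC[of u "-1"] by (simp add: scaleC_minus_one)

lemma adjoint_diff: "u \<in> ell1_dual s \<Longrightarrow> w \<in> ell1_dual s \<Longrightarrow> vs (u - w) = vs u - vs w"
  using adjoint_add[of u "-w"] by (simp add: adjoint_minus csubspaceD[OF csubspace_ell1_dual])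

text \<open>The functional is tested with \<open>vs u\<close> itself, and one factor of its norm
  cancels.\<close>

lemma adjoint_bound:
  assumes "\<And>x. cmod (u x) \<le> D * weight s x"
  shows "norm (vs u) \<le> D * Cv"
proof -
  have u: "u \<in> ell1_dual s" by (rule ell1_dual_I[OF assms])
  have D: "0 \<le> D" using assms[of undefined] norm_ge_zero order_trans nonneg_if_mult_weight_nonneg by blast
  have "(norm (vs u))\<^sup>2 = cmod (cinner (vs u) (vs u))" by (simp add: cinner_self norm_power)
  also have "\<dots> = cmod \<langle>v (vs u), u\<rangle>" using adjoint[OF u] pairing_commute[of u] by simp
  also have "\<dots> \<le> D * ell1_norm s (v (vs u))" by (rule pairing_bound(2)[OF Cv(2) assms])
  also have "\<dots> \<le> D * (Cv * norm (vs u))" by (intro mult_left_mono Cv D)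
  finally have "norm (vs u) * norm (vs u) \<le> (D * Cv) * norm (vs u)" by (simp add: power2_eq_square mult.assoc)
  then show ?thesis using D Cv(1) by (cases "vs u = 0") auto
qed

lemma V_ell1: "u \<in> ell1_dual s \<Longrightarrow> V u \<in> ell1 s"
  by (simp add: V_factor Cv)

lemma V_add: "u \<in> ell1_dual s \<Longrightarrow> w \<in> ell1_dual s \<Longrightarrow> V (u + w) = V u + V w"
  by (simp add: V_factor csubspaceD[OF csubspace_ell1_dual] adjoint_add clinear_onD[OF clinear_U] clinear_onD[OF clinear_v])

lemma V_scaleC: "u \<in> ell1_dual s \<Longrightarrow> V (c *\<^sub>C u) = c *\<^sub>C V u"
  by (simp only: V_factor csubspaceD[OF csubspace_ell1_dual] adjoint_scaleC clinear_onD[OF clinear_U] clinear_onD[OF clinear_v])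

lemma V_minus: "u \<in> ell1_dual s \<Longrightarrow> V (- u) = - V u"
  using V_scaleC[of u "-1"] by (simp add: scaleC_minus_one)

lemma V_diff: "u \<in> ell1_dual s \<Longrightarrow> w \<in> ell1_dual s \<Longrightarrow> V (u - w) = V u - V w"
  using V_add[of u "-w"] by (simp add: V_minus csubspaceD[OF csubspace_ell1_dual])

lemma V_sum: "(\<And>i. i \<in> I \<Longrightarrow> f i \<in> ell1_dual s) \<Longrightarrow> V (\<Sum>i\<in>I. f i) = (\<Sum>i\<in>I. V (f i))"
proof (induction I rule: infinite_finite_induct)
  case (insert i I)
  then show ?case
    unfolding sum.insert[OF insert.hyps(1,2)]
    by (subst V_add) (auto intro: csubspace_sum[OF csubspace_ell1_dual])
qed (use V_scaleC[of 0 0] csubspaceD(1)[OF csubspace_ell1_dual] in auto)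

lemma V_bound:
  assumes "\<And>x. cmod (u x) \<le> D * weight s x"
  shows "ell1_norm s (V u) \<le> Cv * (D * Cv)"
proof -
  have "ell1_norm s (V u) \<le> Cv * norm (U (vs u))" using Cv(3) V_factor[OF ell1_dual_I[OF assms]] by simp
  also have "\<dots> \<le> Cv * (D * Cv)" unfolding norm_U by (intro mult_left_mono adjoint_bound assms Cv)
  finally show ?thesis .
qed

lemma pairing_v: "a \<in> ell1_dual s \<Longrightarrow> \<langle>v \<phi>, a\<rangle> = cinner \<phi> (vs a)"
  using adjoint[of a \<phi>] pairing_commute[of "v \<phi>" a] cinner_commute[of \<phi> "vs a"] by simp

lemma V_symmetric: "a \<in> ell1_dual s \<Longrightarrow> b \<in> ell1_dual s \<Longrightarrow> \<langle>a, V b\<rangle> = \<langle>V a, b\<rangle>"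
  by (simp add: V_factor pairing_v adjoint[symmetric] U_sym)

lemma G0_0_kernel:
  obtains C where "\<And>t. 1 \<le> t \<Longrightarrow> kernel_operator (G0 0) (free_kernel 0) t C"
  by (rule free_coeff_kernel[of 0]) auto

lemma G0_0_dual: "f \<in> ell1 s \<Longrightarrow> G0 0 f \<in> ell1_dual s"
proof -
  obtain C where "\<And>t. 1 \<le> t \<Longrightarrow> kernel_operator (G0 0) (free_kernel 0) t C" by (rule G0_0_kernel) blast
  from this[OF s_bounds(1)] interpret kernel_operator "G0 0" "free_kernel 0" s C .
  show "f \<in> ell1 s \<Longrightarrow> G0 0 f \<in> ell1_dual s" by (rule apply_dual)
qed

lemma G0_0_add: "f \<in> ell1 s \<Longrightarrow> f' \<in> ell1 s \<Longrightarrow> G0 0 (f + f') = G0 0 f + G0 0 f'"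
  and G0_0_scaleC: "f \<in> ell1 s \<Longrightarrow> G0 0 (c *\<^sub>C f) = c *\<^sub>C G0 0 f"
  and G0_0_minus: "f \<in> ell1 s \<Longrightarrow> G0 0 (- f) = - G0 0 f"
  and G0_0_diff: "f \<in> ell1 s \<Longrightarrow> f' \<in> ell1 s \<Longrightarrow> G0 0 (f - f') = G0 0 f - G0 0 f'"
  and G0_0_symmetric: "f \<in> ell1 s \<Longrightarrow> f' \<in> ell1 s \<Longrightarrow> \<langle>G0 0 f, f'\<rangle> = \<langle>f, G0 0 f'\<rangle>"
proof -
  obtain C where "\<And>t. 1 \<le> t \<Longrightarrow> kernel_operator (G0 0) (free_kernel 0) t C" by (rule G0_0_kernel) blast
  from this[OF s_bounds(1)] interpret kernel_operator "G0 0" "free_kernel 0" s C .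
  show "f \<in> ell1 s \<Longrightarrow> f' \<in> ell1 s \<Longrightarrow> G0 0 (f + f') = G0 0 f + G0 0 f'" by (rule apply_add)
  show "f \<in> ell1 s \<Longrightarrow> G0 0 (c *\<^sub>C f) = c *\<^sub>C G0 0 f" by (rule apply_scaleC)
  show "f \<in> ell1 s \<Longrightarrow> G0 0 (- f) = - G0 0 f" by (rule apply_minus)
  show "f \<in> ell1 s \<Longrightarrow> f' \<in> ell1 s \<Longrightarrow> G0 0 (f - f') = G0 0 f - G0 0 f'" by (rule apply_diff)
  show "f \<in> ell1 s \<Longrightarrow> f' \<in> ell1 s \<Longrightarrow> \<langle>G0 0 f, f'\<rangle> = \<langle>f, G0 0 f'\<rangle>" by (rule symmetric)
qed

lemma H0_G0': "f \<in> ell1 s \<Longrightarrow> H0 (G0 0 f) = f"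
  by (rule H0_G0[OF ell1_mono(1)]) (use s_bounds in auto)

subsection \<open>The operator \<open>M0\<close>\<close>

definition M0 :: "'k \<Rightarrow> 'k" where
  "M0 = U + vs \<odot> G0 0 \<odot> v"

lemma M0_apply: "M0 \<phi> = U \<phi> + vs (G0 0 (v \<phi>))"
  by (simp add: M0_def)

lemma clinear_M0: "clinear_on UNIV M0"
  unfolding clinear_on_def
proof (intro conjI ballI allI)
  fix x y :: 'k and c
  show "M0 (x + y) = M0 x + M0 y"
    unfolding M0_apply clinear_onD(1)[OF clinear_v] clinear_onD(1)[OF clinear_U]
    by (simp only: G0_0_add[OF Cv(2) Cv(2)] adjoint_add[OF G0_0_dual[OF Cv(2)] G0_0_dual[OF Cv(2)]])
      (simp add: add_ac)
  show "M0 (c *\<^sub>C x) = c *\<^sub>C M0 x"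
    unfolding M0_apply clinear_onD(2)[OF clinear_v] clinear_onD(2)[OF clinear_U]
    by (simp only: G0_0_scaleC[OF Cv(2)] adjoint_scaleC[OF G0_0_dual[OF Cv(2)]] scaleC_add_right)
qed

lemma M0_sym: "cinner x (M0 y) = cinner (M0 x) y"
proof -
  have "cinner x (vs (G0 0 (v y))) = \<langle>v x, G0 0 (v y)\<rangle>" by (simp add: pairing_v G0_0_dual Cv)
  also have "\<dots> = \<langle>G0 0 (v x), v y\<rangle>" by (simp add: G0_0_symmetric Cv)
  also have "\<dots> = cinner (vs (G0 0 (v x))) y" by (simp add: adjoint G0_0_dual Cv)
  finally show ?thesis by (simp add: M0_apply cinner_add_right cinner_add_left U_sym)
qed

text \<open>The exponent 1 on the right, instead of \<open>s\<close>, is the point: the gap between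
  the two weights is what makes this part of \<open>M0\<close> compact.\<close>

lemma compact_part_bound:
  obtains C where "0 \<le> C" "\<And>\<phi>. norm (vs (G0 0 (v \<phi>))) \<le> C * ell1_norm 1 (v \<phi>)"
proof -
  obtain C where "\<And>t. 1 \<le> t \<Longrightarrow> kernel_operator (G0 0) (free_kernel 0) t C" by (rule G0_0_kernel) blast
  then interpret kernel_operator "G0 0" "free_kernel 0" 1 C by simp
  have "norm (vs (G0 0 (v \<phi>))) \<le> (C * Cv) * ell1_norm 1 (v \<phi>)" for \<phi>
  proof -
    have v1: "v \<phi> \<in> ell1 1" by (rule ell1_mono(1)[OF Cv(2) s_bounds(1)])
    have "norm (vs (G0 0 (v \<phi>))) \<le> (C * ell1_norm 1 (v \<phi>)) * Cv"
    proof (rule adjoint_bound)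
      fix x
      have "cmod (G0 0 (v \<phi>) x) \<le> C * ell1_norm 1 (v \<phi>) * weight 1 x" by (rule apply_bound[OF v1])
      also have "\<dots> \<le> C * ell1_norm 1 (v \<phi>) * weight s x"
        by (intro mult_left_mono weight_mono s_bounds mult_nonneg_nonneg C_nonneg ell1_norm_nonneg)
      finally show "cmod (G0 0 (v \<phi>) x) \<le> C * ell1_norm 1 (v \<phi>) * weight s x" .
    qed
    then show ?thesis by (simp add: mult_ac)
  qed
  then show thesis using that[of "C * Cv"] C_nonneg Cv(1) by simp
qed

text \<open>Only \<open>proper\<close> requires an idea. \<open>U\<close> preserves norms and, off a
  finite set, the contribution of \<open>v \<phi>\<close> to the other part is small relative to
  \<open>norm \<phi>\<close>; so \<open>norm \<phi>\<close> is controlled by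
  \<open>M0 \<phi>\<close> and finitely many values of \<open>v \<phi>\<close>. A subsequence along
  which these values converge is Cauchy.\<close>

sublocale M0: compactly_perturbed_isometry M0
proof (rule compactly_perturbed_isometry.intro)
  show "clinear_on UNIV M0" by (rule clinear_M0)
  show "cinner x (M0 y) = cinner (M0 x) y" for x y by (rule M0_sym)
  obtain C where C: "0 \<le> C" "\<And>\<phi>. norm (vs (G0 0 (v \<phi>))) \<le> C * ell1_norm 1 (v \<phi>)"
    by (rule compact_part_bound) blast
  show "bounded_linear M0"
  proof (rule bounded_linearI_clinear[OF clinear_M0, of "1 + C * Cv"])
    fix \<phi>
    have "norm (M0 \<phi>) \<le> norm (U \<phi>) + norm (vs (G0 0 (v \<phi>)))" unfolding M0_apply by (rule norm_triangle_ineq)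
    also have "\<dots> \<le> norm \<phi> + C * (Cv * norm \<phi>)"
    proof (rule add_mono)
      have "norm (vs (G0 0 (v \<phi>))) \<le> C * ell1_norm 1 (v \<phi>)" by (rule C(2))
      also have "\<dots> \<le> C * ell1_norm s (v \<phi>)"
        by (intro mult_left_mono ell1_mono(2) Cv(2) s_bounds C(1))
      also have "\<dots> \<le> C * (Cv * norm \<phi>)" by (intro mult_left_mono Cv C(1))
      finally show "norm (vs (G0 0 (v \<phi>))) \<le> C * (Cv * norm \<phi>)" .
    qed (simp add: norm_U)
    finally show "norm (M0 \<phi>) \<le> (1 + C * Cv) * norm \<phi>" by (simp add: algebra_simps)
  qed
  fix x :: "nat \<Rightarrow> 'k"
  assume x1: "\<And>n. norm (x n) = 1" and lim: "(\<lambda>n. M0 (x n)) \<longlonglongrightarrow> 0"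
  \<comment> \<open>\<open>N\<close> is so large that the tail contributes at most half of
    \<open>norm \<phi>\<close>, which is absorbed on the left.\<close>
  obtain N :: nat where "max 1 (2 * (C * Cv)) \<le> real N"
    using real_arch_simple by blast
  then have N: "0 < N" "2 * (C * Cv) \<le> real N" by auto
  obtain S :: "('v, 'n) vertex set" where S: "finite S" "\<And>f :: ('v, 'n) state. f \<in> ell1 s \<Longrightarrow>
      ell1_norm 1 f \<le> (\<Sum>y\<in>S. weight 1 y * cmod (f y)) + ell1_norm s f / real N"
    by (rule ell1_norm_tail[OF ell1_zero s_bounds(2) N(1)]) blast
  have est: "norm \<phi> \<le> 2 * norm (M0 \<phi>) + 2 * C * (\<Sum>y\<in>S. weight 1 y * cmod (v \<phi> y))" for \<phi>
  proof -
    have "norm \<phi> = norm (M0 \<phi> - vs (G0 0 (v \<phi>)))" by (simp add: M0_apply norm_U)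
    also have "\<dots> \<le> norm (M0 \<phi>) + norm (vs (G0 0 (v \<phi>)))" by (rule norm_triangle_ineq4)
    also have "norm (vs (G0 0 (v \<phi>))) \<le> C * ((\<Sum>y\<in>S. weight 1 y * cmod (v \<phi> y)) + Cv * norm \<phi> / real N)"
    proof (rule order_trans[OF C(2)], rule mult_left_mono[OF _ C(1)])
      have "ell1_norm s (v \<phi>) / real N \<le> Cv * norm \<phi> / real N" by (intro divide_right_mono Cv) simp
      then show "ell1_norm 1 (v \<phi>) \<le> (\<Sum>y\<in>S. weight 1 y * cmod (v \<phi> y)) + Cv * norm \<phi> / real N"
        using S(2)[OF Cv(2)[of \<phi>]] by linarith
    qed
    also have "C * ((\<Sum>y\<in>S. weight 1 y * cmod (v \<phi> y)) + Cv * norm \<phi> / real N)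
        \<le> C * (\<Sum>y\<in>S. weight 1 y * cmod (v \<phi> y)) + norm \<phi> / 2"
    proof -
      have "(2 * (C * Cv)) * norm \<phi> \<le> real N * norm \<phi>" by (intro mult_right_mono N) simp
      then have "C * (Cv * norm \<phi> / real N) \<le> norm \<phi> / 2" using N(1) by (simp add: field_simps)
      then show ?thesis by (simp add: distrib_left)
    qed
    finally show ?thesis by simp
  qed
  have bd: "bounded (range (\<lambda>n. v (x n) p))" for p
  proof -
    have "cmod (v (x n) p) \<le> Cv" for n
    proof -
      have "cmod (v (x n) p) \<le> weight s p * cmod (v (x n) p)"
        using mult_right_mono[OF weight_ge_1[OF s_bounds(4), of p], of "cmod (v (x n) p)"] by simp
      also have "\<dots> \<le> ell1_norm s (v (x n))" by (rule ell1_bound[OF Cv(2)])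
      also have "\<dots> \<le> Cv" using Cv(3)[of "x n"] x1 by simp
      finally show ?thesis .
    qed
    then show ?thesis by (auto intro!: boundedI)
  qed
  obtain r l where r: "strict_mono r" "\<And>p. p \<in> S \<Longrightarrow> (\<lambda>n. v (x (r n)) p) \<longlonglongrightarrow> l p"
    using finite_convergent_subsequence[OF S(1), of "\<lambda>n. v (x n)"] bd by blast
  \<comment> \<open>\<open>l\<close> is the limit of the values on \<open>S\<close>; comparing both
    members of a difference with it splits the estimate into terms with one index each.\<close>
  define b where "b n = 2 * norm (M0 (x (r n))) + 2 * C * (\<Sum>y\<in>S. weight 1 y * cmod (v (x (r n)) y - l y))" for n
  have "Cauchy (x \<circ> r)"
  proof (rule Cauchy_if_dist_le)
    fix m n
    let ?d = "x (r m) - x (r n)"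
    have "norm (M0 ?d) \<le> norm (M0 (x (r m))) + norm (M0 (x (r n)))"
      by (simp only: clinear_onD[OF clinear_M0] norm_triangle_ineq4)
    moreover have "(\<Sum>y\<in>S. weight 1 y * cmod (v ?d y)) \<le>
        (\<Sum>y\<in>S. weight 1 y * cmod (v (x (r m)) y - l y)) + (\<Sum>y\<in>S. weight 1 y * cmod (v (x (r n)) y - l y))"
      unfolding sum.distrib[symmetric] distrib_left[symmetric]
    proof (intro sum_mono mult_left_mono)
      fix y
      have "v ?d y = (v (x (r m)) y - l y) - (v (x (r n)) y - l y)"
        by (simp add: clinear_onD[OF clinear_v])
      then show "cmod (v ?d y) \<le> cmod (v (x (r m)) y - l y) + cmod (v (x (r n)) y - l y)"
        by (simp only: norm_triangle_ineq4)
    qed simp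
    from mult_left_mono[OF this, of "2 * C"]
    have "2 * C * (\<Sum>y\<in>S. weight 1 y * cmod (v ?d y)) \<le> 2 * C * (\<Sum>y\<in>S. weight 1 y * cmod (v (x (r m)) y - l y))
        + 2 * C * (\<Sum>y\<in>S. weight 1 y * cmod (v (x (r n)) y - l y))"
      using C(1) by (simp add: distrib_left)
    ultimately show "dist ((x \<circ> r) m) ((x \<circ> r) n) \<le> b m + b n"
      using est[of ?d] unfolding b_def dist_norm o_def by linarith
  next
    have M: "(\<lambda>n. M0 (x (r n))) \<longlonglongrightarrow> 0" using LIMSEQ_subseq_LIMSEQ[OF lim r(1)] by (simp add: o_def)
    have "b \<longlonglongrightarrow> 2 * norm (0::'k) + 2 * C * (\<Sum>y\<in>S. weight 1 y * cmod (l y - l y))"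
      unfolding b_def by (intro tendsto_intros M r(2))
    then show "b \<longlonglongrightarrow> 0" by simp
  qed
  then show "\<exists>r l. strict_mono r \<and> (x \<circ> r) \<longlonglongrightarrow> l"
    using r(1) Cauchy_convergent_iff convergent_def by blast
qed

abbreviation "D \<equiv> pseudo_inverse M0"

text \<open>In a solution of \<open>w = b - G0 0 (V w)\<close> the function \<open>V w\<close>
  equals \<open>W b\<close> up to \<open>V\<close> of an element of the bounded eigenspace.\<close>

definition W :: "('v, 'n) op" where
  "W = v \<odot> D \<odot> vs"

lemma W_apply: "W f = v (D (vs f))"
  by (simp add: W_def)

lemma W_ell1: "W f \<in> ell1 s"
  by (simp add: W_apply Cv)

lemma W_symmetric: "a \<in> ell1_dual s \<Longrightarrow> b \<in> ell1_dual s \<Longrightarrow> \<langle>W a, b\<rangle> = \<langle>a, W b\<rangle>"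
  by (simp add: W_apply pairing_v adjoint[symmetric] M0.pseudo_inverse_sym)

subsection \<open>Generalized eigenfunctions\<close>

lemma H_apply: "H u = H0 u + V u"
  by simp

lemma n_comb_dual_s: "(n_comb a :: ('v, 'n) state) \<in> ell1_dual s"
  using n_comb_dual s_bounds(1) by (rule ell1_dual_mono)

text \<open>As \<open>G0 0\<close> is a right inverse of \<open>H0\<close>, the equation says that
  \<open>u + G0 0 (V u)\<close> lies in the kernel of \<open>H0\<close>.\<close>

lemma H_eq_0_iff:
  assumes u: "u \<in> ell1_dual s"
  shows "H u = 0 \<longleftrightarrow> (\<exists>a. u = n_comb a - G0 0 (V u))"
proof
  assume "H u = 0"
  then have "H0 u + V u = 0" by (simp only: H_apply)
  then have "H0 (u + G0 0 (V u)) = 0"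
    by (simp only: clinear_onD(1)[OF clinear_H0] H0_G0'[OF V_ell1[OF u]])
  then obtain a where "u + G0 0 (V u) = n_comb a" by (rule H0_kernel)
  then show "\<exists>a. u = n_comb a - G0 0 (V u)" by (metis add_diff_cancel_right')
next
  assume "\<exists>a. u = n_comb a - G0 0 (V u)"
  then obtain a where a: "u = n_comb a - G0 0 (V u)" ..
  have "H0 u = H0 (n_comb a - G0 0 (V u))" using a by simp
  also have "\<dots> = 0 - V u" by (simp only: clinear_onD(5)[OF clinear_H0] H0_n_comb H0_G0'[OF V_ell1[OF u]])
  finally show "H u = 0" by simp
qed

text \<open>The constants at infinity come from \<open>G0 0\<close> alone and are minus the first
  moments of \<open>V u\<close>; this is the formula by which the vectors \<open>c\<close> are
  defined.\<close>

lemma asymptotics: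
  assumes "u \<in> ell1_dual s" "u = n_comb a - G0 0 (V u)"
  shows "u - n_comb a - one_comb (\<chi> \<alpha>. - \<langle>n_vec \<alpha>, V u\<rangle>) \<in> ell1 (s - 2)"
proof -
  have "(\<chi> \<alpha>. - \<langle>n_vec \<alpha>, V u\<rangle>) = - (\<chi> \<alpha>. \<langle>n_vec \<alpha>, V u\<rangle>)" by (simp add: vec_eq_iff)
  moreover have "u - n_comb a = - G0 0 (V u)" using assms(2) by (metis diff_diff_eq2 diff_add_cancel minus_diff_eq add_diff_cancel_left' uminus_add_conv_diff diff_minus_eq_add)
  ultimately have "u - n_comb a - one_comb (\<chi> \<alpha>. - \<langle>n_vec \<alpha>, V u\<rangle>) = - (G0 0 (V u) - one_comb (\<chi> \<alpha>. \<langle>n_vec \<alpha>, V u\<rangle>))"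
    by (simp only: one_comb_minus) simp
  then show ?thesis
    using ell1_minus[OF G0_0_asymptotics[OF V_ell1[OF assms(1)] s_bounds(2)]] by (simp only:)
qed

lemma n_comb_one_plus:
  assumes "(n_comb a :: ('v, 'n) state) \<in> one_plus_ell1 (s - 2)"
  shows "a = 0"
proof -
  obtain b where "(n_comb a :: ('v, 'n) state) - one_comb b \<in> ell1 (s - 2)"
    using assms by (rule one_plus_ell1_E)
  then have "(n_comb a :: ('v, 'n) state) + one_comb (- b) \<in> ell1 (s - 2)" by (simp only: one_comb_minus diff_conv_add_uminus)
  then show "a = 0" by (rule n_one_comb_unique) (use s_bounds in simp)
qed

text \<open>Linear growth cannot be compensated by constants and summable functions, so membership
  means \<open>a = 0\<close> in \<open>H_eq_0_iff\<close>, leaving the homogeneous equation.\<close>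

lemma bdd_eigenspace_iff:
  "u \<in> bdd_eigenspace s H \<longleftrightarrow> u \<in> ell1_dual s \<and> u = - G0 0 (V u)"
proof
  assume "u \<in> bdd_eigenspace s H"
  then have u: "u \<in> ell1_dual s" "H u = 0" "u \<in> one_plus_ell1 (s - 2)"
    by (auto simp: bdd_eigenspace_def gen_eigenspace_def)
  obtain a where a: "u = n_comb a - G0 0 (V u)" using H_eq_0_iff[OF u(1)] u(2) by auto
  have "u - n_comb a \<in> one_plus_ell1 (s - 2)" by (rule one_plus_ell1_I[OF asymptotics[OF u(1) a]])
  from csubspaceD(5)[OF csubspace_one_plus_ell1 u(3) this]
  have "(n_comb a :: ('v, 'n) state) \<in> one_plus_ell1 (s - 2)" by simp
  then have "a = 0" by (rule n_comb_one_plus)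
  then show "u \<in> ell1_dual s \<and> u = - G0 0 (V u)" using a u(1) by (simp add: n_comb_zero)
next
  assume u: "u \<in> ell1_dual s \<and> u = - G0 0 (V u)"
  then have e: "u = n_comb 0 - G0 0 (V u)" by (simp add: n_comb_zero)
  have "H u = 0" using H_eq_0_iff[of u] u e by blast
  moreover have "u \<in> one_plus_ell1 (s - 2)"
    using one_plus_ell1_I[OF asymptotics[OF _ e]] u by (simp add: n_comb_zero)
  ultimately show "u \<in> bdd_eigenspace s H" using u by (simp add: bdd_eigenspace_def gen_eigenspace_def)
qed

lemma bdd_eigenspace_asymptotics:
  assumes "u \<in> bdd_eigenspace s H"
  shows "u - one_comb (\<chi> \<alpha>. - \<langle>n_vec \<alpha>, V u\<rangle>) \<in> ell1 (s - 2)"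
  using asymptotics[of u 0] assms by (simp add: n_comb_zero bdd_eigenspace_iff)

lemma one_comb_unique:
  fixes u :: "('v, 'n) state"
  assumes "u - one_comb a \<in> ell1 (s - 2)" "u - one_comb b \<in> ell1 (s - 2)"
  shows "a = b"
proof -
  have "(u - one_comb b) - (u - one_comb a) \<in> ell1 (s - 2)" by (rule ell1_diff[OF assms(2,1)])
  then have "(n_comb 0 :: ('v, 'n) state) + one_comb (a - b) \<in> ell1 (s - 2)" by (simp add: n_comb_zero one_comb_diff)
  from n_one_comb_unique(2)[OF this] show ?thesis using s_bounds by simp
qed

text \<open>Symmetry of \<open>V\<close> and of \<open>G0 0\<close> together with
  \<open>w = - G0 0 (V w)\<close>. The pairing is, up to sign, the product of the slopes of
  \<open>u\<close> with the constants of \<open>w\<close> at infinity, so this is Green's formula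
  with its boundary term at infinity.\<close>

lemma Green:
  assumes u: "u \<in> ell1_dual s" "u = n_comb a - G0 0 (V u)" and w: "w \<in> bdd_eigenspace s H"
  shows "\<langle>V w, n_comb a\<rangle> = 0"
proof -
  have w': "w \<in> ell1_dual s" "w = - G0 0 (V w)" using w by (auto simp: bdd_eigenspace_iff)
  have "\<langle>V w, u\<rangle> = \<langle>w, V u\<rangle>" by (rule V_symmetric[OF w'(1) u(1), symmetric])
  also have "\<dots> = \<langle>- G0 0 (V w), V u\<rangle>" using w'(2) by simp
  also have "\<dots> = - \<langle>V w, G0 0 (V u)\<rangle>"
    by (simp add: pairing_minus_left G0_0_symmetric V_ell1 u(1) w'(1))
  finally have "\<langle>V w, u\<rangle> + \<langle>V w, G0 0 (V u)\<rangle> = 0" by simp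
  moreover have "\<langle>V w, u\<rangle> + \<langle>V w, G0 0 (V u)\<rangle> = \<langle>V w, u + G0 0 (V u)\<rangle>"
    by (rule pairing_add_right[symmetric]; rule pairable_ell1_dual[OF V_ell1[OF w'(1)]])
      (simp_all add: u(1) G0_0_dual V_ell1)
  moreover have "u + G0 0 (V u) = n_comb a" using u(2) by (metis diff_add_cancel)
  ultimately show ?thesis by simp
qed

text \<open>With \<open>u = - G0 0 (v \<phi>)\<close> the equation \<open>M0 \<phi> = 0\<close>
  reads \<open>vs u = U \<phi>\<close>, hence
  \<open>V u = v (U (U \<phi>)) = v \<phi>\<close>.\<close>

lemma eigenfunction_from_kernel:
  assumes "\<phi> \<in> kernel M0"
  shows "- G0 0 (v \<phi>) \<in> bdd_eigenspace s H" "V (- G0 0 (v \<phi>)) = v \<phi>"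
proof -
  let ?u = "- G0 0 (v \<phi>)"
  have g: "G0 0 (v \<phi>) \<in> ell1_dual s" by (rule G0_0_dual[OF Cv(2)])
  have u: "?u \<in> ell1_dual s" by (rule csubspaceD(4)[OF csubspace_ell1_dual g])
  have "U \<phi> = - vs (G0 0 (v \<phi>))" using assms by (simp add: kernel_def M0_apply eq_neg_iff_add_eq_0)
  then have "vs ?u = U \<phi>" by (simp only: adjoint_minus[OF g])
  then show V: "V ?u = v \<phi>" by (simp only: V_factor[OF u] U_U)
  show "?u \<in> bdd_eigenspace s H" using u V by (simp add: bdd_eigenspace_iff)
qed

text \<open>The hypothesis makes \<open>vs f\<close> orthogonal to the kernel of \<open>M0\<close>,
  where the pseudo-inverse is exact. The conclusion means that \<open>f - G0 0 (W f)\<close> solves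
  \<open>w = f - G0 0 (V w)\<close>.\<close>

lemma V_solution_of_orthogonal:
  assumes f: "f \<in> ell1_dual s" and orth: "\<And>u. u \<in> bdd_eigenspace s H \<Longrightarrow> \<langle>V u, f\<rangle> = 0"
  shows "V (f - G0 0 (W f)) = W f"
proof -
  have "vs f \<in> orth_compl (kernel M0)"
    unfolding orth_compl_def
  proof (intro CollectI ballI)
    fix \<phi> assume "\<phi> \<in> kernel M0"
    from eigenfunction_from_kernel[OF this] orth have "\<langle>v \<phi>, f\<rangle> = 0" by metis
    then show "cinner \<phi> (vs f) = 0" by (simp add: pairing_v[OF f])
  qed
  then have "M0 (D (vs f)) = vs f" by (rule M0.pseudo_inverse_exact)
  moreover have "M0 (D (vs f)) = U (D (vs f)) + vs (G0 0 (W f))" by (simp only: M0_apply W_apply)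
  ultimately have eq: "vs f - vs (G0 0 (W f)) = U (D (vs f))" by (metis add_diff_cancel_right')
  have g: "G0 0 (W f) \<in> ell1_dual s" by (rule G0_0_dual[OF W_ell1])
  have "V (f - G0 0 (W f)) = v (U (vs f - vs (G0 0 (W f))))"
    by (simp only: V_factor[OF csubspaceD(5)[OF csubspace_ell1_dual f g]] adjoint_diff[OF f g])
  then show ?thesis by (simp only: eq U_U) (simp only: W_apply)
qed

text \<open>\<open>y = U (vs w)\<close> satisfies \<open>M0 y = vs b\<close>, so it differs from
  \<open>D (vs b)\<close> by an element of the kernel, which corresponds to \<open>u\<close>. Every
  order above the leading one is an instance with its own \<open>b\<close>.\<close>

lemma Lippmann_Schwinger_solution:
  assumes w: "w \<in> ell1_dual s" and b: "b \<in> ell1_dual s" and eq: "w = b - G0 0 (V w)"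
  obtains u where "u \<in> bdd_eigenspace s H" "w = b - G0 0 (W b) + u" "V w = W b + V u"
proof -
  have g: "G0 0 (V w) \<in> ell1_dual s" by (rule G0_0_dual[OF V_ell1[OF w]])
  define y where "y = U (vs w)"
  have vy: "v y = V w" by (simp add: y_def V_factor[OF w])
  have "vs b = vs (w + G0 0 (V w))" using eq by (metis diff_add_cancel)
  also have "\<dots> = M0 y" by (simp only: adjoint_add[OF w g] M0_apply vy) (simp only: y_def U_U)
  finally have b': "vs b = M0 y" .
  then have "M0 (D (vs b)) = vs b" using M0.pseudo_inverse_exact M0.range_orth by metis
  then have q: "y - D (vs b) \<in> kernel M0" by (simp add: kernel_def clinear_onD[OF clinear_M0] b')
  define u where "u = - G0 0 (v (y - D (vs b)))"
  have u: "u \<in> bdd_eigenspace s H" "V u = v (y - D (vs b))"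
    unfolding u_def using eigenfunction_from_kernel[OF q] by auto
  have Vw: "V w = W b + V u" by (simp only: u(2) clinear_onD(5)[OF clinear_v] vy W_apply) simp
  have "w = b - G0 0 (W b + V u)" using eq Vw by simp
  also have "\<dots> = b - G0 0 (W b) + u"
    using G0_0_add[OF W_ell1 Cv(2), of b "y - D (vs b)"] by (simp only: u(2)) (simp add: u_def)
  finally show thesis using that u(1) Vw by blast
qed

end

section \<open>Resonances\<close>

lemma cdot_add_right: "cdot a (b + b') = cdot a b + cdot a b'"
  and cdot_scale_right: "cdot a (x *s b) = x * cdot a b"
  and cdot_zero_right [simp]: "cdot a 0 = 0"
  by (simp_all add: cdot_def distrib_left sum.distrib sum_distrib_left mult.left_commute)

lemma cdot_sum_right: "cdot a (\<Sum>i\<in>I. f i) = (\<Sum>i\<in>I. cdot a (f i))"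
  by (induction I rule: infinite_finite_induct) (simp_all add: cdot_add_right)

lemma orthonormal_systemD:
  "orthonormal_system I c \<Longrightarrow> i \<in> I \<Longrightarrow> j \<in> I \<Longrightarrow> cdot (c i) (c j) = (if i = j then 1 else 0)"
  by (simp add: orthonormal_system_def)

lemma orthonormal_coefficients:
  assumes c: "orthonormal_system I c" and J: "finite J" "J \<subseteq> I" and i: "i \<in> J"
  shows "cdot (c i) (\<Sum>j\<in>J. a j *s c j) = a i"
proof -
  have "cdot (c i) (\<Sum>j\<in>J. a j *s c j) = (\<Sum>j\<in>J. if i = j then a j else 0)"
    unfolding cdot_sum_right cdot_scale_right
  proof (intro sum.cong refl)
    fix j assume "j \<in> J"
    then have "i \<in> I" "j \<in> I" using J(2) i by auto
    then show "a j * cdot (c i) (c j) = (if i = j then a j else 0)" by (simp add: orthonormal_systemD[OF c])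
  qed
  then show ?thesis using J i by simp
qed

text \<open>Index sets are arbitrary, but \<open>sum\<close> over an infinite set is 0 by
  convention; finiteness guarantees that \<open>projection_of\<close> really sums over its index
  set.\<close>

lemma orthonormal_system_finite:
  fixes c :: "'i \<Rightarrow> complex ^ 'n::finite"
  assumes c: "orthonormal_system I c"
  shows "finite I"
proof -
  have inj: "inj_on c I"
  proof (rule inj_onI)
    fix i j assume "i \<in> I" "j \<in> I" "c i = c j"
    then show "i = j"
      using orthonormal_systemD[OF c, of i i] orthonormal_systemD[OF c, of i j] by (auto split: if_splits)
  qed
  have "vec.independent (c ` I)"
    unfolding vec.dependent_explicit
  proof (rule notI, elim exE conjE bexE)
    fix t u x assume t: "finite t" "t \<subseteq> c ` I" "(\<Sum>x\<in>t. u x *s x) = 0" "x \<in> t" "u x \<noteq> 0"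
    define J where "J = {i \<in> I. c i \<in> t}"
    have tJ: "t = c ` J" using t(2) by (auto simp: J_def)
    have injJ: "inj_on c J" by (rule inj_on_subset[OF inj]) (auto simp: J_def)
    have finJ: "finite J" using t(1) tJ finite_image_iff[OF injJ] by simp
    obtain i where i: "i \<in> J" "x = c i" using t(4) tJ by auto
    have "(\<Sum>x\<in>t. u x *s x) = (\<Sum>j\<in>J. u (c j) *s c j)"
      unfolding tJ by (subst sum.reindex[OF injJ]) simp
    then have "cdot (c i) (\<Sum>j\<in>J. u (c j) *s c j) = 0" using t(3) by simp
    then have "u (c i) = 0"
      using orthonormal_coefficients[OF c finJ _ i(1), of "\<lambda>j. u (c j)"] by (auto simp: J_def)
    then show False using t(5) i(2) by simp
  qed
  then have "finite (c ` I)" by (rule vec.finiteI_independent)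
  then show ?thesis by (rule finite_imageD[OF _ inj])
qed

lemma orthonormal_basis_expansion:
  assumes c: "orthonormal_basis I c"
  shows "x = (\<Sum>i\<in>I. cdot (c i) x *s c i)"
proof -
  have o: "orthonormal_system I c" and sp: "x \<in> vec.span (c ` I)" using c by (auto simp: orthonormal_basis_def)
  have fin: "finite I" by (rule orthonormal_system_finite[OF o])
  from sp show ?thesis
  proof (induction rule: vec.span_induct_alt)
    case (step a b y)
    then obtain k where k: "k \<in> I" "b = c k" by auto
    have "(\<Sum>i\<in>I. cdot (c i) (a *s b + y) *s c i) = (\<Sum>i\<in>I. (if i = k then a *s c i else 0) + cdot (c i) y *s c i)"
      by (intro sum.cong refl)
        (use k in \<open>auto simp: cdot_add_right cdot_scale_right orthonormal_systemD[OF o] vec.scale_left_distrib\<close>)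
    also have "\<dots> = a *s b + (\<Sum>i\<in>I. cdot (c i) y *s c i)"
      using fin k by (simp add: sum.distrib)
    finally show ?case using step by simp
  qed simp
qed

text \<open>The complementary vectors have their own index type; the disjoint sum joins both
  systems, so that completeness and mutual orthogonality concern a single family.\<close>

locale resonance = scattering E0 xs \<beta> V v U
  for E0 :: "'v::finite set set" and xs :: "'n::finite \<Rightarrow> 'v" and \<beta> :: nat and V :: "('v, 'n) op"
    and v :: "'k::complex_hilbert \<Rightarrow> ('v, 'n) state" and U :: "'k \<Rightarrow> 'k" +
  fixes \<Gamma> :: "'i set" and \<Psi> :: "'i \<Rightarrow> ('v, 'n) state" and c :: "'i \<Rightarrow> complex ^ 'n"
    and \<Gamma>t :: "'j set" and ct :: "'j \<Rightarrow> complex ^ 'n"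
  assumes no_eigenvalue: "eigenspace s H = {0}"
    and res_basis: "resonance_basis s H \<Gamma> \<Psi>"
    and c_eq: "\<And>\<gamma>. c \<gamma> = (\<chi> \<alpha>. - \<langle>n_vec \<alpha>, V (\<Psi> \<gamma>)\<rangle>)"
    and ct: "orthonormal_basis (\<Gamma> <+> \<Gamma>t) (case_sum c ct)"
begin

abbreviation "P \<equiv> projection_of \<Gamma> \<Psi>"
abbreviation "B \<equiv> bdd_eigenspace s H"

lemma c_ct_orthonormal: "orthonormal_system (\<Gamma> <+> \<Gamma>t) (case_sum c ct)"
  using ct by (simp add: orthonormal_basis_def)

lemma finite_indices: "finite \<Gamma>" "finite \<Gamma>t"
  using finite_PlusD[OF orthonormal_system_finite[OF c_ct_orthonormal]] by auto

lemma c_orthonormal: "i \<in> \<Gamma> \<Longrightarrow> j \<in> \<Gamma> \<Longrightarrow> cdot (c i) (c j) = (if i = j then 1 else 0)"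
  using orthonormal_systemD[OF c_ct_orthonormal InlI InlI] by simp

lemma c_ct_orthogonal: "i \<in> \<Gamma> \<Longrightarrow> j \<in> \<Gamma>t \<Longrightarrow> cdot (c i) (ct j) = 0"
  using orthonormal_systemD[OF c_ct_orthonormal InlI InrI] by simp

lemma ct_orthonormal: "orthonormal_system \<Gamma>t ct"
  unfolding orthonormal_system_def using orthonormal_systemD[OF c_ct_orthonormal InrI InrI] by simp

lemma completeness: "x = (\<Sum>\<gamma>\<in>\<Gamma>. cdot (c \<gamma>) x *s c \<gamma>) + (\<Sum>\<gamma>\<in>\<Gamma>t. cdot (ct \<gamma>) x *s ct \<gamma>)"
  using orthonormal_basis_expansion[OF ct, of x] sum.Plus[OF finite_indices, of "\<lambda>i. cdot (case_sum c ct i) x *s case_sum c ct i"]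
  by simp

lemma B_dual: "u \<in> B \<Longrightarrow> u \<in> ell1_dual s"
  by (simp add: bdd_eigenspace_def gen_eigenspace_def)

lemma csubspace_gen: "csubspace (gen_eigenspace s H)"
  unfolding csubspace_def gen_eigenspace_def
proof (intro conjI ballI allI CollectI)
  show "0 \<in> ell1_dual s" by (rule csubspaceD[OF csubspace_ell1_dual])
  then have "V 0 = 0" using V_scaleC[of 0 0] by simp
  then show "H 0 = 0" by (simp add: clinear_onD[OF clinear_H0])
  fix x y c assume "x \<in> {\<Psi> \<in> ell1_dual s. H \<Psi> = 0}"
  then have x: "x \<in> ell1_dual s" "H x = 0" by auto
  show "c *\<^sub>C x \<in> ell1_dual s" by (rule csubspaceD(3)[OF csubspace_ell1_dual x(1)])
  have "H (c *\<^sub>C x) = c *\<^sub>C H x"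
    by (simp only: H_apply clinear_onD(2)[OF clinear_H0] V_scaleC[OF x(1)] scaleC_add_right)
  then show "H (c *\<^sub>C x) = 0" using x(2) by (simp only: scaleC_zero_right)
  assume "y \<in> {\<Psi> \<in> ell1_dual s. H \<Psi> = 0}"
  then have y: "y \<in> ell1_dual s" "H y = 0" by auto
  show "x + y \<in> ell1_dual s" by (rule csubspaceD(2)[OF csubspace_ell1_dual x(1) y(1)])
  have "H (x + y) = H x + H y"
    by (simp only: H_apply clinear_onD(1)[OF clinear_H0] V_add[OF x(1) y(1)]) (simp add: add_ac)
  then show "H (x + y) = 0" using x(2) y(2) by (simp only: add_0)
qed

lemma csubspace_B: "csubspace B"
  using csubspace_gen csubspace_one_plus_ell1[of "s - 2"]
  unfolding csubspace_def bdd_eigenspace_def by blast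

lemma \<Psi>_B: "\<gamma> \<in> \<Gamma> \<Longrightarrow> \<Psi> \<gamma> \<in> B"
  using res_basis by (simp add: resonance_basis_def quotient_basis_def)

lemmas \<Psi>_dual = B_dual[OF \<Psi>_B]

text \<open>As the eigenspace is \<open>{0}\<close>, the basis of the quotient is a basis of
  \<open>B\<close> itself.\<close>

lemma B_expansion:
  assumes "u \<in> B" obtains a where "u = (\<Sum>\<gamma>\<in>\<Gamma>. a \<gamma> *\<^sub>C \<Psi> \<gamma>)"
proof -
  obtain J a where J: "finite J" "J \<subseteq> \<Gamma>" "u - (\<Sum>i\<in>J. a i *\<^sub>C \<Psi> i) \<in> eigenspace s H"
    using bspec[OF res_basis[unfolded resonance_basis_def quotient_basis_def,
        THEN conjunct1, THEN conjunct2, THEN conjunct2] assms] by (elim exE conjE)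
  then have "u = (\<Sum>i\<in>J. a i *\<^sub>C \<Psi> i)" by (simp add: no_eigenvalue)
  also have "\<dots> = (\<Sum>\<gamma>\<in>\<Gamma>. (if \<gamma> \<in> J then a \<gamma> else 0) *\<^sub>C \<Psi> \<gamma>)"
    by (rule sum.mono_neutral_cong_left[OF finite_indices(1) J(2)]) auto
  finally show thesis by (rule that)
qed

lemma P_apply: "P u = (\<Sum>\<gamma>\<in>\<Gamma>. \<langle>\<Psi> \<gamma>, u\<rangle> *\<^sub>C \<Psi> \<gamma>)"
  by (simp add: projection_of_def sum_fun_apply ketbra_def)

lemma P_B: "P u \<in> B"
  unfolding P_apply by (intro csubspace_sum[OF csubspace_B] csubspaceD(3)[OF csubspace_B] \<Psi>_B)

lemmas P_dual = B_dual[OF P_B]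

text \<open>Moving \<open>V\<close> to the resonance functions lets \<open>P V\<close> be computed
  on growing functions, whose pairing with \<open>\<Psi> \<gamma>\<close> itself need not
  converge.\<close>

lemma PV_apply: "u \<in> ell1_dual s \<Longrightarrow> P (V u) = (\<Sum>\<gamma>\<in>\<Gamma>. \<langle>V (\<Psi> \<gamma>), u\<rangle> *\<^sub>C \<Psi> \<gamma>)"
  unfolding P_apply by (intro sum.cong refl) (simp add: V_symmetric \<Psi>_dual)

lemma VP_apply: "V (P u) = (\<Sum>\<gamma>\<in>\<Gamma>. \<langle>\<Psi> \<gamma>, u\<rangle> *\<^sub>C V (\<Psi> \<gamma>))"
  unfolding P_apply by (simp add: V_sum V_scaleC csubspaceD(3)[OF csubspace_ell1_dual] \<Psi>_dual)

lemma pairing_V_n_comb: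
  assumes "u \<in> ell1_dual s"
  shows "\<langle>V u, n_comb a\<rangle> = - cdot (\<chi> \<alpha>. - \<langle>n_vec \<alpha>, V u\<rangle>) a"
proof -
  have "V u \<in> ell1 1" by (rule ell1_mono(1)[OF V_ell1[OF assms] s_bounds(1)])
  then have "\<langle>V u, n_comb a\<rangle> = cnj (\<Sum>\<alpha>\<in>UNIV. cnj (a $ \<alpha>) * \<langle>n_vec \<alpha>, V u\<rangle>)"
    unfolding pairing_commute[of "V u" "n_comb a"] by (simp only: pairing_n_comb_left)
  then show ?thesis by (simp add: cdot_def mult.commute sum_negf)
qed

lemma pairing_V\<Psi>_n_comb: "\<gamma> \<in> \<Gamma> \<Longrightarrow> \<langle>V (\<Psi> \<gamma>), n_comb a\<rangle> = - cdot (c \<gamma>) a"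
  unfolding c_eq by (rule pairing_V_n_comb[OF \<Psi>_dual])

lemma gen_representation:
  assumes "u \<in> gen_eigenspace s H"
  obtains a where "u = n_comb a - G0 0 (V u)" "u - n_comb a \<in> one_plus_ell1 (s - 2)"
    "\<And>w. w \<in> B \<Longrightarrow> \<langle>V w, n_comb a\<rangle> = 0"
proof -
  have u: "u \<in> ell1_dual s" "H u = 0" using assms by (auto simp: gen_eigenspace_def)
  then obtain a where a: "u = n_comb a - G0 0 (V u)" using H_eq_0_iff by blast
  show thesis
    by (rule that[OF a one_plus_ell1_I[OF asymptotics[OF u(1) a]] Green[OF u(1) a]])
qed

text \<open>This makes the slope a complete invariant of a class modulo \<open>B\<close>.\<close>

lemma gen_minus_n_comb_B:
  assumes u: "u \<in> gen_eigenspace s H" and a: "u - n_comb a \<in> one_plus_ell1 (s - 2)"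
    and w: "w \<in> gen_eigenspace s H" "w - n_comb a \<in> one_plus_ell1 (s - 2)"
  shows "u - w \<in> B"
proof -
  have "u - w \<in> gen_eigenspace s H" by (rule csubspaceD(5)[OF csubspace_gen u w(1)])
  moreover have "(u - n_comb a) - (w - n_comb a) \<in> one_plus_ell1 (s - 2)"
    by (rule csubspaceD(5)[OF csubspace_one_plus_ell1 a w(2)])
  then have "u - w \<in> one_plus_ell1 (s - 2)" by simp
  ultimately show ?thesis by (simp add: bdd_eigenspace_def)
qed

text \<open>Slopes and constants are determined by the functions, so the given \<open>a\<close> and
  \<open>b\<close> coincide with those in the Green identity.\<close>

lemma coefficients_orthogonal:
  assumes u: "u \<in> gen_eigenspace s H" and w: "w \<in> B"
    and a: "u - n_comb a \<in> one_plus_ell1 (s - 2)" and b: "w - one_comb b \<in> ell1 (s - 2)"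
  shows "cdot b a = 0"
proof -
  obtain a' where a': "u - n_comb a' \<in> one_plus_ell1 (s - 2)" "\<And>w. w \<in> B \<Longrightarrow> \<langle>V w, n_comb a'\<rangle> = 0"
    by (rule gen_representation[OF u]) blast
  have "(u - n_comb a') - (u - n_comb a) \<in> one_plus_ell1 (s - 2)"
    by (rule csubspaceD(5)[OF csubspace_one_plus_ell1 a'(1) a])
  then have "(n_comb (a - a') :: ('v, 'n) state) \<in> one_plus_ell1 (s - 2)" by (simp add: n_comb_diff)
  then have "a' = a" using n_comb_one_plus by fastforce
  moreover have "b = (\<chi> \<alpha>. - \<langle>n_vec \<alpha>, V w\<rangle>)"
    by (rule one_comb_unique[OF b bdd_eigenspace_asymptotics[OF w]])
  ultimately show ?thesis using a'(2)[OF w] pairing_V_n_comb[OF B_dual[OF w], of a] by simp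
qed

text \<open>The last summand, with values in \<open>B\<close>, is the correction that the
  solvability condition of the following order imposes on the solution
  \<open>u - G0 0 (W u)\<close>.\<close>

definition T :: "('v, 'n) op" where
  "T = id - (G0 0 - P \<odot> V \<odot> G0 1) \<odot> W"

definition \<Psi>t :: "'j \<Rightarrow> ('v, 'n) state" where
  "\<Psi>t \<gamma> = T (n_comb (ct \<gamma>))"

lemma T_apply: "T u = u - G0 0 (W u) + P (V (G0 1 (W u)))"
  by (simp add: T_def fun_eq_iff)

text \<open>Orthogonality of \<open>ct \<gamma>\<close> to all \<open>c\<close> is the solvability
  condition for \<open>n_comb (ct \<gamma>)\<close>, so \<open>?f\<close> is a generalised
  eigenfunction. The extra term of \<open>T\<close> lies in \<open>B\<close> and changes neither
  membership nor slope.\<close>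

lemma \<Psi>t_properties:
  assumes "\<gamma> \<in> \<Gamma>t"
  shows "\<Psi>t \<gamma> \<in> gen_eigenspace s H" "\<Psi>t \<gamma> - n_comb (ct \<gamma>) \<in> one_plus_ell1 (s - 2)"
proof -
  let ?n = "n_comb (ct \<gamma>) :: ('v, 'n) state"
  let ?f = "?n - G0 0 (W ?n)"
  have "\<langle>V u, ?n\<rangle> = 0" if uB: "u \<in> B" for u
  proof -
    obtain a where u: "u = (\<Sum>\<gamma>\<in>\<Gamma>. a \<gamma> *\<^sub>C \<Psi> \<gamma>)" by (rule B_expansion[OF uB])
    have Vu: "V u = (\<Sum>\<gamma>\<in>\<Gamma>. a \<gamma> *\<^sub>C V (\<Psi> \<gamma>))"
      unfolding u by (simp add: V_sum V_scaleC csubspaceD(3)[OF csubspace_ell1_dual] \<Psi>_dual)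
    have "\<langle>V u, ?n\<rangle> = (\<Sum>\<gamma>\<in>\<Gamma>. \<langle>a \<gamma> *\<^sub>C V (\<Psi> \<gamma>), ?n\<rangle>)"
      unfolding Vu by (rule pairing_sum_left, rule pairable_ell1_dual[OF csubspaceD(3)[OF csubspace_ell1 V_ell1] n_comb_dual_s])
        (rule \<Psi>_dual)
    then show ?thesis
      by (simp add: pairing_scaleC_left pairing_V\<Psi>_n_comb c_ct_orthogonal[OF _ assms])
  qed
  from V_solution_of_orthogonal[OF n_comb_dual_s this] have Vf: "V ?f = W ?n" .
  have f: "?f \<in> ell1_dual s" by (rule csubspaceD(5)[OF csubspace_ell1_dual n_comb_dual_s G0_0_dual[OF W_ell1]])
  have fe: "?f = n_comb (ct \<gamma>) - G0 0 (V ?f)" by (simp only: Vf)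
  then have "H ?f = 0" using H_eq_0_iff[OF f] by blast
  then have fg: "?f \<in> gen_eigenspace s H" using f by (simp add: gen_eigenspace_def)
  have p: "P (V (G0 1 (W ?n))) \<in> gen_eigenspace s H" "P (V (G0 1 (W ?n))) \<in> one_plus_ell1 (s - 2)"
    using P_B[of "V (G0 1 (W ?n))"] by (auto simp: bdd_eigenspace_def)
  show "\<Psi>t \<gamma> \<in> gen_eigenspace s H"
    unfolding \<Psi>t_def T_apply by (rule csubspaceD(2)[OF csubspace_gen fg p(1)])
  have "?f - ?n \<in> one_plus_ell1 (s - 2)" by (rule one_plus_ell1_I[OF asymptotics[OF f fe]])
  from csubspaceD(2)[OF csubspace_one_plus_ell1 this p(2)]
  show "\<Psi>t \<gamma> - ?n \<in> one_plus_ell1 (s - 2)" unfolding \<Psi>t_def T_apply by (simp add: algebra_simps)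
qed

lemma \<Psi>t_sum:
  assumes "J \<subseteq> \<Gamma>t"
  shows "(\<Sum>i\<in>J. a i *\<^sub>C \<Psi>t i) \<in> gen_eigenspace s H"
    "(\<Sum>i\<in>J. a i *\<^sub>C \<Psi>t i) - n_comb (\<Sum>i\<in>J. a i *s ct i) \<in> one_plus_ell1 (s - 2)"
proof -
  show "(\<Sum>i\<in>J. a i *\<^sub>C \<Psi>t i) \<in> gen_eigenspace s H"
    using assms by (intro csubspace_sum[OF csubspace_gen] csubspaceD(3)[OF csubspace_gen] \<Psi>t_properties) auto
  have eq: "(\<Sum>i\<in>J. a i *\<^sub>C \<Psi>t i) - n_comb (\<Sum>i\<in>J. a i *s ct i) = (\<Sum>i\<in>J. a i *\<^sub>C (\<Psi>t i - n_comb (ct i)))"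
    by (simp only: n_comb_sum n_comb_scale scaleC_diff_right sum_subtractf)
  show "(\<Sum>i\<in>J. a i *\<^sub>C \<Psi>t i) - n_comb (\<Sum>i\<in>J. a i *s ct i) \<in> one_plus_ell1 (s - 2)"
    unfolding eq using assms
    by (intro csubspace_sum[OF csubspace_one_plus_ell1] csubspaceD(3)[OF csubspace_one_plus_ell1] \<Psi>t_properties(2)) auto
qed

text \<open>Modulo \<open>B\<close> a generalised eigenfunction is determined by its slopes; by the
  Green identity these are orthogonal to all \<open>c \<gamma>\<close>, hence combinations of the
  \<open>ct \<gamma>\<close>, which are the slopes of the \<open>\<Psi>t \<gamma>\<close>.\<close>

theorem nonresonance_basis_\<Psi>t: "nonresonance_basis s H \<Gamma>t \<Psi>t"
  unfolding nonresonance_basis_def quotient_basis_def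
proof (intro conjI ballI allI impI)
  fix i assume "i \<in> \<Gamma>t"
  then show "\<Psi>t i \<in> gen_eigenspace s H" by (rule \<Psi>t_properties)
next
  fix J a j assume J: "finite J" "J \<subseteq> \<Gamma>t" "(\<Sum>i\<in>J. a i *\<^sub>C \<Psi>t i) \<in> B" "j \<in> J"
  then have "(\<Sum>i\<in>J. a i *\<^sub>C \<Psi>t i) \<in> one_plus_ell1 (s - 2)" by (simp add: bdd_eigenspace_def)
  from csubspaceD(5)[OF csubspace_one_plus_ell1 this \<Psi>t_sum(2)[OF J(2), of a]]
  have "(n_comb (\<Sum>i\<in>J. a i *s ct i) :: ('v, 'n) state) \<in> one_plus_ell1 (s - 2)" by simp
  then have "(\<Sum>i\<in>J. a i *s ct i) = 0" by (rule n_comb_one_plus)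
  then show "a j = 0" using orthonormal_coefficients[OF ct_orthonormal J(1,2,4), of a] by simp
next
  fix \<Phi> assume \<Phi>: "\<Phi> \<in> gen_eigenspace s H"
  obtain a where a: "\<Phi> - n_comb a \<in> one_plus_ell1 (s - 2)" "\<And>w. w \<in> B \<Longrightarrow> \<langle>V w, n_comb a\<rangle> = 0"
    by (rule gen_representation[OF \<Phi>]) blast
  have "cdot (c \<gamma>) a = 0" if "\<gamma> \<in> \<Gamma>" for \<gamma>
    using a(2)[OF \<Psi>_B[OF that]] pairing_V\<Psi>_n_comb[OF that] by simp
  then have a': "(\<Sum>i\<in>\<Gamma>t. cdot (ct i) a *s ct i) = a" using completeness[of a] by simp
  have "\<Phi> - (\<Sum>i\<in>\<Gamma>t. cdot (ct i) a *\<^sub>C \<Psi>t i) \<in> B"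
    by (rule gen_minus_n_comb_B[OF \<Phi> a(1) \<Psi>t_sum(1)[OF order_refl]])
      (use \<Psi>t_sum(2)[OF order_refl, of "\<lambda>i. cdot (ct i) a"] a' in simp)
  then show "\<exists>J a. finite J \<and> J \<subseteq> \<Gamma>t \<and> \<Phi> - (\<Sum>i\<in>J. a i *\<^sub>C \<Psi>t i) \<in> B"
    by (intro exI[of _ \<Gamma>t] exI[of _ "\<lambda>i. cdot (ct i) a"] conjI finite_indices order_refl)
next
  fix i \<Phi> assume "\<Phi> \<in> eigenspace s H"
  then have "\<Phi> = 0" by (simp add: no_eigenvalue)
  then show "(cnj \<circ> \<Phi>) * \<Psi>t i \<in> ell1 0" "\<langle>\<Phi>, \<Psi>t i\<rangle> = 0"
    by (simp_all add: ell1_def)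
next
  show "\<exists>c. orthonormal_system \<Gamma>t c \<and> (\<forall>i\<in>\<Gamma>t. \<Psi>t i - n_comb (c i) \<in> one_plus_ell1 (s - 2))"
    using ct_orthonormal \<Psi>t_properties(2) by blast
qed

end

section \<open>Comparing coefficients\<close>

abbreviation right_filter :: "complex filter" where
  "right_filter \<equiv> at 0 within {\<kappa>. 0 < Re \<kappa>}"

lemma right_filter_nontrivial: "right_filter \<noteq> bot"
proof -
  have "(0::complex) islimpt {\<kappa>. 0 < Re \<kappa>}"
    unfolding islimpt_approachable
  proof (intro allI impI)
    fix e :: real assume "0 < e"
    then show "\<exists>x'\<in>{\<kappa>. 0 < Re \<kappa>}. x' \<noteq> 0 \<and> dist x' 0 < e"
      by (intro bexI[of _ "complex_of_real (e / 2)"]) auto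
  qed
  then show ?thesis by (simp add: trivial_limit_within)
qed

lemma eventually_right_small:
  assumes "0 < d" shows "\<forall>\<^sub>F \<kappa> in right_filter. 0 < Re \<kappa> \<and> cmod \<kappa> < d"
  using assms by (auto simp: eventually_at intro!: exI[of _ d])

definition vanishes_to_order :: "nat \<Rightarrow> (complex \<Rightarrow> complex) \<Rightarrow> bool" where
  "vanishes_to_order n h \<longleftrightarrow> (\<exists>C. \<forall>\<^sub>F \<kappa> in right_filter. cmod (h \<kappa>) \<le> C * cmod \<kappa> ^ n)"

lemma vanishes_to_orderI:
  "(\<forall>\<^sub>F \<kappa> in right_filter. cmod (h \<kappa>) \<le> C * cmod \<kappa> ^ n) \<Longrightarrow> vanishes_to_order n h"
  unfolding vanishes_to_order_def by blast

lemma vanishes_cong: "vanishes_to_order n h \<Longrightarrow> (\<And>\<kappa>. h \<kappa> = k \<kappa>) \<Longrightarrow> vanishes_to_order n k"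
  by (simp add: vanishes_to_order_def)

lemma vanishes_0 [simp]: "vanishes_to_order n (\<lambda>_. 0)"
  by (rule vanishes_to_orderI[of _ 0]) simp

lemma vanishes_add:
  assumes "vanishes_to_order n h" "vanishes_to_order n k"
  shows "vanishes_to_order n (\<lambda>\<kappa>. h \<kappa> + k \<kappa>)"
proof -
  obtain C D where *: "\<forall>\<^sub>F \<kappa> in right_filter. cmod (h \<kappa>) \<le> C * cmod \<kappa> ^ n"
    "\<forall>\<^sub>F \<kappa> in right_filter. cmod (k \<kappa>) \<le> D * cmod \<kappa> ^ n"
    using assms unfolding vanishes_to_order_def by blast
  show ?thesis
  proof (rule vanishes_to_orderI, rule eventually_mono[OF eventually_conj[OF *]])
    fix \<kappa> assume "cmod (h \<kappa>) \<le> C * cmod \<kappa> ^ n \<and> cmod (k \<kappa>) \<le> D * cmod \<kappa> ^ n"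
    then show "cmod (h \<kappa> + k \<kappa>) \<le> (C + D) * cmod \<kappa> ^ n"
      using norm_triangle_ineq[of "h \<kappa>" "k \<kappa>"] by (simp add: distrib_right)
  qed
qed

lemma vanishes_minus: "vanishes_to_order n h \<Longrightarrow> vanishes_to_order n (\<lambda>\<kappa>. - h \<kappa>)"
  by (simp add: vanishes_to_order_def)

lemma vanishes_diff:
  "vanishes_to_order n h \<Longrightarrow> vanishes_to_order n k \<Longrightarrow> vanishes_to_order n (\<lambda>\<kappa>. h \<kappa> - k \<kappa>)"
  using vanishes_add[OF _ vanishes_minus, of n h k] by simp

lemma vanishes_sum:
  "(\<And>i. i \<in> I \<Longrightarrow> vanishes_to_order n (h i)) \<Longrightarrow> vanishes_to_order n (\<lambda>\<kappa>. \<Sum>i\<in>I. h i \<kappa>)"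
  by (induction I rule: infinite_finite_induct) (simp_all add: vanishes_add)

lemma vanishes_power_mult:
  assumes "vanishes_to_order n h" shows "vanishes_to_order (m + n) (\<lambda>\<kappa>. \<kappa> ^ m * h \<kappa>)"
proof -
  obtain C where *: "\<forall>\<^sub>F \<kappa> in right_filter. cmod (h \<kappa>) \<le> C * cmod \<kappa> ^ n"
    using assms unfolding vanishes_to_order_def by blast
  show ?thesis
  proof (rule vanishes_to_orderI, rule eventually_mono[OF *])
    fix \<kappa> assume "cmod (h \<kappa>) \<le> C * cmod \<kappa> ^ n"
    from mult_left_mono[OF this, of "cmod \<kappa> ^ m"]
    show "cmod (\<kappa> ^ m * h \<kappa>) \<le> C * cmod \<kappa> ^ (m + n)" by (simp add: norm_mult norm_power power_add mult_ac)
  qed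
qed

lemma vanishes_mono:
  assumes "vanishes_to_order n h" "m \<le> n" shows "vanishes_to_order m h"
proof -
  obtain C where *: "\<forall>\<^sub>F \<kappa> in right_filter. cmod (h \<kappa>) \<le> C * cmod \<kappa> ^ n"
    using assms(1) unfolding vanishes_to_order_def by blast
  show ?thesis
  proof (rule vanishes_to_orderI, rule eventually_mono[OF eventually_conj[OF * eventually_right_small[of 1]]])
    fix \<kappa> assume a: "cmod (h \<kappa>) \<le> C * cmod \<kappa> ^ n \<and> 0 < Re \<kappa> \<and> cmod \<kappa> < 1"
    then have "cmod (h \<kappa>) \<le> \<bar>C\<bar> * cmod \<kappa> ^ n" using mult_right_mono[OF abs_ge_self[of C], of "cmod \<kappa> ^ n"] by simp
    also have "\<dots> \<le> \<bar>C\<bar> * cmod \<kappa> ^ m" using a assms(2) by (intro mult_left_mono power_decreasing) auto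
    finally show "cmod (h \<kappa>) \<le> \<bar>C\<bar> * cmod \<kappa> ^ m" .
  qed simp
qed

lemma vanishes_monomial: "n \<le> m \<Longrightarrow> vanishes_to_order n (\<lambda>\<kappa>. \<kappa> ^ m * a)"
proof -
  have "vanishes_to_order 0 (\<lambda>\<kappa>. a)" by (rule vanishes_to_orderI[of _ "cmod a"]) simp
  from vanishes_power_mult[OF this, of m] show "n \<le> m \<Longrightarrow> vanishes_to_order n (\<lambda>\<kappa>. \<kappa> ^ m * a)"
    using vanishes_mono by simp
qed

text \<open>A bound of order \<open>n + 1\<close> implies one of order \<open>n\<close>, so by
  induction all coefficients below the top one vanish; dividing by \<open>\<kappa>^n\<close> gives
  the top one in the limit.\<close>

lemma vanishing_polynomial:
  assumes "vanishes_to_order n (\<lambda>\<kappa>. \<Sum>i<n. \<kappa> ^ i * a i)" "i < n"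
  shows "a i = 0"
  using assms
proof (induction n arbitrary: i)
  case (Suc n)
  have "vanishes_to_order n (\<lambda>\<kappa>. (\<Sum>i<Suc n. \<kappa> ^ i * a i) - \<kappa> ^ n * a n)"
    by (rule vanishes_diff[OF vanishes_mono[OF Suc.prems(1)] vanishes_monomial]) auto
  then have *: "a i = 0" if "i < n" for i using Suc.IH that by simp
  then have "vanishes_to_order (Suc n) (\<lambda>\<kappa>. \<kappa> ^ n * a n)" using Suc.prems(1) by simp
  then obtain C where C: "\<forall>\<^sub>F \<kappa> in right_filter. cmod (\<kappa> ^ n * a n) \<le> C * cmod \<kappa> ^ Suc n"
    unfolding vanishes_to_order_def by blast
  have "\<forall>\<^sub>F \<kappa> in right_filter. cmod (a n) \<le> C * cmod \<kappa>"
  proof (rule eventually_mono[OF eventually_conj[OF C eventually_right_small[of 1]]])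
    fix \<kappa> assume k: "cmod (\<kappa> ^ n * a n) \<le> C * cmod \<kappa> ^ Suc n \<and> 0 < Re \<kappa> \<and> cmod \<kappa> < 1"
    then have "\<kappa> \<noteq> 0" by auto
    then have "0 < cmod \<kappa> ^ n" by simp
    moreover have "cmod \<kappa> ^ n * cmod (a n) \<le> cmod \<kappa> ^ n * (C * cmod \<kappa>)"
      using k by (simp add: norm_mult norm_power mult_ac)
    ultimately show "cmod (a n) \<le> C * cmod \<kappa>" by (rule mult_left_le_imp_le[rotated])
  qed simp
  moreover have "((\<lambda>\<kappa>. C * cmod \<kappa>) \<longlongrightarrow> C * cmod 0) right_filter" by (intro tendsto_intros)
  ultimately have "cmod (a n) \<le> C * cmod 0"
    by (intro tendsto_lowerbound[OF _ _ right_filter_nontrivial])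
  then have "a n = 0" by simp
  then show ?case using * Suc.prems(2) by (cases "i = n") auto
qed simp

text \<open>After multiplying out, terms with \<open>i + j \<ge> n\<close> are negligible monomials
  and the others are collected by degree. The condition stays inside the double sum, to be evaluated
  once \<open>J\<close> and \<open>I\<close> are numerals.\<close>

lemma compare_coefficients:
  assumes "vanishes_to_order n (\<lambda>\<kappa>. (\<Sum>j<J. \<kappa> ^ j * (\<Sum>i<I. \<kappa> ^ i * c j i)) - (\<Sum>p<n. \<kappa> ^ p * d p))" "p < n"
  shows "(\<Sum>j<J. \<Sum>i<I. if i + j = p then c j i else 0) = d p"
proof -
  let ?e = "\<lambda>p. \<Sum>j<J. \<Sum>i<I. if i + j = p then c j i else 0"
  have "vanishes_to_order n (\<lambda>\<kappa>. \<Sum>j<J. \<Sum>i<I. \<kappa> ^ j * (\<kappa> ^ i * c j i) - (\<Sum>p<n. \<kappa> ^ p * (if i + j = p then c j i else 0)))"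
  proof (intro vanishes_sum)
    fix j i
    have "(\<Sum>p<n. \<kappa> ^ p * (if i + j = p then c j i else 0)) = (if i + j < n then \<kappa> ^ (i + j) * c j i else 0)" for \<kappa>
    proof -
      have "(\<Sum>p<n. \<kappa> ^ p * (if i + j = p then c j i else 0)) = (\<Sum>p<n. if i + j = p then \<kappa> ^ p * c j i else 0)"
        by (intro sum.cong) auto
      then show ?thesis by simp
    qed
    then have "(\<lambda>\<kappa>. \<kappa> ^ j * (\<kappa> ^ i * c j i) - (\<Sum>p<n. \<kappa> ^ p * (if i + j = p then c j i else 0)))
        = (\<lambda>\<kappa>. if i + j < n then 0 else \<kappa> ^ (i + j) * c j i)"
      by (auto simp: fun_eq_iff power_add)
    then show "vanishes_to_order n (\<lambda>\<kappa>. \<kappa> ^ j * (\<kappa> ^ i * c j i) - (\<Sum>p<n. \<kappa> ^ p * (if i + j = p then c j i else 0)))"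
      using vanishes_monomial[of n "i + j" "c j i"] by (cases "i + j < n") simp_all
  qed
  from vanishes_diff[OF assms(1) this]
  have "vanishes_to_order n (\<lambda>\<kappa>. \<Sum>p<n. \<kappa> ^ p * (?e p - d p))"
  proof (rule vanishes_cong)
    fix \<kappa>
    have "(\<Sum>p<n. \<kappa> ^ p * ?e p) = (\<Sum>p<n. \<Sum>j<J. \<Sum>i<I. \<kappa> ^ p * (if i + j = p then c j i else 0))"
      by (simp only: sum_distrib_left)
    also have "\<dots> = (\<Sum>j<J. \<Sum>p<n. \<Sum>i<I. \<kappa> ^ p * (if i + j = p then c j i else 0))"
      by (rule sum.swap)
    also have "\<dots> = (\<Sum>j<J. \<Sum>i<I. \<Sum>p<n. \<kappa> ^ p * (if i + j = p then c j i else 0))"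
      by (intro sum.cong refl sum.swap)
    finally show "(\<Sum>j<J. \<kappa> ^ j * (\<Sum>i<I. \<kappa> ^ i * c j i)) - (\<Sum>p<n. \<kappa> ^ p * d p)
        - (\<Sum>j<J. \<Sum>i<I. \<kappa> ^ j * (\<kappa> ^ i * c j i) - (\<Sum>p<n. \<kappa> ^ p * (if i + j = p then c j i else 0)))
        = (\<Sum>p<n. \<kappa> ^ p * (?e p - d p))"
      by (simp only: right_diff_distrib sum_subtractf sum_distrib_left) simp
  qed
  from vanishing_polynomial[OF this assms(2)] show ?thesis by simp
qed

section \<open>The expansion of the resolvent\<close>

text \<open>The coefficient of order 0 occurs from \<open>\<beta> = 4\<close> on, and then
  \<open>G0 0\<close> to \<open>G0 3\<close> all map \<open>ell1 (\<beta> - 1)\<close> into its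
  dual.\<close>

locale resonance4 = resonance E0 xs \<beta> V v U \<Gamma> \<Psi> c \<Gamma>t ct
  for E0 :: "'v::finite set set" and xs :: "'n::finite \<Rightarrow> 'v" and \<beta> :: nat and V :: "('v, 'n) op"
    and v :: "'k::complex_hilbert \<Rightarrow> ('v, 'n) state" and U :: "'k \<Rightarrow> 'k"
    and \<Gamma> :: "'i set" and \<Psi> :: "'i \<Rightarrow> ('v, 'n) state" and c :: "'i \<Rightarrow> complex ^ 'n"
    and \<Gamma>t :: "'j set" and ct :: "'j \<Rightarrow> complex ^ 'n" +
  assumes beta4: "4 \<le> \<beta>"
begin

abbreviation L :: "('v, 'n) state set" where
  "L \<equiv> ell1 (s - 1)"

lemma G0_kernel:
  assumes "j \<le> 3"
  obtains C where "\<And>t. real (max 1 j) \<le> t \<Longrightarrow> kernel_operator (G0 j) (free_kernel j) t C"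
    "kernel_operator (G0 j) (free_kernel j) (s - 1) C"
proof -
  obtain C where C: "\<And>t. real (max 1 j) \<le> t \<Longrightarrow> kernel_operator (G0 j) (free_kernel j) t C"
    by (rule free_coeff_kernel[of j]) auto
  moreover have "real (max 1 j) \<le> s - 1" using assms beta4 by auto
  ultimately show thesis using that by blast
qed

lemma
  assumes j: "j \<le> 3"
  shows G_dual: "x \<in> L \<Longrightarrow> G0 j x \<in> ell1_dual (s - 1)"
    and G_add: "x \<in> L \<Longrightarrow> y \<in> L \<Longrightarrow> G0 j (x + y) = G0 j x + G0 j y"
    and G_scaleC: "x \<in> L \<Longrightarrow> G0 j (a *\<^sub>C x) = a *\<^sub>C G0 j x"
    and G_minus: "x \<in> L \<Longrightarrow> G0 j (- x) = - G0 j x"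
    and G_diff: "x \<in> L \<Longrightarrow> y \<in> L \<Longrightarrow> G0 j (x - y) = G0 j x - G0 j y"
    and G_sum: "(\<And>i. i \<in> I \<Longrightarrow> q i \<in> L) \<Longrightarrow> G0 j (\<Sum>i\<in>I. q i) = (\<Sum>i\<in>I. G0 j (q i))"
    and G_symmetric: "x \<in> L \<Longrightarrow> y \<in> L \<Longrightarrow> \<langle>G0 j x, y\<rangle> = \<langle>x, G0 j y\<rangle>"
proof -
  obtain C where C: "\<And>t. real (max 1 j) \<le> t \<Longrightarrow> kernel_operator (G0 j) (free_kernel j) t C"
    and "kernel_operator (G0 j) (free_kernel j) (s - 1) C" by (rule G0_kernel[OF j]) blast
  then interpret kernel_operator "G0 j" "free_kernel j" "s - 1" C by simp
  show "x \<in> L \<Longrightarrow> G0 j x \<in> ell1_dual (s - 1)" by (rule apply_dual)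
  show "x \<in> L \<Longrightarrow> y \<in> L \<Longrightarrow> G0 j (x + y) = G0 j x + G0 j y" by (rule apply_add)
  show "x \<in> L \<Longrightarrow> G0 j (a *\<^sub>C x) = a *\<^sub>C G0 j x" by (rule apply_scaleC)
  show "x \<in> L \<Longrightarrow> G0 j (- x) = - G0 j x" by (rule apply_minus)
  show "x \<in> L \<Longrightarrow> y \<in> L \<Longrightarrow> G0 j (x - y) = G0 j x - G0 j y" by (rule apply_diff)
  show "(\<And>i. i \<in> I \<Longrightarrow> q i \<in> L) \<Longrightarrow> G0 j (\<Sum>i\<in>I. q i) = (\<Sum>i\<in>I. G0 j (q i))" by (rule apply_sum)
  show "x \<in> L \<Longrightarrow> y \<in> L \<Longrightarrow> \<langle>G0 j x, y\<rangle> = \<langle>x, G0 j y\<rangle>" by (rule symmetric)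
qed

lemma dual_mono: "x \<in> ell1_dual (s - 1) \<Longrightarrow> x \<in> ell1_dual s"
  by (rule ell1_dual_mono) auto

lemma L_from_ell1: "x \<in> ell1 s \<Longrightarrow> x \<in> L"
  by (rule ell1_mono(1)) auto

lemma V_L: "x \<in> ell1_dual s \<Longrightarrow> V x \<in> L"
  by (rule L_from_ell1[OF V_ell1])

lemma W_L: "W x \<in> L"
  by (rule L_from_ell1[OF W_ell1])

text \<open>Constants plus a summable remainder. Boundedness lets resonance functions be paired with
  every element of \<open>L\<close>.\<close>

lemma B_bounded: "u \<in> B \<Longrightarrow> u \<in> ell1_dual 0"
proof -
  assume u: "u \<in> B"
  let ?o = "one_comb (\<chi> \<alpha>. - \<langle>n_vec \<alpha>, V u\<rangle>) :: ('v, 'n) state"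
  have "u - ?o \<in> ell1_dual 0"
    by (rule ell1_subset_dual[OF bdd_eigenspace_asymptotics[OF u]]) (use s_bounds in auto)
  from csubspaceD(2)[OF csubspace_ell1_dual this one_comb_dual[of "\<chi> \<alpha>. - \<langle>n_vec \<alpha>, V u\<rangle>"]]
  show "u \<in> ell1_dual 0" by simp
qed

lemma pairable_B_L: "u \<in> B \<Longrightarrow> x \<in> L \<Longrightarrow> pairable u x"
  by (rule pairable_dual_ell1[OF B_bounded ell1_mono(1)]) (use beta4 in auto)

end

text \<open>\<open>J\<close> free terms are used and \<open>m = J - 1\<close> coefficients of
  \<open>\<kappa> w\<close> are given, \<open>a i\<close> belonging to the power
  \<open>i - 1\<close> in \<open>w\<close> itself. The pair (3, 2) yields the coefficient of order
  0, the pair (4, 3) that of order 1.\<close>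

locale resolvent_family = resonance4 E0 xs \<beta> V v U \<Gamma> \<Psi> c \<Gamma>t ct
  for E0 :: "'v::finite set set" and xs :: "'n::finite \<Rightarrow> 'v" and \<beta> :: nat and V :: "('v, 'n) op"
    and v :: "'k::complex_hilbert \<Rightarrow> ('v, 'n) state" and U :: "'k \<Rightarrow> 'k"
    and \<Gamma> :: "'i set" and \<Psi> :: "'i \<Rightarrow> ('v, 'n) state" and c :: "'i \<Rightarrow> complex ^ 'n"
    and \<Gamma>t :: "'j set" and ct :: "'j \<Rightarrow> complex ^ 'n" +
  fixes u :: "('v, 'n) state" and w :: "complex \<Rightarrow> ('v, 'n) state" and a :: "nat \<Rightarrow> ('v, 'n) state" and J m :: nat
  assumes J: "J = 3 \<or> J = 4" and J_beta: "J + 1 \<le> \<beta>" and m: "J = Suc m"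
    and u: "u \<in> ell1 (real \<beta> - 1)"
    and w_equation: "\<forall>\<^sub>F \<kappa> in right_filter. w \<kappa> \<in> ell2 \<and> (free_ham E0 xs + V) (w \<kappa>) + \<kappa>\<^sup>2 *\<^sub>C w \<kappa> = u"
    and a_dual: "\<And>i. i < m \<Longrightarrow> a i \<in> ell1_dual (real \<beta> - 1)"
    and w_expansion: "\<exists>C. \<forall>\<^sub>F \<kappa> in right_filter. \<forall>x.
        cmod (\<kappa> * w \<kappa> x - (\<Sum>i<m. \<kappa> ^ i * a i x)) \<le> C * cmod \<kappa> ^ m * weight (real \<beta> - 1) x"
begin

text \<open>With \<open>f\<close> as below, \<open>w \<kappa>\<close> is the free resolvent applied to \<open>f \<kappa>\<close>, and \<open>b i\<close> is, like \<open>a i\<close> for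
  \<open>w\<close>, its coefficient at \<open>\<kappa> ^ (i - 1)\<close>.\<close>

definition b :: "nat \<Rightarrow> ('v, 'n) state" where
  "b i = (if i = 1 then u else 0) - V (a i)"

definition f :: "complex \<Rightarrow> ('v, 'n) state" where
  "f \<kappa> = u - V (w \<kappa>)"

lemma b_L: "i < m \<Longrightarrow> b i \<in> L"
  unfolding b_def using u by (intro ell1_diff V_L dual_mono a_dual) auto

lemma w_dual: "w \<kappa> \<in> ell2 \<Longrightarrow> w \<kappa> \<in> ell1_dual s"
  by (rule ell2_subset_dual) simp_all

lemma f_L: "w \<kappa> \<in> ell2 \<Longrightarrow> f \<kappa> \<in> L"
  unfolding f_def by (intro ell1_diff u V_L w_dual)

lemma J_le: "real J \<le> s - 1"
  using J_beta by linarith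

text \<open>\<open>V\<close> turns a weighted pointwise error into an error in \<open>ell1\<close>
  norm, the form in which a source can be inserted into the free kernels.\<close>

lemma f_expansion:
  "\<exists>C. \<forall>\<^sub>F \<kappa> in right_filter. w \<kappa> \<in> ell2 \<and>
     ell1_norm (s - 1) (\<kappa> *\<^sub>C f \<kappa> - (\<Sum>i<m. \<kappa> ^ i *\<^sub>C b i)) \<le> C * cmod \<kappa> ^ m"
proof -
  obtain C where C: "\<forall>\<^sub>F \<kappa> in right_filter. \<forall>x.
        cmod (\<kappa> * w \<kappa> x - (\<Sum>i<m. \<kappa> ^ i * a i x)) \<le> C * cmod \<kappa> ^ m * weight (s - 1) x"
    using w_expansion by blast
  have m1: "1 < m" using J m by auto
  have "w \<kappa> \<in> ell2 \<and> ell1_norm (s - 1) (\<kappa> *\<^sub>C f \<kappa> - (\<Sum>i<m. \<kappa> ^ i *\<^sub>C b i)) \<le> (Cv * C * Cv) * cmod \<kappa> ^ m"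
    if w: "w \<kappa> \<in> ell2" and le: "\<forall>x. cmod (\<kappa> * w \<kappa> x - (\<Sum>i<m. \<kappa> ^ i * a i x)) \<le> C * cmod \<kappa> ^ m * weight (s - 1) x"
    for \<kappa>
  proof
    let ?r = "\<kappa> *\<^sub>C w \<kappa> - (\<Sum>i<m. \<kappa> ^ i *\<^sub>C a i)"
    have ai: "\<kappa> ^ i *\<^sub>C a i \<in> ell1_dual s" "a i \<in> ell1_dual s" if "i \<in> {..<m}" for i
      using that a_dual[of i] dual_mono csubspaceD(3)[OF csubspace_ell1_dual] by auto
    have ws: "\<kappa> *\<^sub>C w \<kappa> \<in> ell1_dual s" by (rule csubspaceD(3)[OF csubspace_ell1_dual w_dual[OF w]])
    have "V ?r = V (\<kappa> *\<^sub>C w \<kappa>) - (\<Sum>i<m. V (\<kappa> ^ i *\<^sub>C a i))"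
      by (simp only: V_diff[OF ws csubspace_sum[OF csubspace_ell1_dual ai(1)]] V_sum[OF ai(1)])
    also have "\<dots> = \<kappa> *\<^sub>C V (w \<kappa>) - (\<Sum>i<m. \<kappa> ^ i *\<^sub>C V (a i))"
      unfolding V_scaleC[OF w_dual[OF w]]
      by (intro arg_cong2[where f = "(-)"] refl sum.cong V_scaleC ai(2))
    finally have Vr: "V ?r = \<kappa> *\<^sub>C V (w \<kappa>) - (\<Sum>i<m. \<kappa> ^ i *\<^sub>C V (a i))" .
    have "(\<Sum>i<m. \<kappa> ^ i *\<^sub>C b i) = (\<Sum>i<m. if i = 1 then \<kappa> *\<^sub>C u else 0) - (\<Sum>i<m. \<kappa> ^ i *\<^sub>C V (a i))"
      unfolding sum_subtractf[symmetric] b_def scaleC_diff_right by (intro sum.cong) auto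
    also have "(\<Sum>i<m. if i = 1 then \<kappa> *\<^sub>C u else 0) = \<kappa> *\<^sub>C u" using m1 by simp
    finally have Sb: "(\<Sum>i<m. \<kappa> ^ i *\<^sub>C b i) = \<kappa> *\<^sub>C u - (\<Sum>i<m. \<kappa> ^ i *\<^sub>C V (a i))" .
    have "x - y - (x - z) = - (y - z)" for x y z :: "('v, 'n) state" by simp
    then have "\<kappa> *\<^sub>C f \<kappa> - (\<Sum>i<m. \<kappa> ^ i *\<^sub>C b i) = - V ?r"
      unfolding Vr f_def scaleC_diff_right Sb .
    then have "ell1_norm (s - 1) (\<kappa> *\<^sub>C f \<kappa> - (\<Sum>i<m. \<kappa> ^ i *\<^sub>C b i)) = ell1_norm (s - 1) (V ?r)"
      by (simp only: ell1_minus_norm)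
    also have "\<dots> \<le> ell1_norm s (V ?r)"
      by (rule ell1_mono(2)[OF V_ell1])
        (auto intro!: csubspaceD(5)[OF csubspace_ell1_dual ws] csubspace_sum[OF csubspace_ell1_dual] ai(1))
    also have "\<dots> \<le> Cv * ((C * cmod \<kappa> ^ m) * Cv)"
    proof (rule V_bound)
      fix x :: "('v, 'n) vertex"
      have "0 \<le> C * cmod \<kappa> ^ m"
        using le norm_ge_zero order_trans nonneg_if_mult_weight_nonneg by blast
      then have "C * cmod \<kappa> ^ m * weight (s - 1) x \<le> C * cmod \<kappa> ^ m * weight s x"
        by (intro mult_left_mono weight_mono) auto
      moreover have "cmod (?r x) = cmod (\<kappa> * w \<kappa> x - (\<Sum>i<m. \<kappa> ^ i * a i x))" by (simp add: sum_fun_apply)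
      ultimately show "cmod (?r x) \<le> C * cmod \<kappa> ^ m * weight s x"
        using le order_trans by fastforce
    qed
    finally show "ell1_norm (s - 1) (\<kappa> *\<^sub>C f \<kappa> - (\<Sum>i<m. \<kappa> ^ i *\<^sub>C b i)) \<le> (Cv * C * Cv) * cmod \<kappa> ^ m"
      by (simp add: mult_ac)
  qed (rule w)
  then show ?thesis
    using eventually_elim2[OF w_equation C] by (intro exI[of _ "Cv * C * Cv"]) (auto elim!: eventually_mono)
qed

lemma f_bounded: "\<exists>C. \<forall>\<^sub>F \<kappa> in right_filter. ell1_norm (s - 1) (\<kappa> *\<^sub>C f \<kappa>) \<le> C"
proof -
  obtain C where C: "\<forall>\<^sub>F \<kappa> in right_filter. w \<kappa> \<in> ell2 \<and>
     ell1_norm (s - 1) (\<kappa> *\<^sub>C f \<kappa> - (\<Sum>i<m. \<kappa> ^ i *\<^sub>C b i)) \<le> C * cmod \<kappa> ^ m"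
    using f_expansion by blast
  have "ell1_norm (s - 1) (\<kappa> *\<^sub>C f \<kappa>) \<le> \<bar>C\<bar> + (\<Sum>i<m. ell1_norm (s - 1) (b i))"
    if w: "w \<kappa> \<in> ell2" and le: "ell1_norm (s - 1) (\<kappa> *\<^sub>C f \<kappa> - (\<Sum>i<m. \<kappa> ^ i *\<^sub>C b i)) \<le> C * cmod \<kappa> ^ m"
      and k: "cmod \<kappa> < 1" for \<kappa>
  proof -
    let ?S = "\<Sum>i<m. \<kappa> ^ i *\<^sub>C b i"
    have bi: "\<kappa> ^ i *\<^sub>C b i \<in> L" if "i \<in> {..<m}" for i using that b_L ell1_scaleC(1) by auto
    have SL: "?S \<in> L" by (rule csubspace_sum[OF csubspace_ell1 bi])
    have pw: "cmod \<kappa> ^ i \<le> 1" for i using k by (simp add: power_le_one)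
    have "ell1_norm (s - 1) ((\<kappa> *\<^sub>C f \<kappa> - ?S) + ?S) \<le> ell1_norm (s - 1) (\<kappa> *\<^sub>C f \<kappa> - ?S) + ell1_norm (s - 1) ?S"
      by (rule ell1_add(2)[OF ell1_diff[OF ell1_scaleC(1)[OF f_L[OF w]] SL] SL])
    moreover have "ell1_norm (s - 1) ?S \<le> (\<Sum>i<m. ell1_norm (s - 1) (b i))"
    proof (rule order_trans[OF ell1_norm_sum_le[OF bi] sum_mono])
      fix i assume "i \<in> {..<m}"
      then have "ell1_norm (s - 1) (\<kappa> ^ i *\<^sub>C b i) \<le> cmod \<kappa> ^ i * ell1_norm (s - 1) (b i)"
        using ell1_scaleC(2)[OF b_L, of i "\<kappa> ^ i"] by (simp add: norm_power)
      also have "\<dots> \<le> 1 * ell1_norm (s - 1) (b i)" by (intro mult_right_mono pw ell1_norm_nonneg)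
      finally show "ell1_norm (s - 1) (\<kappa> ^ i *\<^sub>C b i) \<le> ell1_norm (s - 1) (b i)" by simp
    qed
    moreover have "C * cmod \<kappa> ^ m \<le> \<bar>C\<bar> * 1" by (intro mult_mono pw) auto
    ultimately show ?thesis using le by simp
  qed
  then show ?thesis
    using eventually_conj[OF C eventually_right_small[of 1]]
    by (intro exI[of _ "\<bar>C\<bar> + (\<Sum>i<m. ell1_norm (s - 1) (b i))"]) (auto elim!: eventually_mono)
qed

text \<open>The full order \<open>J\<close> is available here because the source need only stay
  bounded after multiplication by \<kappa>; the weight required is
  \<open>J \<le> \<beta> - 1\<close>.\<close>

lemma free_part:
  assumes \<psi>: "\<psi> \<in> L"
  shows "vanishes_to_order J (\<lambda>\<kappa>. \<kappa> * \<langle>\<psi>, w \<kappa>\<rangle> - (\<Sum>j<J. \<kappa> ^ j * \<langle>\<psi>, G0 j (\<kappa> *\<^sub>C f \<kappa>)\<rangle>))"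
proof -
  obtain \<delta> C where \<delta>: "0 < \<delta>" "0 \<le> C" and free: "\<And>\<kappa> w f x. \<lbrakk>0 < Re \<kappa>; cmod \<kappa> < \<delta>; w \<in> ell1_dual 0; f \<in> ell1 (real J);
        H0 w + \<kappa>\<^sup>2 *\<^sub>C w = f\<rbrakk> \<Longrightarrow>
      cmod (w x - (\<Sum>j<J. \<kappa> ^ j * G0 j f x)) \<le> C * cmod \<kappa> ^ J * weight (real J) x * ell1_norm (real J) f"
    by (rule free_expansion) (use J in blast)
  obtain D where D: "\<forall>\<^sub>F \<kappa> in right_filter. ell1_norm (s - 1) (\<kappa> *\<^sub>C f \<kappa>) \<le> D" using f_bounded by blast
  have \<psi>J: "\<psi> \<in> ell1 (real J)" by (rule ell1_mono(1)[OF \<psi> J_le])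
  have "cmod (\<kappa> * \<langle>\<psi>, w \<kappa>\<rangle> - (\<Sum>j<J. \<kappa> ^ j * \<langle>\<psi>, G0 j (\<kappa> *\<^sub>C f \<kappa>)\<rangle>)) \<le> (C * D * ell1_norm (real J) \<psi>) * cmod \<kappa> ^ J"
    if w: "w \<kappa> \<in> ell2" and eq: "(H0 + V) (w \<kappa>) + \<kappa>\<^sup>2 *\<^sub>C w \<kappa> = u" and k: "0 < Re \<kappa>" "cmod \<kappa> < \<delta>"
      and D: "ell1_norm (s - 1) (\<kappa> *\<^sub>C f \<kappa>) \<le> D" for \<kappa>
  proof -
    let ?F = "\<kappa> *\<^sub>C f \<kappa>"
    have FL: "?F \<in> L" by (rule ell1_scaleC(1)[OF f_L[OF w]])
    have FJ: "?F \<in> ell1 (real J)" "ell1_norm (real J) ?F \<le> D"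
      using ell1_mono[OF FL J_le] D by auto
    have "H0 (w \<kappa>) + V (w \<kappa>) + \<kappa>\<^sup>2 *\<^sub>C w \<kappa> = u" using eq by (simp only: H_apply)
    then have e: "H0 (w \<kappa>) + \<kappa>\<^sup>2 *\<^sub>C w \<kappa> = f \<kappa>" unfolding f_def by (simp add: algebra_simps)
    have "H0 (\<kappa> *\<^sub>C w \<kappa>) + \<kappa>\<^sup>2 *\<^sub>C (\<kappa> *\<^sub>C w \<kappa>) = \<kappa> *\<^sub>C (H0 (w \<kappa>) + \<kappa>\<^sup>2 *\<^sub>C w \<kappa>)"
      by (simp only: clinear_onD(2)[OF clinear_H0] scaleC_add_right scaleC_scaleC mult.commute)
    then have E: "H0 (\<kappa> *\<^sub>C w \<kappa>) + \<kappa>\<^sup>2 *\<^sub>C (\<kappa> *\<^sub>C w \<kappa>) = ?F" by (simp only: e)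
    have w0: "\<kappa> *\<^sub>C w \<kappa> \<in> ell1_dual 0"
      by (rule csubspaceD(3)[OF csubspace_ell1_dual ell2_subset_dual[OF w]]) simp
    let ?R = "\<kappa> *\<^sub>C w \<kappa> - (\<Sum>j<J. \<kappa> ^ j *\<^sub>C G0 j ?F)"
    have R: "cmod (?R x) \<le> (C * cmod \<kappa> ^ J * D) * weight (real J) x" for x
    proof -
      have "cmod (?R x) \<le> C * cmod \<kappa> ^ J * weight (real J) x * ell1_norm (real J) ?F"
        using free[OF k w0 FJ(1) E, of x] by (simp add: sum_fun_apply)
      also have "\<dots> \<le> C * cmod \<kappa> ^ J * weight (real J) x * D"
        by (intro mult_left_mono FJ(2)) (simp add: \<delta>(2))
      finally show ?thesis by (simp add: mult_ac)
    qed
    have Gp: "pairable \<psi> (\<kappa> ^ j *\<^sub>C G0 j ?F)" if "j < J" for j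
      using that J by (intro pairable_scaleC_right pairable_ell1_dual[OF \<psi>] G_dual FL) auto
    have wp: "pairable \<psi> (\<kappa> *\<^sub>C w \<kappa>)"
      by (intro pairable_scaleC_right pairable_ell1_dual[OF \<psi>] ell2_subset_dual[OF w]) (use beta4 in auto)
    have "\<langle>\<psi>, ?R\<rangle> = \<langle>\<psi>, \<kappa> *\<^sub>C w \<kappa>\<rangle> - (\<Sum>j<J. \<langle>\<psi>, \<kappa> ^ j *\<^sub>C G0 j ?F\<rangle>)"
    proof -
      have "\<langle>\<psi>, \<Sum>j<J. \<kappa> ^ j *\<^sub>C G0 j ?F\<rangle> = (\<Sum>j<J. \<langle>\<psi>, \<kappa> ^ j *\<^sub>C G0 j ?F\<rangle>)"
        by (rule pairing_sum_right) (use Gp in auto)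
      moreover have "pairable \<psi> (\<Sum>j<J. \<kappa> ^ j *\<^sub>C G0 j ?F)"
        by (rule pairable_sum_right) (use Gp in auto)
      ultimately show ?thesis by (simp only: pairing_diff_right[OF wp])
    qed
    then have "\<kappa> * \<langle>\<psi>, w \<kappa>\<rangle> - (\<Sum>j<J. \<kappa> ^ j * \<langle>\<psi>, G0 j ?F\<rangle>) = \<langle>\<psi>, ?R\<rangle>"
      by (simp only: pairing_scaleC_right)
    then show ?thesis using pairing_bound(2)[where w = ?R, OF \<psi>J R] by (simp only: mult_ac)
  qed
  then show ?thesis
    using eventually_conj[OF eventually_conj[OF w_equation D] eventually_right_small[OF \<delta>(1)]]
    by (intro vanishes_to_orderI) (auto elim!: eventually_mono)
qed

text \<open>Replacing the source by its given coefficients limits the accuracy to order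
  \<open>m\<close>; for \<open>j = 0\<close> this loss is avoided by
  \<open>exact_identity\<close>.\<close>

lemma source_part:
  assumes \<psi>: "\<psi> \<in> L" and j: "j < J"
  shows "vanishes_to_order m (\<lambda>\<kappa>. \<langle>\<psi>, G0 j (\<kappa> *\<^sub>C f \<kappa>)\<rangle> - (\<Sum>i<m. \<kappa> ^ i * \<langle>\<psi>, G0 j (b i)\<rangle>))"
proof -
  have j3: "j \<le> 3" using j J by auto
  obtain K where "kernel_operator (G0 j) (free_kernel j) (s - 1) K" by (rule G0_kernel[OF j3]) blast
  then interpret K: kernel_operator "G0 j" "free_kernel j" "s - 1" K .
  obtain C where C: "\<forall>\<^sub>F \<kappa> in right_filter. w \<kappa> \<in> ell2 \<and>
     ell1_norm (s - 1) (\<kappa> *\<^sub>C f \<kappa> - (\<Sum>i<m. \<kappa> ^ i *\<^sub>C b i)) \<le> C * cmod \<kappa> ^ m"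
    using f_expansion by blast
  show ?thesis
  proof (rule vanishes_to_orderI[of _ "K * C * ell1_norm (s - 1) \<psi>"], rule eventually_mono[OF C])
    fix \<kappa>
    assume *: "w \<kappa> \<in> ell2 \<and> ell1_norm (s - 1) (\<kappa> *\<^sub>C f \<kappa> - (\<Sum>i<m. \<kappa> ^ i *\<^sub>C b i)) \<le> C * cmod \<kappa> ^ m"
    let ?F = "\<kappa> *\<^sub>C f \<kappa>" and ?S = "\<Sum>i<m. \<kappa> ^ i *\<^sub>C b i"
    have FL: "?F \<in> L" using * by (intro ell1_scaleC(1) f_L) auto
    have bi: "\<kappa> ^ i *\<^sub>C b i \<in> L" "b i \<in> L" if "i \<in> {..<m}" for i using that b_L ell1_scaleC(1) by auto
    have SL: "?S \<in> L" by (rule csubspace_sum[OF csubspace_ell1 bi(1)])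
    have p: "pairable \<psi> (G0 j x)" if "x \<in> L" for x by (rule pairable_ell1_dual[OF \<psi> K.apply_dual[OF that]])
    have "G0 j ?S = (\<Sum>i<m. G0 j (\<kappa> ^ i *\<^sub>C b i))" by (rule K.apply_sum[OF bi(1)])
    also have "\<dots> = (\<Sum>i<m. \<kappa> ^ i *\<^sub>C G0 j (b i))" by (intro sum.cong refl K.apply_scaleC bi(2))
    finally have GS: "G0 j ?S = (\<Sum>i<m. \<kappa> ^ i *\<^sub>C G0 j (b i))" .
    have "\<langle>\<psi>, G0 j (?F - ?S)\<rangle> = \<langle>\<psi>, G0 j ?F\<rangle> - \<langle>\<psi>, G0 j ?S\<rangle>"
      by (simp only: K.apply_diff[OF FL SL] pairing_diff_right[OF p[OF FL] p[OF SL]])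
    also have "\<langle>\<psi>, G0 j ?S\<rangle> = (\<Sum>i<m. \<langle>\<psi>, \<kappa> ^ i *\<^sub>C G0 j (b i)\<rangle>)"
      unfolding GS by (intro pairing_sum_right pairable_scaleC_right p bi(2))
    finally have "\<langle>\<psi>, G0 j ?F\<rangle> - (\<Sum>i<m. \<kappa> ^ i * \<langle>\<psi>, G0 j (b i)\<rangle>) = \<langle>\<psi>, G0 j (?F - ?S)\<rangle>"
      by (simp only: pairing_scaleC_right)
    moreover have "cmod \<langle>\<psi>, G0 j (?F - ?S)\<rangle> \<le> (K * (C * cmod \<kappa> ^ m)) * ell1_norm (s - 1) \<psi>"
    proof (rule pairing_bound(2)[OF \<psi>])
      fix x
      have "cmod (G0 j (?F - ?S) x) \<le> K * ell1_norm (s - 1) (?F - ?S) * weight (s - 1) x"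
        by (rule K.apply_bound[OF ell1_diff[OF FL SL]])
      also have "\<dots> \<le> K * (C * cmod \<kappa> ^ m) * weight (s - 1) x"
        using * by (intro mult_right_mono mult_left_mono K.C_nonneg) auto
      finally show "cmod (G0 j (?F - ?S) x) \<le> K * (C * cmod \<kappa> ^ m) * weight (s - 1) x" .
    qed
    ultimately show "cmod (\<langle>\<psi>, G0 j ?F\<rangle> - (\<Sum>i<m. \<kappa> ^ i * \<langle>\<psi>, G0 j (b i)\<rangle>)) \<le> K * C * ell1_norm (s - 1) \<psi> * cmod \<kappa> ^ m"
      by (simp add: mult_ac)
  qed
qed

text \<open>The assumed expansion at a vertex is compared with the one coming from the free
  resolvent, both tested with a point mass; the accuracy of the former restricts \<open>p\<close> to
  values below \<open>m\<close>.\<close>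

lemma coefficient_equation:
  assumes p: "p < m"
  shows "a p = (\<Sum>j<J. \<Sum>i<m. if i + j = p then G0 j (b i) else 0)"
proof (rule ext)
  fix x
  let ?\<psi> = "point_mass x :: ('v, 'n) state"
  have \<psi>: "?\<psi> \<in> L" by (rule point_mass_ell1)
  obtain C where C: "\<forall>\<^sub>F \<kappa> in right_filter. \<forall>x.
        cmod (\<kappa> * w \<kappa> x - (\<Sum>i<m. \<kappa> ^ i * a i x)) \<le> C * cmod \<kappa> ^ m * weight (s - 1) x"
    using w_expansion by blast
  have 1: "vanishes_to_order m (\<lambda>\<kappa>. \<kappa> * w \<kappa> x - (\<Sum>i<m. \<kappa> ^ i * a i x))"
    by (rule vanishes_to_orderI[of _ "C * weight (s - 1) x"], rule eventually_mono[OF C]) (simp add: mult_ac)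
  have 2: "vanishes_to_order m (\<lambda>\<kappa>. \<kappa> * w \<kappa> x - (\<Sum>j<J. \<kappa> ^ j * G0 j (\<kappa> *\<^sub>C f \<kappa>) x))"
    using vanishes_mono[OF free_part[OF \<psi>], of m] m by (simp add: pairing_point_mass)
  have 3: "vanishes_to_order m (\<lambda>\<kappa>. \<Sum>j<J. \<kappa> ^ j * (G0 j (\<kappa> *\<^sub>C f \<kappa>) x - (\<Sum>i<m. \<kappa> ^ i * G0 j (b i) x)))"
  proof (rule vanishes_sum, rule vanishes_mono[OF vanishes_power_mult])
    fix j assume "j \<in> {..<J}"
    then show "vanishes_to_order m (\<lambda>\<kappa>. G0 j (\<kappa> *\<^sub>C f \<kappa>) x - (\<Sum>i<m. \<kappa> ^ i * G0 j (b i) x))"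
      using source_part[OF \<psi>, of j] by (simp add: pairing_point_mass)
  qed simp
  have "vanishes_to_order m (\<lambda>\<kappa>. (\<Sum>j<J. \<kappa> ^ j * (\<Sum>i<m. \<kappa> ^ i * G0 j (b i) x)) - (\<Sum>p<m. \<kappa> ^ p * a p x))"
  proof (rule vanishes_cong[OF vanishes_diff[OF vanishes_diff[OF 1 2] 3]])
    fix \<kappa>
    show "\<kappa> * w \<kappa> x - (\<Sum>i<m. \<kappa> ^ i * a i x) - (\<kappa> * w \<kappa> x - (\<Sum>j<J. \<kappa> ^ j * G0 j (\<kappa> *\<^sub>C f \<kappa>) x))
        - (\<Sum>j<J. \<kappa> ^ j * (G0 j (\<kappa> *\<^sub>C f \<kappa>) x - (\<Sum>i<m. \<kappa> ^ i * G0 j (b i) x)))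
      = (\<Sum>j<J. \<kappa> ^ j * (\<Sum>i<m. \<kappa> ^ i * G0 j (b i) x)) - (\<Sum>p<m. \<kappa> ^ p * a p x)"
      by (simp only: right_diff_distrib sum_subtractf) simp
  qed
  from compare_coefficients[OF this p, symmetric]
  show "a p x = (\<Sum>j<J. \<Sum>i<m. if i + j = p then G0 j (b i) else 0) x"
    by (simp add: sum_fun_apply if_distrib if_distribR cong: if_cong)
qed

text \<open>By \<open>z = - G0 0 (V z)\<close> and symmetry the two contributions of
  \<open>V (w \<kappa>)\<close> cancel, and only the pairing with the given \<open>u\<close>
  remains; no expansion of \<open>w\<close> is involved.\<close>

lemma exact_identity:
  assumes w: "w \<kappa> \<in> ell2" and z: "z \<in> B"
  shows "\<kappa> * \<langle>V z, w \<kappa>\<rangle> - \<langle>V z, G0 0 (\<kappa> *\<^sub>C f \<kappa>)\<rangle> = \<kappa> * \<langle>z, u\<rangle>"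
proof -
  have zd: "z \<in> ell1_dual s" "z = - G0 0 (V z)" using z by (auto simp: bdd_eigenspace_iff)
  have "\<langle>V z, w \<kappa>\<rangle> = \<langle>z, V (w \<kappa>)\<rangle>" by (rule V_symmetric[OF zd(1) w_dual[OF w], symmetric])
  moreover have "\<langle>V z, G0 0 (\<kappa> *\<^sub>C f \<kappa>)\<rangle> = - \<langle>z, \<kappa> *\<^sub>C f \<kappa>\<rangle>"
  proof -
    have "\<langle>V z, G0 0 (\<kappa> *\<^sub>C f \<kappa>)\<rangle> = \<langle>G0 0 (V z), \<kappa> *\<^sub>C f \<kappa>\<rangle>"
      by (rule G_symmetric[symmetric]) (auto intro: V_L zd(1) ell1_scaleC(1) f_L[OF w])
    also have "\<dots> = \<langle>- z, \<kappa> *\<^sub>C f \<kappa>\<rangle>" using zd(2) by (metis minus_minus)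
    finally show ?thesis by (simp only: pairing_minus_left)
  qed
  moreover have "\<langle>z, f \<kappa>\<rangle> = \<langle>z, u\<rangle> - \<langle>z, V (w \<kappa>)\<rangle>"
    unfolding f_def by (intro pairing_diff_right pairable_B_L[OF z] u V_L w_dual[OF w])
  ultimately show ?thesis by (simp add: pairing_scaleC_right algebra_simps)
qed

text \<open>The term \<open>j = 0\<close> is removed exactly and the others carry a factor \<kappa>,
  so a source known to order \<open>m\<close> suffices for order \<open>J = m + 1\<close>. The case
  \<open>p = m\<close> is the condition that fixes the free part of the last coefficient.\<close>

lemma solvability:
  assumes z: "z \<in> B" and p: "p < J"
  shows "(\<Sum>j<J. \<Sum>i<m. if i + j = p then (if j = 0 then 0 else \<langle>V z, G0 j (b i)\<rangle>) else 0)
    = (if p = 1 then \<langle>z, u\<rangle> else 0)"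
proof -
  let ?\<psi> = "V z"
  have \<psi>: "?\<psi> \<in> L" by (rule V_L[OF B_dual[OF z]])
  let ?c = "\<lambda>j i. if j = 0 then 0 else \<langle>?\<psi>, G0 j (b i)\<rangle>"
  let ?d = "\<lambda>j \<kappa>. if j = 0 then 0 else \<langle>?\<psi>, G0 j (\<kappa> *\<^sub>C f \<kappa>)\<rangle>"
  have J0: "0 < J" "1 < J" using J by auto
  have split: "(\<Sum>j<J. \<kappa> ^ j * \<langle>?\<psi>, G0 j (\<kappa> *\<^sub>C f \<kappa>)\<rangle>) = \<langle>?\<psi>, G0 0 (\<kappa> *\<^sub>C f \<kappa>)\<rangle> + (\<Sum>j<J. \<kappa> ^ j * ?d j \<kappa>)" for \<kappa>
  proof -
    have "{..<J} = insert 0 {1..<J}" using J0 by auto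
    then show ?thesis by simp
  qed
  have 1: "vanishes_to_order J (\<lambda>\<kappa>. \<kappa> * \<langle>z, u\<rangle> - (\<Sum>j<J. \<kappa> ^ j * ?d j \<kappa>))"
  proof -
    obtain C where C: "\<forall>\<^sub>F \<kappa> in right_filter. cmod (\<kappa> * \<langle>?\<psi>, w \<kappa>\<rangle> - (\<Sum>j<J. \<kappa> ^ j * \<langle>?\<psi>, G0 j (\<kappa> *\<^sub>C f \<kappa>)\<rangle>)) \<le> C * cmod \<kappa> ^ J"
      using free_part[OF \<psi>] unfolding vanishes_to_order_def by blast
    show ?thesis
    proof (rule vanishes_to_orderI, rule eventually_mono[OF eventually_conj[OF C w_equation]])
      fix \<kappa> assume *: "cmod (\<kappa> * \<langle>?\<psi>, w \<kappa>\<rangle> - (\<Sum>j<J. \<kappa> ^ j * \<langle>?\<psi>, G0 j (\<kappa> *\<^sub>C f \<kappa>)\<rangle>)) \<le> C * cmod \<kappa> ^ J \<and>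
        w \<kappa> \<in> ell2 \<and> (free_ham E0 xs + V) (w \<kappa>) + \<kappa>\<^sup>2 *\<^sub>C w \<kappa> = u"
      have "\<kappa> * \<langle>z, u\<rangle> - (\<Sum>j<J. \<kappa> ^ j * ?d j \<kappa>)
          = \<kappa> * \<langle>?\<psi>, w \<kappa>\<rangle> - (\<Sum>j<J. \<kappa> ^ j * \<langle>?\<psi>, G0 j (\<kappa> *\<^sub>C f \<kappa>)\<rangle>)"
        unfolding split using exact_identity[OF _ z, of \<kappa>] * by (simp add: algebra_simps)
      then show "cmod (\<kappa> * \<langle>z, u\<rangle> - (\<Sum>j<J. \<kappa> ^ j * ?d j \<kappa>)) \<le> C * cmod \<kappa> ^ J" using * by simp
    qed
  qed
  have 2: "vanishes_to_order J (\<lambda>\<kappa>. \<Sum>j<J. \<kappa> ^ j * (?d j \<kappa> - (\<Sum>i<m. \<kappa> ^ i * ?c j i)))"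
  proof (rule vanishes_sum)
    fix j assume j: "j \<in> {..<J}"
    show "vanishes_to_order J (\<lambda>\<kappa>. \<kappa> ^ j * (?d j \<kappa> - (\<Sum>i<m. \<kappa> ^ i * ?c j i)))"
    proof (cases "j = 0")
      case False
      have "vanishes_to_order (j + m) (\<lambda>\<kappa>. \<kappa> ^ j * (\<langle>?\<psi>, G0 j (\<kappa> *\<^sub>C f \<kappa>)\<rangle> - (\<Sum>i<m. \<kappa> ^ i * \<langle>?\<psi>, G0 j (b i)\<rangle>)))"
        by (rule vanishes_power_mult, rule source_part[OF \<psi>]) (use j in auto)
      from vanishes_mono[OF this, of J] show ?thesis using False m by simp
    qed simp
  qed
  have "vanishes_to_order J (\<lambda>\<kappa>. (\<Sum>j<J. \<kappa> ^ j * (\<Sum>i<m. \<kappa> ^ i * ?c j i)) - (\<Sum>p<J. \<kappa> ^ p * (if p = 1 then \<langle>z, u\<rangle> else 0)))"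
  proof (rule vanishes_cong[OF vanishes_minus[OF vanishes_add[OF 1 2]]])
    fix \<kappa>
    have "(\<Sum>p<J. \<kappa> ^ p * (if p = 1 then \<langle>z, u\<rangle> else 0)) = (\<Sum>p<J. if p = 1 then \<kappa> * \<langle>z, u\<rangle> else 0)"
      by (intro sum.cong) auto
    also have "\<dots> = \<kappa> * \<langle>z, u\<rangle>" using J0 by simp
    finally have e: "(\<Sum>p<J. \<kappa> ^ p * (if p = 1 then \<langle>z, u\<rangle> else 0)) = \<kappa> * \<langle>z, u\<rangle>" .
    show "- (\<kappa> * \<langle>z, u\<rangle> - (\<Sum>j<J. \<kappa> ^ j * ?d j \<kappa>) + (\<Sum>j<J. \<kappa> ^ j * (?d j \<kappa> - (\<Sum>i<m. \<kappa> ^ i * ?c j i))))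
      = (\<Sum>j<J. \<kappa> ^ j * (\<Sum>i<m. \<kappa> ^ i * ?c j i)) - (\<Sum>p<J. \<kappa> ^ p * (if p = 1 then \<langle>z, u\<rangle> else 0))"
      unfolding e by (simp only: right_diff_distrib sum_subtractf) simp
  qed
  from compare_coefficients[OF this p] show ?thesis .
qed

end

section \<open>Algebra of the projections, the perturbation and the free coefficients\<close>

context resonance4
begin

lemma G_dual_s: "j \<le> 3 \<Longrightarrow> x \<in> L \<Longrightarrow> G0 j x \<in> ell1_dual s"
  by (rule dual_mono[OF G_dual])

lemmas dual_add = csubspaceD(2)[OF csubspace_ell1_dual]
lemmas dual_diff = csubspaceD(5)[OF csubspace_ell1_dual]
lemmas dual_minus = csubspaceD(4)[OF csubspace_ell1_dual]
lemmas dual_scaleC = csubspaceD(3)[OF csubspace_ell1_dual]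

lemma P_diff: "x \<in> L \<Longrightarrow> y \<in> L \<Longrightarrow> P (x - y) = P x - P y"
  unfolding P_apply sum_subtractf[symmetric]
  by (intro sum.cong refl) (simp only: pairing_diff_right[OF pairable_B_L pairable_B_L] \<Psi>_B scaleC_diff_left)

lemma P_add: "x \<in> L \<Longrightarrow> y \<in> L \<Longrightarrow> P (x + y) = P x + P y"
  unfolding P_apply sum.distrib[symmetric]
  by (intro sum.cong refl) (simp only: pairing_add_right[OF pairable_B_L pairable_B_L] \<Psi>_B scaleC_add_left)

lemma P_minus: "P (- x) = - P x"
  unfolding P_apply sum_negf[symmetric]
  by (intro sum.cong refl) (simp only: pairing_minus_right scaleC_minus_left)

lemma PV_add: "x \<in> ell1_dual s \<Longrightarrow> y \<in> ell1_dual s \<Longrightarrow> P (V (x + y)) = P (V x) + P (V y)"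
  by (simp only: V_add P_add V_L)

lemma PV_diff: "x \<in> ell1_dual s \<Longrightarrow> y \<in> ell1_dual s \<Longrightarrow> P (V (x - y)) = P (V x) - P (V y)"
  by (simp only: V_diff P_diff V_L)

lemma PV_minus: "x \<in> ell1_dual s \<Longrightarrow> P (V (- x)) = - P (V x)"
  by (simp only: V_minus P_minus)

lemma W_add: "x \<in> ell1_dual s \<Longrightarrow> y \<in> ell1_dual s \<Longrightarrow> W (x + y) = W x + W y"
  by (simp only: W_apply adjoint_add clinear_onD(1)[OF M0.clinear_pseudo_inverse] clinear_onD(1)[OF clinear_v])

lemma W_scaleC: "x \<in> ell1_dual s \<Longrightarrow> W (a *\<^sub>C x) = a *\<^sub>C W x"
  by (simp only: W_apply adjoint_scaleC clinear_onD(2)[OF M0.clinear_pseudo_inverse] clinear_onD(2)[OF clinear_v])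

lemma T_add:
  assumes "x \<in> ell1_dual s" "y \<in> ell1_dual s" shows "T (x + y) = T x + T y"
  unfolding T_apply W_add[OF assms]
  by (simp only: G_add[OF _ W_L W_L] PV_add[OF G_dual_s[OF _ W_L] G_dual_s[OF _ W_L]] le0 one_le_numeral)
    (simp add: fun_eq_iff)

lemma P_scaleC: "P (a *\<^sub>C x) = a *\<^sub>C P x"
  unfolding P_apply scaleC_sum_right by (simp only: pairing_scaleC_right scaleC_scaleC)

lemma T_scaleC:
  assumes "x \<in> ell1_dual s" shows "T (a *\<^sub>C x) = a *\<^sub>C T x"
  unfolding T_apply W_scaleC[OF assms]
  by (simp only: G_scaleC[OF _ W_L] V_scaleC[OF G_dual_s[OF _ W_L]] P_scaleC le0 one_le_numeral
      scaleC_add_right scaleC_diff_right)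

lemma T_minus: "x \<in> ell1_dual s \<Longrightarrow> T (- x) = - T x"
  using T_scaleC[of x "-1"] by (simp only: scaleC_minus_one)

lemma T_diff: "x \<in> ell1_dual s \<Longrightarrow> y \<in> ell1_dual s \<Longrightarrow> T (x - y) = T x - T y"
  using T_add[of x "-y"] T_minus[of y] dual_minus[of y s] by (simp only: diff_conv_add_uminus)

lemma T_sum:
  assumes "\<And>i. i \<in> I \<Longrightarrow> x i \<in> ell1_dual s"
  shows "T (\<Sum>i\<in>I. x i) = (\<Sum>i\<in>I. T (x i))"
  using assms
proof (induction I rule: infinite_finite_induct)
  case (insert i I)
  then have *: "T (\<Sum>i\<in>insert i I. x i) = T (x i) + T (\<Sum>i\<in>I. x i)"
    unfolding sum.insert[OF insert.hyps(1,2)] by (intro T_add csubspace_sum[OF csubspace_ell1_dual]) auto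
  have IH: "T (\<Sum>i\<in>I. x i) = (\<Sum>i\<in>I. T (x i))" by (intro insert.IH insert.prems) auto
  show ?case using * IH unfolding sum.insert[OF insert.hyps(1,2)] by (simp only:)
qed (use T_scaleC[of 0 0] csubspaceD(1)[OF csubspace_ell1_dual] in auto)

lemma L_1: "x \<in> L \<Longrightarrow> x \<in> ell1 1"
  by (rule ell1_mono(1)) (use beta4 in auto)

lemma n_moments_V\<Psi>_sum:
  "(\<chi> \<alpha>. \<langle>n_vec \<alpha>, V (\<Sum>\<gamma>\<in>\<Gamma>. x \<gamma> *\<^sub>C \<Psi> \<gamma>)\<rangle>) = - (\<Sum>\<gamma>\<in>\<Gamma>. x \<gamma> *s c \<gamma>)"
proof -
  have "V (\<Sum>\<gamma>\<in>\<Gamma>. x \<gamma> *\<^sub>C \<Psi> \<gamma>) = (\<Sum>\<gamma>\<in>\<Gamma>. x \<gamma> *\<^sub>C V (\<Psi> \<gamma>))"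
    by (simp add: V_sum V_scaleC dual_scaleC \<Psi>_dual)
  then have "\<langle>n_vec \<alpha>, V (\<Sum>\<gamma>\<in>\<Gamma>. x \<gamma> *\<^sub>C \<Psi> \<gamma>)\<rangle> = (\<Sum>\<gamma>\<in>\<Gamma>. \<langle>n_vec \<alpha>, x \<gamma> *\<^sub>C V (\<Psi> \<gamma>)\<rangle>)" for \<alpha>
    using pairing_sum_right[of \<Gamma> "n_vec \<alpha>" "\<lambda>\<gamma>. x \<gamma> *\<^sub>C V (\<Psi> \<gamma>)"]
      pairable_scaleC_right[OF pairable_dual_ell1[OF n_vec_dual L_1[OF V_L[OF \<Psi>_dual]]]] by simp
  then show ?thesis
    by (simp add: vec_eq_iff pairing_scaleC_right c_eq sum_negf)
qed

lemma PV_n_comb: "P (V (n_comb x)) = - (\<Sum>\<gamma>\<in>\<Gamma>. cdot (c \<gamma>) x *\<^sub>C \<Psi> \<gamma>)"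
  unfolding PV_apply[OF n_comb_dual_s] sum_negf[symmetric]
  by (intro sum.cong refl) (simp only: pairing_V\<Psi>_n_comb scaleC_minus_left)

text \<open>The first moments of \<open>V (\<Psi> \<gamma>)\<close> are the components of
  \<open>- c \<gamma>\<close>, and \<open>P V\<close> reads off the components along the orthonormal
  \<open>c \<gamma>\<close> with a minus sign.\<close>

lemma PVG1V_B:
  assumes "z \<in> B" shows "P (V (G0 1 (V z))) = - z"
proof -
  obtain x where z: "z = (\<Sum>\<gamma>\<in>\<Gamma>. x \<gamma> *\<^sub>C \<Psi> \<gamma>)" by (rule B_expansion[OF assms])
  have "G0 1 (V z) = n_comb (\<Sum>\<gamma>\<in>\<Gamma>. x \<gamma> *s c \<gamma>)"
    unfolding G0_1_eq z n_moments_V\<Psi>_sum n_comb_minus by simp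
  then have "P (V (G0 1 (V z))) = - (\<Sum>\<gamma>\<in>\<Gamma>. cdot (c \<gamma>) (\<Sum>\<gamma>\<in>\<Gamma>. x \<gamma> *s c \<gamma>) *\<^sub>C \<Psi> \<gamma>)"
    by (simp only: PV_n_comb)
  also have "(\<Sum>\<gamma>\<in>\<Gamma>. cdot (c \<gamma>) (\<Sum>\<gamma>\<in>\<Gamma>. x \<gamma> *s c \<gamma>) *\<^sub>C \<Psi> \<gamma>) = z"
  proof -
    have "orthonormal_system \<Gamma> c" by (simp add: orthonormal_system_def c_orthonormal)
    from orthonormal_coefficients[OF this finite_indices(1) order_refl, of _ x]
    show ?thesis unfolding z by (intro sum.cong refl) simp
  qed
  finally show ?thesis .
qed

lemma pairing_PV:
  assumes z: "z \<in> ell1_dual s" and u: "u \<in> L"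
  shows "\<langle>P (V z), u\<rangle> = \<langle>z, V (P u)\<rangle>"
proof -
  have "\<langle>P (V z), u\<rangle> = (\<Sum>\<gamma>\<in>\<Gamma>. \<langle>\<langle>V (\<Psi> \<gamma>), z\<rangle> *\<^sub>C \<Psi> \<gamma>, u\<rangle>)"
    unfolding PV_apply[OF z] by (intro pairing_sum_left pairable_B_L[OF csubspaceD(3)[OF csubspace_B \<Psi>_B] u])
  also have "\<dots> = (\<Sum>\<gamma>\<in>\<Gamma>. \<langle>z, \<langle>\<Psi> \<gamma>, u\<rangle> *\<^sub>C V (\<Psi> \<gamma>)\<rangle>)"
    by (intro sum.cong refl)
      (simp add: pairing_scaleC_left pairing_scaleC_right mult.commute pairing_commute[of z])
  also have "\<dots> = \<langle>z, V (P u)\<rangle>"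
    unfolding VP_apply
    by (intro pairing_sum_right[symmetric] pairable_scaleC_right pairable_dual_ell1[OF z V_ell1[OF \<Psi>_dual]])
  finally show ?thesis .
qed

text \<open>The right-hand side of the equation of order 0, once the leading coefficient is known to
  be \<open>P u\<close>.\<close>

definition source :: "('v, 'n) state \<Rightarrow> ('v, 'n) state" where
  "source u = G0 0 u - G0 1 (V (P u))"

text \<open>The coefficient \<open>b 1\<close> before its correction by an element of
  \<open>V B\<close>; as an operator, the right-hand bracket in the coefficient of order 1.\<close>

definition S :: "('v, 'n) state \<Rightarrow> ('v, 'n) state" where
  "S u = u - W (source u)"

lemma VP_L: "V (P u) \<in> L"
  by (rule V_L[OF P_dual])

lemma source_dual: "u \<in> L \<Longrightarrow> source u \<in> ell1_dual s"
  unfolding source_def by (intro dual_diff G_dual_s VP_L) auto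

lemma S_L: "u \<in> L \<Longrightarrow> S u \<in> L"
  unfolding S_def by (intro ell1_diff W_L)

text \<open>\<open>S\<close> and \<open>T\<close> are formally adjoint, because \<open>V\<close>,
  \<open>W\<close>, \<open>P\<close>, \<open>G0 0\<close> and \<open>G0 1\<close> are symmetric.
  Hence the moments of \<open>S u\<close> in the complementary directions are pairings with the same
  functions that \<open>T\<close> produces.\<close>

lemma S_T_adjoint:
  assumes u: "u \<in> L" and \<gamma>: "\<gamma> \<in> \<Gamma>t"
  shows "cdot (ct \<gamma>) (\<chi> \<alpha>. \<langle>n_vec \<alpha>, S u\<rangle>) = \<langle>\<Psi>t \<gamma>, u\<rangle>"
proof -
  let ?n = "n_comb (ct \<gamma>) :: ('v, 'n) state"
  have n: "?n \<in> ell1_dual s" by (rule n_comb_dual_s)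
  have pn: "pairable ?n x" if "x \<in> L" for x by (rule pairable_dual_ell1[OF n_comb_dual L_1[OF that]])
  have pw: "pairable (W ?n) (G0 j x)" if "j \<le> 3" "x \<in> L" for j x
    by (rule pairable_ell1_dual[OF W_ell1 G_dual_s[OF that]])
  have GW: "pairable (G0 0 (W ?n)) u" by (rule pairable_dual_ell1[OF G_dual[OF _ W_L] u]) simp
  have "cdot (ct \<gamma>) (\<chi> \<alpha>. \<langle>n_vec \<alpha>, S u\<rangle>) = \<langle>?n, S u\<rangle>"
    unfolding pairing_n_comb_left[OF L_1[OF S_L[OF u]]] by (simp add: cdot_def)
  also have "\<dots> = \<langle>?n, u\<rangle> - \<langle>?n, W (source u)\<rangle>"
    unfolding S_def by (rule pairing_diff_right[OF pn[OF u] pn[OF W_L]])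
  also have "\<langle>?n, W (source u)\<rangle> = \<langle>W ?n, source u\<rangle>" by (rule W_symmetric[OF n source_dual[OF u], symmetric])
  also have "\<dots> = \<langle>W ?n, G0 0 u\<rangle> - \<langle>W ?n, G0 1 (V (P u))\<rangle>"
    unfolding source_def by (intro pairing_diff_right pw VP_L u) auto
  also have "\<langle>W ?n, G0 0 u\<rangle> = \<langle>G0 0 (W ?n), u\<rangle>" by (rule G_symmetric[symmetric, OF _ W_L u]) simp
  also have "\<langle>W ?n, G0 1 (V (P u))\<rangle> = \<langle>G0 1 (W ?n), V (P u)\<rangle>"
    by (rule G_symmetric[symmetric, OF _ W_L VP_L]) simp
  also have "\<dots> = \<langle>P (V (G0 1 (W ?n))), u\<rangle>"
    by (rule pairing_PV[symmetric, OF G_dual_s[OF _ W_L] u]) simp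
  finally have 1: "cdot (ct \<gamma>) (\<chi> \<alpha>. \<langle>n_vec \<alpha>, S u\<rangle>) = \<langle>?n, u\<rangle> - (\<langle>G0 0 (W ?n), u\<rangle> - \<langle>P (V (G0 1 (W ?n))), u\<rangle>)" .
  have "pairable (?n - G0 0 (W ?n)) u"
    by (rule pairable_dual_ell1[OF dual_diff[OF ell1_dual_mono[OF n_comb_dual] G_dual[OF _ W_L]] u]) (use beta4 in auto)
  then have "\<langle>\<Psi>t \<gamma>, u\<rangle> = \<langle>?n, u\<rangle> - \<langle>G0 0 (W ?n), u\<rangle> + \<langle>P (V (G0 1 (W ?n))), u\<rangle>"
    unfolding \<Psi>t_def T_apply
    by (simp only: pairing_add_left[OF _ pairable_B_L[OF P_B u]] pairing_diff_left[OF pn[OF u] GW])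
  then show ?thesis using 1 by simp
qed

lemma T_G1_S:
  assumes u: "u \<in> L"
  shows "T (G0 1 (S u + V (P (V (G0 1 (S u)))))) = - projection_of \<Gamma>t \<Psi>t u"
proof -
  define x where "x = (\<chi> \<alpha>. \<langle>n_vec \<alpha>, S u\<rangle>)"
  have G1S: "G0 1 (S u) = - n_comb x" unfolding x_def by (rule G0_1_eq)
  have "P (V (G0 1 (S u))) = (\<Sum>\<gamma>\<in>\<Gamma>. cdot (c \<gamma>) x *\<^sub>C \<Psi> \<gamma>)"
    unfolding G1S PV_minus[OF n_comb_dual_s] PV_n_comb by simp
  then have "G0 1 (V (P (V (G0 1 (S u))))) = n_comb (\<Sum>\<gamma>\<in>\<Gamma>. cdot (c \<gamma>) x *s c \<gamma>)"
    unfolding G0_1_eq[of "V (P (V (G0 1 (S u))))"] by (simp only: n_moments_V\<Psi>_sum n_comb_minus minus_minus)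
  moreover have "G0 1 (S u + V (P (V (G0 1 (S u))))) = G0 1 (S u) + G0 1 (V (P (V (G0 1 (S u)))))"
    by (rule G_add[OF _ S_L[OF u] VP_L]) simp
  ultimately have "G0 1 (S u + V (P (V (G0 1 (S u))))) = - n_comb x + n_comb (\<Sum>\<gamma>\<in>\<Gamma>. cdot (c \<gamma>) x *s c \<gamma>)"
    by (simp only: G1S)
  also have "\<dots> = - n_comb (\<Sum>\<gamma>\<in>\<Gamma>t. cdot (ct \<gamma>) x *s ct \<gamma>)"
    by (subst (1) completeness[of x]) (simp only: n_comb_add minus_add_distrib, simp)
  finally have "T (G0 1 (S u + V (P (V (G0 1 (S u)))))) = - T (n_comb (\<Sum>\<gamma>\<in>\<Gamma>t. cdot (ct \<gamma>) x *s ct \<gamma>))"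
    by (simp only: T_minus[OF n_comb_dual_s])
  also have "n_comb (\<Sum>\<gamma>\<in>\<Gamma>t. cdot (ct \<gamma>) x *s ct \<gamma>) = (\<Sum>\<gamma>\<in>\<Gamma>t. cdot (ct \<gamma>) x *\<^sub>C (n_comb (ct \<gamma>) :: ('v, 'n) state))"
    by (simp only: n_comb_sum n_comb_scale)
  also have "T \<dots> = (\<Sum>\<gamma>\<in>\<Gamma>t. T (cdot (ct \<gamma>) x *\<^sub>C n_comb (ct \<gamma>)))"
    by (intro T_sum dual_scaleC n_comb_dual_s)
  also have "\<dots> = (\<Sum>\<gamma>\<in>\<Gamma>t. \<langle>\<Psi>t \<gamma>, u\<rangle> *\<^sub>C \<Psi>t \<gamma>)"
    by (intro sum.cong refl) (simp only: T_scaleC[OF n_comb_dual_s] \<Psi>t_def[symmetric] S_T_adjoint[OF u] x_def)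
  also have "\<dots> = projection_of \<Gamma>t \<Psi>t u"
    by (simp add: projection_of_def sum_fun_apply ketbra_def)
  finally show ?thesis .
qed

end

section \<open>Solving the equations order by order\<close>

context resolvent_family
begin

lemma Jm: "(J = 3 \<and> m = 2) \<or> (J = 4 \<and> m = 3)"
  using J m by auto

lemma index_sets: "{..<2} = {0, 1::nat}" "{..<3} = {0, 1, 2::nat}" "{..<4} = {0, 1, 2, 3::nat}"
  by auto

lemma a_eq_0: "a 0 = G0 0 (b 0)"
  and a_eq_1: "a 1 = G0 0 (b 1) + G0 1 (b 0)"
  using Jm coefficient_equation[of 0] coefficient_equation[of 1]
  by (auto simp: index_sets simp del: One_nat_def)

lemma a_eq_2: "J = 4 \<Longrightarrow> a 2 = G0 0 (b 2) + (G0 1 (b 1) + G0 2 (b 0))"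
  using Jm coefficient_equation[of 2] by (auto simp: index_sets simp del: One_nat_def)

lemma solvable_1: "z \<in> B \<Longrightarrow> \<langle>V z, G0 1 (b 0)\<rangle> = \<langle>z, u\<rangle>"
  and solvable_2: "z \<in> B \<Longrightarrow> \<langle>V z, G0 1 (b 1)\<rangle> + \<langle>V z, G0 2 (b 0)\<rangle> = 0"
  using Jm solvability[of z 1] solvability[of z 2]
  by (auto simp: index_sets simp del: One_nat_def)

lemma solvable_3: "J = 4 \<Longrightarrow> z \<in> B \<Longrightarrow>
    \<langle>V z, G0 1 (b 2)\<rangle> + (\<langle>V z, G0 2 (b 1)\<rangle> + \<langle>V z, G0 3 (b 0)\<rangle>) = 0"
  using Jm solvability[of z 3] by (auto simp: index_sets simp del: One_nat_def)

lemma m_bounds: "0 < m" "1 < m" "J = 4 \<Longrightarrow> 2 < m"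
  using Jm by auto

lemma a_dual_s: "i < m \<Longrightarrow> a i \<in> ell1_dual s"
  by (rule dual_mono[OF a_dual])

text \<open>The lowest equation is homogeneous, so \<open>a 0\<close> lies in \<open>B\<close>; the
  condition of the next order contains \<open>u\<close> and identifies it. The leading coefficient
  of the resolvent is thus \<open>P\<close>.\<close>

lemma a_0: "a 0 = P u"
proof -
  have a0: "a 0 \<in> ell1_dual s" by (rule a_dual_s[OF m_bounds(1)])
  have b0: "b 0 = - V (a 0)" by (simp add: b_def)
  have "a 0 = - G0 0 (V (a 0))" using a_eq_0 unfolding b0 by (simp only: G_minus[OF _ V_L[OF a0]] le0)
  then have B: "a 0 \<in> B" using a0 by (simp add: bdd_eigenspace_iff)
  have "G0 1 (b 0) = - G0 1 (V (a 0))" unfolding b0 by (rule G_minus[OF _ V_L[OF a0]]) simp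
  then have "P (V (G0 1 (b 0))) = a 0"
    by (simp only: PV_minus[OF G_dual_s[OF _ V_L[OF a0]]] one_le_numeral PVG1V_B[OF B] minus_minus)
  moreover have "P (V (G0 1 (b 0))) = P u"
  proof -
    have d: "G0 1 (b 0) \<in> ell1_dual s" by (rule G_dual_s[OF _ b_L[OF m_bounds(1)]]) simp
    show ?thesis
      unfolding PV_apply[OF d] unfolding P_apply by (intro sum.cong refl) (simp only: solvable_1[OF \<Psi>_B])
  qed
  ultimately show ?thesis by simp
qed

lemma b_0: "b 0 = - V (P u)"
  by (simp add: b_def a_0)

lemma Gb_0: "j \<le> 3 \<Longrightarrow> G0 j (b 0) = - G0 j (V (P u))"
  unfolding b_0 by (rule G_minus[OF _ VP_L])

text \<open>Turns a solvability condition against all of \<open>B\<close> into an identity between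
  values of \<open>P V\<close>.\<close>

lemma PV_sum_zero:
  assumes "x \<in> ell1_dual s" "y \<in> ell1_dual s" "\<And>z. z \<in> B \<Longrightarrow> \<langle>V z, x\<rangle> + \<langle>V z, y\<rangle> = 0"
  shows "P (V x) + P (V y) = 0"
  unfolding PV_apply[OF assms(1)] PV_apply[OF assms(2)] sum.distrib[symmetric] scaleC_add_left[symmetric]
  using assms(3)[OF \<Psi>_B] by (intro sum.neutral) simp

text \<open>\<open>q\<close> is the undetermined element of \<open>B\<close> in the solution of
  order 0; the condition at \<open>p = 2\<close> contains it only through
  \<open>P (V (G0 1 (V q))) = - q\<close>, so it can be solved for \<open>q\<close>.\<close>

lemma b_1: "b 1 = S u - V (P (V (G0 2 (V (P u)))) - P (V (G0 1 (S u))))"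
  and a_1: "a 1 = source u - G0 0 (W (source u)) + (P (V (G0 2 (V (P u)))) - P (V (G0 1 (S u))))"
proof -
  have a1: "a 1 \<in> ell1_dual s" by (rule a_dual_s[OF m_bounds(2)])
  have b1: "b 1 = u - V (a 1)" by (simp add: b_def)
  have "G0 0 (b 1) = G0 0 u - G0 0 (V (a 1))"
    unfolding b1 by (rule G_diff[OF _ u V_L[OF a1]]) simp
  then have "a 1 = (G0 0 u - G0 0 (V (a 1))) + - G0 1 (V (P u))"
    using a_eq_1 Gb_0[of 1] by (simp only: one_le_numeral)
  also have "\<dots> = source u - G0 0 (V (a 1))" unfolding source_def by simp
  finally obtain q where q: "q \<in> B" "a 1 = source u - G0 0 (W (source u)) + q" "V (a 1) = W (source u) + V q"
    by (rule Lippmann_Schwinger_solution[OF a1 source_dual[OF u]]) blast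
  have Vq: "V q \<in> L" by (rule V_L[OF B_dual[OF q(1)]])
  have b1': "b 1 = S u - V q" unfolding b1 q(3) S_def by (simp only: diff_diff_eq)
  have d1: "G0 1 x \<in> ell1_dual s" and d2: "G0 2 x \<in> ell1_dual s" if "x \<in> L" for x
    using that by (auto intro: G_dual_s)
  have "P (V (G0 1 (b 1))) = P (V (G0 1 (S u))) + q"
  proof -
    have "G0 1 (b 1) = G0 1 (S u) - G0 1 (V q)" unfolding b1' by (rule G_diff[OF _ S_L[OF u] Vq]) simp
    then have "P (V (G0 1 (b 1))) = P (V (G0 1 (S u))) - P (V (G0 1 (V q)))"
      by (simp only: PV_diff[OF d1[OF S_L[OF u]] d1[OF Vq]])
    then show ?thesis by (simp only: PVG1V_B[OF q(1)] diff_minus_eq_add)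
  qed
  moreover have "P (V (G0 2 (b 0))) = - P (V (G0 2 (V (P u))))"
    using Gb_0[of 2] by (simp add: PV_minus[OF d2[OF VP_L]])
  moreover have "P (V (G0 1 (b 1))) + P (V (G0 2 (b 0))) = 0"
    by (rule PV_sum_zero[OF d1[OF b_L[OF m_bounds(2)]] d2[OF b_L[OF m_bounds(1)]] solvable_2])
  ultimately have "P (V (G0 1 (S u))) + q + - P (V (G0 2 (V (P u)))) = 0" by (simp only:)
  then have "q = P (V (G0 2 (V (P u)))) - P (V (G0 1 (S u)))"
    by (simp only: add.commute[of _ q] eq_diff_eq) (simp only: add_eq_0_iff2 minus_minus)
  then show "b 1 = S u - V (P (V (G0 2 (V (P u)))) - P (V (G0 1 (S u))))"
    and "a 1 = source u - G0 0 (W (source u)) + (P (V (G0 2 (V (P u)))) - P (V (G0 1 (S u))))"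
    using b1' q(2) by simp_all
qed

lemma coefficient_0:
  "a 1 = (G0 0 - P \<odot> V \<odot> G0 1 - G0 1 \<odot> V \<odot> P
          - (G0 0 - P \<odot> V \<odot> G0 1) \<odot> W \<odot> (G0 0 - G0 1 \<odot> V \<odot> P)
          + P \<odot> V \<odot> G0 2 \<odot> V \<odot> P) u"
proof -
  have "G0 1 (S u) = G0 1 u - G0 1 (W (source u))"
    unfolding S_def by (rule G_diff[OF _ u W_L]) simp
  then have e: "P (V (G0 1 (S u))) = P (V (G0 1 u)) - P (V (G0 1 (W (source u))))"
    by (simp only: PV_diff[OF G_dual_s[OF _ u] G_dual_s[OF _ W_L]] one_le_numeral)
  have "(G0 0 - P \<odot> V \<odot> G0 1 - G0 1 \<odot> V \<odot> P
          - (G0 0 - P \<odot> V \<odot> G0 1) \<odot> W \<odot> (G0 0 - G0 1 \<odot> V \<odot> P)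
          + P \<odot> V \<odot> G0 2 \<odot> V \<odot> P) u
    = G0 0 u - P (V (G0 1 u)) - G0 1 (V (P u)) - (G0 0 (W (source u)) - P (V (G0 1 (W (source u)))))
      + P (V (G0 2 (V (P u))))"
    by (simp only: minus_apply plus_fun_apply o_apply source_def)
  also have "\<dots> = a 1"
    unfolding a_1 e source_def[of u, symmetric] by (simp add: source_def[of u] fun_eq_iff)
  finally show ?thesis by simp
qed

text \<open>The same scheme one order higher, with right-hand side \<open>d'\<close> and
  undetermined part \<open>r\<close>. The term \<open>P (V (G0 1 (W d')))\<close> of
  \<open>r\<close> completes \<open>d' - G0 0 (W d')\<close> to \<open>T d'\<close>.\<close>

lemma a_2:
  assumes J4: "J = 4"
  shows "a 2 = T (G0 1 (b 1) - G0 2 (V (P u))) - P (V (G0 2 (b 1))) + P (V (G0 3 (V (P u))))"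
proof -
  have a2: "a 2 \<in> ell1_dual s" by (rule a_dual_s[OF m_bounds(3)[OF J4]])
  have b2: "b 2 = - V (a 2)" by (simp add: b_def)
  have b1L: "b 1 \<in> L" by (rule b_L[OF m_bounds(2)])
  have d: "G0 j x \<in> ell1_dual s" if "j \<le> 3" "x \<in> L" for j x using that by (rule G_dual_s)
  define d' where "d' = G0 1 (b 1) - G0 2 (V (P u))"
  have d': "d' \<in> ell1_dual s" unfolding d'_def by (intro dual_diff d b1L VP_L) auto
  have "G0 0 (b 2) = - G0 0 (V (a 2))" unfolding b2 by (rule G_minus[OF _ V_L[OF a2]]) simp
  moreover have "G0 2 (b 0) = - G0 2 (V (P u))" by (rule Gb_0) simp
  ultimately have "a 2 = - G0 0 (V (a 2)) + (G0 1 (b 1) + - G0 2 (V (P u)))" using a_eq_2[OF J4] by (simp only:)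
  also have "\<dots> = d' - G0 0 (V (a 2))" unfolding d'_def by (simp only: add_uminus_conv_diff uminus_add_conv_diff)
  finally obtain r where r: "r \<in> B" "a 2 = d' - G0 0 (W d') + r" "V (a 2) = W d' + V r"
    by (rule Lippmann_Schwinger_solution[OF a2 d']) blast
  have Vr: "V r \<in> L" by (rule V_L[OF B_dual[OF r(1)]])
  have b2L: "b 2 \<in> L" by (rule b_L[OF m_bounds(3)[OF J4]])
  have "G0 1 (b 2) = - (G0 1 (W d') + G0 1 (V r))"
    unfolding b2 r(3) by (simp only: G_minus[OF _ ell1_add(1)[OF W_L Vr]] G_add[OF _ W_L Vr] one_le_numeral)
  then have "P (V (G0 1 (b 2))) = - (P (V (G0 1 (W d'))) + P (V (G0 1 (V r))))"
    by (simp only: PV_minus[OF dual_add[OF d[OF _ W_L] d[OF _ Vr]]] PV_add[OF d[OF _ W_L] d[OF _ Vr]] one_le_numeral)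
  then have 1: "P (V (G0 1 (b 2))) = - (P (V (G0 1 (W d'))) - r)"
    by (simp only: PVG1V_B[OF r(1)] add_uminus_conv_diff)
  have 3: "P (V (G0 3 (b 0))) = - P (V (G0 3 (V (P u))))"
    using Gb_0[of 3] PV_minus[OF d[OF _ VP_L], of 3 u] by simp
  have 23: "P (V (G0 2 (b 1) + G0 3 (b 0))) = P (V (G0 2 (b 1))) + P (V (G0 3 (b 0)))"
    by (intro PV_add d b1L b_L[OF m_bounds(1)]) auto
  have "P (V (G0 1 (b 2))) + P (V (G0 2 (b 1) + G0 3 (b 0))) = 0"
  proof (rule PV_sum_zero)
    show "G0 1 (b 2) \<in> ell1_dual s" "G0 2 (b 1) + G0 3 (b 0) \<in> ell1_dual s"
      by (intro dual_add d b1L b2L b_L[OF m_bounds(1)]; simp)+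
    fix z assume z: "z \<in> B"
    have "\<langle>V z, G0 2 (b 1) + G0 3 (b 0)\<rangle> = \<langle>V z, G0 2 (b 1)\<rangle> + \<langle>V z, G0 3 (b 0)\<rangle>"
      by (intro pairing_add_right pairable_ell1_dual[OF V_ell1[OF B_dual[OF z]]] d b1L b_L[OF m_bounds(1)]) auto
    then show "\<langle>V z, G0 1 (b 2)\<rangle> + \<langle>V z, G0 2 (b 1) + G0 3 (b 0)\<rangle> = 0"
      using solvable_3[OF J4 z] by simp
  qed
  then have "- (P (V (G0 1 (W d'))) - r) + (P (V (G0 2 (b 1))) + - P (V (G0 3 (V (P u))))) = 0"
    by (simp only: 1 3 23)
  moreover have "r = x - y + w" if "- (x - r) + (y + - w) = 0" for x y w :: "('v, 'n) state"
    using that by (simp add: fun_eq_iff algebra_simps)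
  ultimately have "r = P (V (G0 1 (W d'))) - P (V (G0 2 (b 1))) + P (V (G0 3 (V (P u))))" by blast
  then show ?thesis unfolding d'_def[symmetric] T_apply using r(2) by (simp add: fun_eq_iff)
qed

text \<open>Writing \<open>b 1 = X - Y\<close> separates the part on which \<open>T_G1_S\<close>
  produces the projection from \<open>Y\<close>, which gives the product with two factors
  \<open>G0 2\<close> and the second summand in the bracket following \<open>T\<close>.\<close>

lemma coefficient_1:
  assumes J4: "J = 4"
  shows "a 2 = (- projection_of \<Gamma>t \<Psi>t + P \<odot> V \<odot> G0 3 \<odot> V \<odot> P
          + P \<odot> V \<odot> G0 2 \<odot> V \<odot> P \<odot> V \<odot> G0 2 \<odot> V \<odot> P
          - T \<odot> (id + G0 1 \<odot> V \<odot> P \<odot> V) \<odot> G0 2 \<odot> V \<odot> P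
          - P \<odot> V \<odot> G0 2 \<odot> (id + V \<odot> P \<odot> V \<odot> G0 1)
              \<odot> (id - W \<odot> (G0 0 - G0 1 \<odot> V \<odot> P))) u"
proof -
  define y where "y = G0 2 (V (P u))"
  define X where "X = S u + V (P (V (G0 1 (S u))))"
  define Y where "Y = V (P (V y))"
  have d: "G0 j x \<in> ell1_dual s" if "j \<le> 3" "x \<in> L" for j x using that by (rule G_dual_s)
  have XL: "X \<in> L" unfolding X_def by (rule ell1_add(1)[OF S_L[OF u] VP_L])
  have YL: "Y \<in> L" unfolding Y_def by (rule VP_L)
  have yd: "y \<in> ell1_dual s" unfolding y_def by (rule d[OF _ VP_L]) simp
  have b1: "b 1 = X - Y"
  proof -
    have "b 1 = S u - (V (P (V y)) - V (P (V (G0 1 (S u)))))"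
      unfolding b_1 y_def[symmetric] by (simp only: V_diff[OF P_dual P_dual])
    then show ?thesis unfolding X_def Y_def by (simp only: diff_diff_eq2)
  qed
  have G1: "G0 1 (b 1) = G0 1 X - G0 1 Y" and G2: "G0 2 (b 1) = G0 2 X - G0 2 Y"
    unfolding b1 by (rule G_diff[OF _ XL YL]; simp)+
  have "G0 1 X - G0 1 Y - y = G0 1 X - (y + G0 1 Y)" by (simp add: fun_eq_iff)
  then have "T (G0 1 (b 1) - y) = T (G0 1 X) - T (y + G0 1 Y)"
    by (simp only: G1 T_diff[OF d[OF _ XL] dual_add[OF yd d[OF _ YL]]] one_le_numeral)
  also have "T (G0 1 X) = - projection_of \<Gamma>t \<Psi>t u" unfolding X_def by (rule T_G1_S[OF u])
  finally have t: "T (G0 1 (b 1) - y) = - projection_of \<Gamma>t \<Psi>t u - T (y + G0 1 Y)" .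
  have "P (V (G0 2 (b 1))) = P (V (G0 2 X)) - P (V (G0 2 Y))"
    unfolding G2 by (rule PV_diff[OF d[OF _ XL] d[OF _ YL]]) simp_all
  then have "a 2 = (- projection_of \<Gamma>t \<Psi>t u - T (y + G0 1 Y)) - (P (V (G0 2 X)) - P (V (G0 2 Y))) + P (V (G0 3 (V (P u))))"
    using a_2[OF J4] by (simp only: y_def[symmetric] t)
  also have "\<dots> = - projection_of \<Gamma>t \<Psi>t u + P (V (G0 3 (V (P u)))) + P (V (G0 2 Y)) - T (y + G0 1 Y) - P (V (G0 2 X))"
    by (simp add: fun_eq_iff)
  finally show ?thesis
    by (simp only: X_def Y_def y_def S_def source_def minus_apply plus_fun_apply uminus_apply o_apply id_apply)
qed

end

section \<open>From the assumed expansion to the coefficient formulas\<close>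

context resonance4
begin

text \<open>An index shift by 1 and multiplication by \<kappa>. The expansion may run beyond the
  order in use, so surplus coefficients are moved into the remainder.\<close>

lemma resolvent_family_of_expansion:
  assumes G: "resolvent_expansion \<beta> H G" and u: "u \<in> L" and J: "J = 3 \<or> J = 4" "J + 1 \<le> \<beta>" "J = Suc m"
  shows "resolvent_family E0 xs \<beta> V v U \<Gamma> \<Psi> c \<Gamma>t ct u (\<lambda>\<kappa>. resolvent H \<kappa> u) (\<lambda>i. G (int i - 1) u) J m"
proof -
  let ?w = "\<lambda>\<kappa>. resolvent H \<kappa> u" and ?a = "\<lambda>i. G (int i - 1) u"
  obtain C where ev: "\<forall>\<^sub>F \<kappa> in right_filter. - (\<kappa>\<^sup>2) \<notin> spectrum H \<and>
        bounded_by (s - 1) (C * cmod \<kappa> ^ (\<beta> - 3))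
          (resolvent H \<kappa> - (\<Sum>j\<in>{-1..int \<beta> - 4}. (\<kappa> powi j) *\<^sub>C G j))"
    using G unfolding resolvent_expansion_def by blast
  have a_dual: "?a i \<in> ell1_dual (s - 1)" if "i < \<beta> - 2" for i
  proof -
    have "int i - 1 \<in> {-1..int \<beta> - 4}" using that by auto
    then obtain C where "bounded_by (s - 1) C (G (int i - 1))"
      using G unfolding resolvent_expansion_def by blast
    then show ?thesis using u by (simp add: bounded_by_def)
  qed
  have u2: "u \<in> ell2" by (rule ell1_subset_ell2[OF u]) (use beta4 in simp)
  have eq: "\<forall>\<^sub>F \<kappa> in right_filter. ?w \<kappa> \<in> ell2 \<and> H (?w \<kappa>) + \<kappa>\<^sup>2 *\<^sub>C ?w \<kappa> = u"
  proof (rule eventually_mono[OF ev])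
    fix \<kappa>
    let ?F = "H + \<kappa>\<^sup>2 *\<^sub>C id"
    assume "- (\<kappa>\<^sup>2) \<notin> spectrum H \<and> bounded_by (s - 1) (C * cmod \<kappa> ^ (\<beta> - 3))
          (resolvent H \<kappa> - (\<Sum>j\<in>{-1..int \<beta> - 4}. (\<kappa> powi j) *\<^sub>C G j))"
    \<comment> \<open>Off the spectrum the operator is onto, so \<open>inv_into\<close> is a right
      inverse and the resolvent equation holds.\<close>
    then have "bij_betw (H - (- (\<kappa>\<^sup>2)) *\<^sub>C id) ell2 ell2" by (simp add: spectrum_def)
    moreover have "H - (- (\<kappa>\<^sup>2)) *\<^sub>C id = ?F" by (simp only: scaleC_minus_left diff_minus_eq_add)
    ultimately have "?F ` ell2 = ell2" by (simp only: bij_betw_def)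
    then have "u \<in> ?F ` ell2" using u2 by simp
    from f_inv_into_f[OF this] inv_into_into[OF this]
    show "?w \<kappa> \<in> ell2 \<and> H (?w \<kappa>) + \<kappa>\<^sup>2 *\<^sub>C ?w \<kappa> = u"
      unfolding resolvent_def by (simp only: plus_fun_apply[of H] scaleC_fun_apply[of _ id] id_apply simp_thms)
  qed
  have mb: "m \<le> \<beta> - 2" using J by auto
  \<comment> \<open>The first summand bounds the remainder, which after multiplication by \<kappa>
    has order \<open>\<beta> - 2 \<ge> m\<close>; the second collects the coefficients from
    \<open>m\<close> on, whose powers are at most \<open>cmod \<kappa> ^ m\<close>.\<close>
  define K where "K = \<bar>C\<bar> * ell1_norm (s - 1) u + (\<Sum>i\<in>{m..<\<beta> - 2}. ell1_dual_norm (s - 1) (?a i))"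
  have expansion: "\<forall>\<^sub>F \<kappa> in right_filter. \<forall>x.
        cmod (\<kappa> * ?w \<kappa> x - (\<Sum>i<m. \<kappa> ^ i * ?a i x)) \<le> K * cmod \<kappa> ^ m * weight (s - 1) x"
  proof (rule eventually_mono[OF eventually_conj[OF ev eventually_right_small[OF zero_less_one]]], intro allI)
    fix \<kappa> x
    assume *: "(- (\<kappa>\<^sup>2) \<notin> spectrum H \<and> bounded_by (s - 1) (C * cmod \<kappa> ^ (\<beta> - 3))
          (resolvent H \<kappa> - (\<Sum>j\<in>{-1..int \<beta> - 4}. (\<kappa> powi j) *\<^sub>C G j))) \<and> 0 < Re \<kappa> \<and> cmod \<kappa> < 1"
    then have k0: "\<kappa> \<noteq> 0" by auto
    have pm: "cmod \<kappa> ^ i \<le> cmod \<kappa> ^ m" if "m \<le> i" for i using * that by (intro power_decreasing) auto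
    let ?r = "(resolvent H \<kappa> - (\<Sum>j\<in>{-1..int \<beta> - 4}. (\<kappa> powi j) *\<^sub>C G j)) u"
    have r: "?r \<in> ell1_dual (s - 1)" "ell1_dual_norm (s - 1) ?r \<le> C * cmod \<kappa> ^ (\<beta> - 3) * ell1_norm (s - 1) u"
      using * u by (simp_all add: bounded_by_def)
    have "(\<Sum>j\<in>{-1..int \<beta> - 4}. \<kappa> * (\<kappa> powi j * G j u x)) = (\<Sum>i<\<beta> - 2. \<kappa> * (\<kappa> powi (int i - 1) * ?a i x))"
    proof (rule sum.reindex_bij_witness[of _ "\<lambda>i. int i - 1" "\<lambda>j. nat (j + 1)"])
    qed (use beta4 in auto)
    also have "\<dots> = (\<Sum>i<\<beta> - 2. \<kappa> ^ i * ?a i x)"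
      by (intro sum.cong refl) (simp add: power_int_diff k0)
    finally have "\<kappa> * ?r x = \<kappa> * ?w \<kappa> x - (\<Sum>i<\<beta> - 2. \<kappa> ^ i * ?a i x)"
      unfolding minus_apply sum_fun_apply scaleC_fun_apply by (simp add: right_diff_distrib sum_distrib_left)
    also have "(\<Sum>i<\<beta> - 2. \<kappa> ^ i * ?a i x) = (\<Sum>i<m. \<kappa> ^ i * ?a i x) + (\<Sum>i\<in>{m..<\<beta> - 2}. \<kappa> ^ i * ?a i x)"
      using sum.atLeastLessThan_concat[of 0 m "\<beta> - 2" "\<lambda>i. \<kappa> ^ i * ?a i x"] mb by (simp add: lessThan_atLeast0)
    finally have "\<kappa> * ?w \<kappa> x - (\<Sum>i<m. \<kappa> ^ i * ?a i x) = \<kappa> * ?r x + (\<Sum>i\<in>{m..<\<beta> - 2}. \<kappa> ^ i * ?a i x)"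
      by (simp only: diff_diff_eq[symmetric] diff_add_cancel)
    then have "cmod (\<kappa> * ?w \<kappa> x - (\<Sum>i<m. \<kappa> ^ i * ?a i x)) \<le> cmod (\<kappa> * ?r x) + cmod (\<Sum>i\<in>{m..<\<beta> - 2}. \<kappa> ^ i * ?a i x)"
      by (simp only: norm_triangle_ineq)
    also have "\<dots> \<le> (\<bar>C\<bar> * ell1_norm (s - 1) u) * cmod \<kappa> ^ m * weight (s - 1) x
        + (\<Sum>i\<in>{m..<\<beta> - 2}. ell1_dual_norm (s - 1) (?a i)) * cmod \<kappa> ^ m * weight (s - 1) x"
    proof (rule add_mono)
      have "cmod (?r x) \<le> ell1_dual_norm (s - 1) ?r * weight (s - 1) x" by (rule ell1_dual_bound[OF r(1)])
      also have "\<dots> \<le> (C * cmod \<kappa> ^ (\<beta> - 3) * ell1_norm (s - 1) u) * weight (s - 1) x"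
        by (intro mult_right_mono r(2)) simp
      also have "\<dots> \<le> (\<bar>C\<bar> * cmod \<kappa> ^ (\<beta> - 3) * ell1_norm (s - 1) u) * weight (s - 1) x"
        by (intro mult_right_mono ell1_norm_nonneg) auto
      finally have "cmod \<kappa> * cmod (?r x) \<le> cmod \<kappa> * ((\<bar>C\<bar> * cmod \<kappa> ^ (\<beta> - 3) * ell1_norm (s - 1) u) * weight (s - 1) x)"
        by (intro mult_left_mono) auto
      also have "\<dots> = (\<bar>C\<bar> * ell1_norm (s - 1) u) * cmod \<kappa> ^ Suc (\<beta> - 3) * weight (s - 1) x"
        by (simp add: mult_ac)
      also have "\<dots> \<le> (\<bar>C\<bar> * ell1_norm (s - 1) u) * cmod \<kappa> ^ m * weight (s - 1) x"
        using J beta4 by (intro mult_right_mono mult_left_mono pm mult_nonneg_nonneg ell1_norm_nonneg) auto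
      finally show "cmod (\<kappa> * ?r x) \<le> (\<bar>C\<bar> * ell1_norm (s - 1) u) * cmod \<kappa> ^ m * weight (s - 1) x"
        by (simp only: norm_mult)
      show "cmod (\<Sum>i\<in>{m..<\<beta> - 2}. \<kappa> ^ i * ?a i x)
          \<le> (\<Sum>i\<in>{m..<\<beta> - 2}. ell1_dual_norm (s - 1) (?a i)) * cmod \<kappa> ^ m * weight (s - 1) x"
        unfolding sum_distrib_right
      proof (rule sum_norm_le)
        fix i assume i: "i \<in> {m..<\<beta> - 2}"
        have "cmod (\<kappa> ^ i * ?a i x) \<le> cmod \<kappa> ^ m * (ell1_dual_norm (s - 1) (?a i) * weight (s - 1) x)"
          unfolding norm_mult norm_power using i by (intro mult_mono pm ell1_dual_bound a_dual) auto
        then show "cmod (\<kappa> ^ i * ?a i x) \<le> ell1_dual_norm (s - 1) (?a i) * cmod \<kappa> ^ m * weight (s - 1) x"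
          by (simp add: mult_ac)
      qed
    qed
    also have "\<dots> = K * cmod \<kappa> ^ m * weight (s - 1) x" unfolding K_def by (simp add: distrib_right)
    finally show "cmod (\<kappa> * ?w \<kappa> x - (\<Sum>i<m. \<kappa> ^ i * ?a i x)) \<le> K * cmod \<kappa> ^ m * weight (s - 1) x" .
  qed
  show ?thesis
  proof (intro resolvent_family.intro resolvent_family_axioms.intro)
    show "resonance4 E0 xs \<beta> V v U \<Gamma> \<Psi> c \<Gamma>t ct" by (rule resonance4_axioms)
    show "\<exists>C. \<forall>\<^sub>F \<kappa> in right_filter. \<forall>x.
        cmod (\<kappa> * ?w \<kappa> x - (\<Sum>i<m. \<kappa> ^ i * ?a i x)) \<le> C * cmod \<kappa> ^ m * weight (s - 1) x"
      using expansion by blast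
  qed (use J u eq a_dual mb in auto)
qed

theorem expansion_coefficient_0:
  assumes "resolvent_expansion \<beta> H G" "u \<in> L"
  shows "G 0 u = (G0 0 - P \<odot> V \<odot> G0 1 - G0 1 \<odot> V \<odot> P
          - (G0 0 - P \<odot> V \<odot> G0 1) \<odot> W \<odot> (G0 0 - G0 1 \<odot> V \<odot> P)
          + P \<odot> V \<odot> G0 2 \<odot> V \<odot> P) u"
proof -
  have "resolvent_family E0 xs \<beta> V v U \<Gamma> \<Psi> c \<Gamma>t ct u (\<lambda>\<kappa>. resolvent H \<kappa> u) (\<lambda>i. G (int i - 1) u) 3 2"
    by (rule resolvent_family_of_expansion[OF assms]) (use beta4 in auto)
  from resolvent_family.coefficient_0[OF this] show ?thesis by simp
qed

theorem expansion_coefficient_1: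
  assumes "resolvent_expansion \<beta> H G" "u \<in> L" "5 \<le> \<beta>"
  shows "G 1 u = (- projection_of \<Gamma>t \<Psi>t + P \<odot> V \<odot> G0 3 \<odot> V \<odot> P
          + P \<odot> V \<odot> G0 2 \<odot> V \<odot> P \<odot> V \<odot> G0 2 \<odot> V \<odot> P
          - T \<odot> (id + G0 1 \<odot> V \<odot> P \<odot> V) \<odot> G0 2 \<odot> V \<odot> P
          - P \<odot> V \<odot> G0 2 \<odot> (id + V \<odot> P \<odot> V \<odot> G0 1)
              \<odot> (id - W \<odot> (G0 0 - G0 1 \<odot> V \<odot> P))) u"
proof -
  have "resolvent_family E0 xs \<beta> V v U \<Gamma> \<Psi> c \<Gamma>t ct u (\<lambda>\<kappa>. resolvent H \<kappa> u) (\<lambda>i. G (int i - 1) u) 4 3"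
    by (rule resolvent_family_of_expansion[OF assms(1,2)]) (use assms(3) in auto)
  from resolvent_family.coefficient_1[OF this refl] show ?thesis by simp
qed

end

text \<open>The powers in the expansion end at \<open>\<beta> - 4\<close>, which explains the guards
  \<open>4 \<le> \<beta>\<close> and \<open>5 \<le> \<beta>\<close>. The operator identities are
  stated on \<open>ell1 (\<beta> - 1)\<close>, where the expansion determines its
  coefficients.\<close>

theorem theoremB3:
  fixes E0 :: "'v::finite set set" and xs :: "'n::finite \<Rightarrow> 'v"
    and V H P Pt :: "('v, 'n) op"
    and G0 :: "nat \<Rightarrow> ('v, 'n) op"
    and v :: "'k::complex_hilbert \<Rightarrow> ('v, 'n) state" and U :: "'k \<Rightarrow> 'k"
    and M0 :: "'k \<Rightarrow> 'k" and W :: "('v, 'n) op"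
    and \<beta> :: nat
    and \<Gamma> :: "'i set" and \<Psi> :: "'i \<Rightarrow> ('v, 'n) state" and c :: "'i \<Rightarrow> complex ^ 'n"
    and \<Gamma>t :: "'j set" and \<Psi>t :: "'j \<Rightarrow> ('v, 'n) state" and ct :: "'j \<Rightarrow> complex ^ 'n"
  assumes graph: "connected_simple_graph E0"
    and beta: "3 \<le> \<beta>"
    and A: "assumption_A (real \<beta>) V v U"
    and H: "H = free_ham E0 xs + V"
    and G0: "G0 = free_coeff E0 xs"
    and M0: "M0 = U + adjoint_of v \<odot> G0 0 \<odot> v"
    and W: "W = v \<odot> pseudo_inverse M0 \<odot> adjoint_of v"
    and first_kind: "eigenspace \<beta> H \<subset> bdd_eigenspace \<beta> H" "eigenspace \<beta> H = {0}"
    and res_basis: "resonance_basis \<beta> H \<Gamma> \<Psi>"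
    and P: "P = projection_of \<Gamma> \<Psi>"
    and c: "\<And>\<gamma>. c \<gamma> = (\<chi> \<alpha>. - \<langle>n_vec \<alpha>, V (\<Psi> \<gamma>)\<rangle>)"
    and ct: "orthonormal_basis (\<Gamma> <+> \<Gamma>t) (case_sum c ct)"
    and \<Psi>t: "\<And>\<gamma>. \<Psi>t \<gamma> = (id - (G0 0 - P \<odot> V \<odot> G0 1) \<odot> W) (n_comb (ct \<gamma>))"
    and Pt: "Pt = projection_of \<Gamma>t \<Psi>t"
  shows "(\<forall>G. resolvent_expansion \<beta> H G \<longrightarrow>
      (4 \<le> \<beta> \<longrightarrow> (\<forall>u\<in>ell1 (real \<beta> - 1). G 0 u =
         (G0 0 - P \<odot> V \<odot> G0 1 - G0 1 \<odot> V \<odot> P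
          - (G0 0 - P \<odot> V \<odot> G0 1) \<odot> W \<odot> (G0 0 - G0 1 \<odot> V \<odot> P)
          + P \<odot> V \<odot> G0 2 \<odot> V \<odot> P) u)) \<and>
      (5 \<le> \<beta> \<longrightarrow> (\<forall>u\<in>ell1 (real \<beta> - 1). G 1 u =
         (- Pt + P \<odot> V \<odot> G0 3 \<odot> V \<odot> P
          + P \<odot> V \<odot> G0 2 \<odot> V \<odot> P \<odot> V \<odot> G0 2 \<odot> V \<odot> P
          - (id - (G0 0 - P \<odot> V \<odot> G0 1) \<odot> W) \<odot> (id + G0 1 \<odot> V \<odot> P \<odot> V) \<odot> G0 2 \<odot> V \<odot> P
          - P \<odot> V \<odot> G0 2 \<odot> (id + V \<odot> P \<odot> V \<odot> G0 1)
              \<odot> (id - W \<odot> (G0 0 - G0 1 \<odot> V \<odot> P))) u)))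
    \<and> nonresonance_basis \<beta> H \<Gamma>t \<Psi>t
    \<and> (\<forall>\<Psi>1\<in>gen_eigenspace \<beta> H. \<forall>\<Psi>2\<in>bdd_eigenspace \<beta> H. \<forall>c1 c2.
         \<Psi>1 - n_comb c1 \<in> one_plus_ell1 (real \<beta> - 2) \<longrightarrow>
         \<Psi>2 - one_comb c2 \<in> ell1 (real \<beta> - 2) \<longrightarrow>
         (\<Sum>\<alpha>\<in>UNIV. cnj (c2 $ \<alpha>) * c1 $ \<alpha>) = 0)"
proof -
  \<comment> \<open>The operators given by equations in the statement are identified with the
    constants of the locales; \<open>resonance4\<close> is instantiated only where
    \<open>4 \<le> \<beta>\<close> is available.\<close>
  have sc: "scattering E0 \<beta> V v U"
    by (intro scattering.intro core_graph.intro scattering_axioms.intro graph beta A)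
  have res: "resonance E0 xs \<beta> V v U \<Gamma> \<Psi> c \<Gamma>t ct"
    by (intro resonance.intro resonance_axioms.intro sc first_kind(2)[unfolded H] res_basis[unfolded H] c ct)
  have W': "W = scattering.W E0 xs v U"
    unfolding scattering.W_def[OF sc] scattering.M0_def[OF sc] W M0 G0 ..
  have T': "id - (G0 0 - P \<odot> V \<odot> G0 1) \<odot> W = resonance.T E0 xs V v U \<Gamma> \<Psi>"
    unfolding resonance.T_def[OF res] W' P G0 ..
  have \<Psi>t': "\<Psi>t = resonance.\<Psi>t E0 xs V v U \<Gamma> \<Psi> ct"
    by (rule ext) (simp only: \<Psi>t T' resonance.\<Psi>t_def[OF res])
  have res4: "resonance4 E0 xs \<beta> V v U \<Gamma> \<Psi> c \<Gamma>t ct" if "4 \<le> \<beta>"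
    by (intro resonance4.intro resonance4_axioms.intro res that)
  show ?thesis
  proof (intro conjI allI impI ballI)
    fix G :: "int \<Rightarrow> ('v, 'n) op" and u :: "('v, 'n) state" assume "resolvent_expansion \<beta> H G" "4 \<le> \<beta>" "u \<in> ell1 (real \<beta> - 1)"
    then show "G 0 u =
         (G0 0 - P \<odot> V \<odot> G0 1 - G0 1 \<odot> V \<odot> P
          - (G0 0 - P \<odot> V \<odot> G0 1) \<odot> W \<odot> (G0 0 - G0 1 \<odot> V \<odot> P)
          + P \<odot> V \<odot> G0 2 \<odot> V \<odot> P) u"
      using resonance4.expansion_coefficient_0[OF res4, of G u] unfolding W' P G0 H by blast
  next
    fix G :: "int \<Rightarrow> ('v, 'n) op" and u :: "('v, 'n) state" assume "resolvent_expansion \<beta> H G" "5 \<le> \<beta>" "u \<in> ell1 (real \<beta> - 1)"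
    moreover from this have "4 \<le> \<beta>" by simp
    ultimately show "G 1 u =
         (- Pt + P \<odot> V \<odot> G0 3 \<odot> V \<odot> P
          + P \<odot> V \<odot> G0 2 \<odot> V \<odot> P \<odot> V \<odot> G0 2 \<odot> V \<odot> P
          - (id - (G0 0 - P \<odot> V \<odot> G0 1) \<odot> W) \<odot> (id + G0 1 \<odot> V \<odot> P \<odot> V) \<odot> G0 2 \<odot> V \<odot> P
          - P \<odot> V \<odot> G0 2 \<odot> (id + V \<odot> P \<odot> V \<odot> G0 1)
              \<odot> (id - W \<odot> (G0 0 - G0 1 \<odot> V \<odot> P))) u"
      using resonance4.expansion_coefficient_1[OF res4, of G u] unfolding T' Pt \<Psi>t' unfolding W' P G0 H by blast
  next
    show "nonresonance_basis \<beta> H \<Gamma>t \<Psi>t"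
      unfolding \<Psi>t' H by (rule resonance.nonresonance_basis_\<Psi>t[OF res])
  next
    fix \<Psi>1 \<Psi>2 c1 c2
    assume "\<Psi>1 \<in> gen_eigenspace \<beta> H" "\<Psi>2 \<in> bdd_eigenspace \<beta> H"
      "\<Psi>1 - n_comb c1 \<in> one_plus_ell1 (real \<beta> - 2)" "\<Psi>2 - one_comb c2 \<in> ell1 (real \<beta> - 2)"
    then have "cdot c2 c1 = 0"
      unfolding H by (rule resonance.coefficients_orthogonal[OF res])
    then show "(\<Sum>\<alpha>\<in>UNIV. cnj (c2 $ \<alpha>) * c1 $ \<alpha>) = 0" by (simp add: cdot_def)
  qed
qed

end
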